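(* Assume that either $$f_L(t_1^* )<f_R(t_1^* )\ \text{ and }\ f_L(t_2^* )>f_R(t_2^* ),$$ or $$f_L(t_1^* )>f_R(t_1^* )\ \text{ and }\ f_L(t_2^* )<f_R(t_2^* ).$$ Then there exists a large constant $V_*\gg 1$, which depends only on $f_L$ and $f_R$, such that almost every orbit whose initial speed satisfies $|v_0|>V_*$ eventually gains energy exponentially in time. In particular, the set of initial conditions $(t_0,v_0)$ whose orbits do not enjoy exponential energy growth has finite measure.
   Context: Setting (rectangular billiard with two moving slits). The table is the unit square $[0,1]\times[0,1]$ with coordinates $(x,y)$. Fix $\lambda\in(0,1)$ and $x_0$ with $0\le x_0<\lambda$. Let $f_L,f_R:\mathbb{R}\to(0,1)$ be $C^2$ functions, periodic with period $2$. At time $t$ there are two horizontal slits of zero thickness: the left slit $\{0\le x\le\lambda,\ y=f_L(t)\}$ and the right slit $\{\lambda\le x\le 1,\ y=f_R(t)\}$. A massless ball moves freely between collisions, with horizontal speed always equal to $1$. It reflects elastically from the boundary of the square and from the slits: the vertical velocity $w$ becomes $-w$ at the floor $y=0$ and at the ceiling $y=1$, and becomes $-w+2\dot f_\bullet(t)$ at a collision at time $t$ with the slit of height $f_\bullet$, $\bullet\in\{L,R\}$; the horizontal velocity is reversed at $x=0$ and $x=1$. The horizontal position is $x_0$ at time $0$, moving to the right, so it is $2$-periodic in time. Within each period the ball passes from the left part to the right part of the table at time $t_1^*=\lambda-x_0$ and from the right part to the left part at time $t_2^*=2-\lambda-x_0$ (mod $2$). Thus the slit relevant to the ball at time $t$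 (mod $2$) has height $$f(t)=\begin{cases} f_L(t) & 0<t<t_1^*\ \text{or}\ t_2^*<t<2,\\ f_R(t) & t_1^*<t<t_2^*.\end{cases}$$ At the times $t_1^*,t_2^*$ the vertical position and velocity of the ball are continuous; after such a time the ball is in the upper (resp. lower) chamber, i.e. above (resp. below) the current slit, according to its height relative to the new slit. Orbits are recorded by $(t_n,v_n)$, $n\ge0$, where $t_n$ (mod $2$) is the time of the $n$-th collision with a slit and $v_n$ is the vertical velocity immediately after that collision; $(t_0,v_0)$ is the initial condition. Orbits having a collision at $x=\lambda$ (a set of measure zero) are excluded. "Measure" and "almost every" refer to Lebesgue measure in $(t_0,v_0)\in(\mathbb{R}/2\mathbb{Z})\times\mathbb{R}$. Write $v(t)$ for the vertical velocity of the ball after an elapsed time $t$ since the initial collision. Since the horizontal speed is constant, energy growth means growth of $|v|$; an orbit "gains energy exponentially in time" if there are constants $c,\zeta>0$ with $|v(t)|\ge c\,e^{\zeta t}$ for all sufficiently large $t$. *)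

theory Defs
  imports "HOL-Analysis.Analysis"
begin

definition C2 :: "(real \<Rightarrow> real) \<Rightarrow> bool" where
  "C2 f \<longleftrightarrow> f C1_differentiable_on UNIV \<and> deriv f C1_differentiable_on UNIV"

text \<open>The horizontal motion is 2-periodic, starts at \<open>x0\<close> moving to the right, and passes
  \<open>x = lam\<close> rightwards at \<open>t1 lam x0\<close> and leftwards at \<open>t2 lam x0\<close>, modulo 2.\<close>

definition t1 :: "real \<Rightarrow> real \<Rightarrow> real" where
  "t1 lam x0 = lam - x0"

definition t2 :: "real \<Rightarrow> real \<Rightarrow> real" where
  "t2 lam x0 = 2 - lam - x0"

definition passage :: "real \<Rightarrow> real \<Rightarrow> real \<Rightarrow> bool" where
  "passage lam x0 t \<longleftrightarrow> (\<exists>k::int. t = t1 lam x0 + 2 * of_int k \<or> t = t2 lam x0 + 2 * of_int k)"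

definition on_right :: "real \<Rightarrow> real \<Rightarrow> real \<Rightarrow> bool" where
  "on_right lam x0 t \<longleftrightarrow> (\<exists>k::int. t1 lam x0 + 2 * of_int k < t \<and> t < t2 lam x0 + 2 * of_int k)"

text \<open>Selects the quantity attached to the slit below or above the ball: the slit height for
  \<open>(gL, gR) = (fL, fR)\<close> and the slit velocity for \<open>(gL, gR) = (deriv fL, deriv fR)\<close>. The value
  at a passage time is irrelevant, since collisions at passage times are excluded below.\<close>

definition current :: "real \<Rightarrow> real \<Rightarrow> (real \<Rightarrow> real) \<Rightarrow> (real \<Rightarrow> real) \<Rightarrow> real \<Rightarrow> real" where
  "current lam x0 gL gR t = (if on_right lam x0 t then gR t else gL t)"

definition contact ::
  "real \<Rightarrow> real \<Rightarrow> (real \<Rightarrow> real) \<Rightarrow> (real \<Rightarrow> real) \<Rightarrow> (real \<Rightarrow> real) \<Rightarrow> real \<Rightarrow> bool" where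
  "contact lam x0 fL fR y t \<longleftrightarrow> y t = 0 \<or> y t = 1 \<or> y t = current lam x0 fL fR t"

text \<open>\<open>y t\<close> is the height of the ball at (absolute) time \<open>t \<ge> t0\<close> and \<open>w t\<close> its vertical
  velocity, taken immediately after the collision when \<open>t\<close> is a collision time. The conditions
  are, in order: the ball is on the slit at time \<open>t0\<close> and leaves it with velocity \<open>v0\<close>; it stays
  in the table; it has finitely many collisions in bounded time; it moves freely between
  collisions, in particular across passage times; it is reflected at floor and ceiling, and at the
  slit, where \<open>u\<close> is the velocity just before the collision; it does not pass through the slit
  (the reflection law leaves this open only for tangential contacts); and it has no collision at
  \<open>x = lam\<close>, where both slits end. The restriction of \<open>y\<close> and \<open>w\<close> to times from \<open>t0\<close> on is
  determined by \<open>t0\<close> and \<open>v0\<close>, if an orbit exists at all.\<close>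

definition slit_orbit ::
  "real \<Rightarrow> real \<Rightarrow> (real \<Rightarrow> real) \<Rightarrow> (real \<Rightarrow> real) \<Rightarrow> real \<Rightarrow> real \<Rightarrow>
   (real \<Rightarrow> real) \<Rightarrow> (real \<Rightarrow> real) \<Rightarrow> bool" where
  "slit_orbit lam x0 fL fR t0 v0 y w \<longleftrightarrow>
     y t0 = current lam x0 fL fR t0 \<and> w t0 = v0 \<and>
     (\<forall>t\<ge>t0. 0 \<le> y t \<and> y t \<le> 1) \<and>
     (\<forall>T. finite {t. t0 < t \<and> t \<le> T \<and> contact lam x0 fL fR y t}) \<and>
     (\<forall>s t. t0 \<le> s \<and> s < t \<and> (\<forall>r\<in>{s<..<t}. \<not> contact lam x0 fL fR y r) \<longrightarrow>
        (\<forall>r\<in>{s<..<t}. w r = w s) \<and> y t = y s + w s * (t - s)) \<and>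
     (\<forall>t>t0. y t = 0 \<or> y t = 1 \<longrightarrow>
        (\<exists>u. (w \<longlongrightarrow> u) (at_left t) \<and> w t = - u)) \<and>
     (\<forall>t>t0. y t = current lam x0 fL fR t \<longrightarrow>
        (\<exists>u. (w \<longlongrightarrow> u) (at_left t) \<and> w t = - u + 2 * current lam x0 (deriv fL) (deriv fR) t)) \<and>
     (\<forall>s t. t0 \<le> s \<and> s < t \<and> (\<forall>r\<in>{s..t}. \<not> passage lam x0 r) \<longrightarrow>
        (\<forall>r\<in>{s..t}. current lam x0 fL fR r \<le> y r) \<or>
        (\<forall>r\<in>{s..t}. y r \<le> current lam x0 fL fR r)) \<and>
     (\<forall>t\<ge>t0. passage lam x0 t \<longrightarrow> y t \<notin> {0, 1, fL t, fR t})"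

text \<open>The orbit is required to exist for all times, so initial conditions whose orbit is excluded
  (or has infinitely many collisions in bounded time) do not have exponential energy growth.
  The argument \<open>t\<close> of the growth condition is the time elapsed since \<open>t0\<close>.\<close>

definition exp_energy_growth ::
  "real \<Rightarrow> real \<Rightarrow> (real \<Rightarrow> real) \<Rightarrow> (real \<Rightarrow> real) \<Rightarrow> real \<Rightarrow> real \<Rightarrow> bool" where
  "exp_energy_growth lam x0 fL fR t0 v0 \<longleftrightarrow>
     (\<exists>y w. slit_orbit lam x0 fL fR t0 v0 y w \<and>
       (\<exists>c>0. \<exists>\<zeta>>0. \<forall>\<^sub>F t in at_top. c * exp (\<zeta> * t) \<le> \<bar>w (t0 + t)\<bar>))"

end

theory Submission
  imports Defs
begin

text \<open>Between the floor and a slit of height \<open>f\<close> the quantity \<open>\<bar>w f - f' y\<bar>\<close> is unchanged by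
  collisions and has bounded derivative, so the speed times the width of the chamber is constant
  up to a bounded error. If the slit is raised at both passages, a ball below the slits stays below
  and its speed grows by a factor \<open>> 1\<close> per period, up to a bounded error, whereas the speed of a
  ball that stays above shrinks by a factor \<open>< 1\<close>. Let \<open>N\<close> be the set of states at time \<open>t1\<close> whose
  orbits are never both below and fast. For large \<open>W\<close> the period map sends \<open>N \<inter> {\<bar>w\<bar> \<le> W}\<close> into
  \<open>N \<inter> {\<bar>w\<bar> \<le> \<theta> W}\<close> with \<open>\<theta> < 1\<close>. As it preserves area, \<open>N\<close> is a null set at large speeds.

  For this to make sense, almost no orbit may have infinitely many collisions in bounded time.
  If time is cut into \<open>n\<close> equal steps, two collisions with the slit in one step force the relative
  speed to be \<open>O(1/n)\<close> and the distance to the slit to be \<open>O(1/n^2)\<close>; since the steps do not expand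
  area, the initial states for which this happens in one of the \<open>n\<close> steps have area \<open>O(1/n^2)\<close>.

  If the slit is lowered at both passages, the table is turned upside down.\<close>

section \<open>Motion in a chamber\<close>

text \<open>Two measures are in play. On states at a fixed time the motion preserves area, which
  drives both the exclusion of accumulating collisions and the argument for \<open>N\<close>.
  Initial conditions \<open>(t, v)\<close> on the slit carry instead the density
  \<open>|v - f' t|\<close> with respect to that area. It vanishes only on a curve, so null sets can
  be pulled back to initial conditions although areas are not preserved; this suffices, as the
  conclusion needs only null sets at large speed and a bounded box below.

  The argument for \<open>N\<close> uses the area inequality alone: if a set of finite area lies in
  the preimage of one of its subsets, the difference is null. Finiteness is why speeds are cut off
  at \<open>W\<close>; a geometric sequence of cut-offs then exhausts the large speeds. The errors
  of the adiabatic invariant are bounded independently of the speed, so a multiplicative gain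
  absorbs them once the speed is large; this is the origin of the threshold.

  The set of growing initial conditions is not shown to be Borel. It is identified, up to a null
  set, with a Borel set pulled back from the section at \<open>t1\<close>.\<close>

definition wall :: "real \<Rightarrow> real \<Rightarrow> real \<Rightarrow> (real \<Rightarrow> real) \<Rightarrow> bool" where
  "wall a M K f \<longleftrightarrow> 0 < a \<and> 0 \<le> M \<and> 0 \<le> K \<and> (\<forall>t. (f has_real_derivative deriv f t) (at t)) \<and>
     (\<forall>t. a \<le> f t \<and> f t \<le> 1 - a) \<and> (\<forall>t. \<bar>deriv f t\<bar> \<le> M) \<and>
     (\<forall>s t. \<bar>deriv f s - deriv f t\<bar> \<le> K * \<bar>s - t\<bar>)"

lemma wall_facts:
  assumes "wall a M K f"
  shows "0 < a" "0 \<le> M" "0 \<le> K" "a \<le> f t" "0 < f t" "f t < 1" "\<bar>deriv f t\<bar> \<le> M"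
proof -
  have "0 < a \<and> 0 \<le> M \<and> 0 \<le> K \<and> a \<le> f t \<and> f t \<le> 1 - a \<and> \<bar>deriv f t\<bar> \<le> M"
    using assms unfolding wall_def by blast
  then show "0 < a" "0 \<le> M" "0 \<le> K" "a \<le> f t" "0 < f t" "f t < 1" "\<bar>deriv f t\<bar> \<le> M" by linarith+
qed

text \<open>The third case covers times without collision, so that one equation can be required at
  every time. For a wall the first two cases do not overlap, as the slit never touches the
  floor.\<close>

definition bounce :: "(real \<Rightarrow> real) \<Rightarrow> real \<Rightarrow> real \<Rightarrow> real \<Rightarrow> real" where
  "bounce f t y u = (if y = 0 then - u else if y = f t then - u + 2 * deriv f t else u)"

text \<open>The motion between the floor and the slit is described by its germs on both sides of every time.
  This avoids enumerating the collisions; that they do not accumulate follows by compactness.\<close>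

definition below :: "(real \<Rightarrow> real) \<Rightarrow> real \<Rightarrow> real \<Rightarrow> (real \<Rightarrow> real) \<Rightarrow> (real \<Rightarrow> real) \<Rightarrow> bool" where
  "below f p q y w \<longleftrightarrow>
     (\<forall>t\<in>{p..q}. 0 \<le> y t \<and> y t \<le> f t) \<and>
     (\<forall>t\<in>{p..<q}. \<forall>\<^sub>F r in at_right t.
        w r = w t \<and> y r = y t + w t * (r - t) \<and> 0 < y r \<and> y r < f r) \<and>
     (\<forall>t\<in>{p<..q}. \<exists>u. (\<forall>\<^sub>F r in at_left t.
        w r = u \<and> y r = y t + u * (r - t) \<and> 0 < y r \<and> y r < f r) \<and> w t = bounce f t (y t) u)"

definition reach_below :: "(real \<Rightarrow> real) \<Rightarrow> real \<Rightarrow> real \<Rightarrow> real \<times> real \<Rightarrow> real \<times> real \<Rightarrow> bool" where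
  "reach_below f p q x x' \<longleftrightarrow> (\<exists>y w. below f p q y w \<and> (y p, w p) = x \<and> (y q, w q) = x')"

definition flip :: "real \<times> real \<Rightarrow> real \<times> real" where
  "flip x = (1 - fst x, - snd x)"

text \<open>Turned upside down, a motion above the slit becomes one below the slit of height
  \<open>1 - f\<close>, so only one chamber has to be analysed.\<close>

definition reach :: "(real \<Rightarrow> real) \<Rightarrow> real \<Rightarrow> real \<Rightarrow> real \<times> real \<Rightarrow> real \<times> real \<Rightarrow> bool" where
  "reach f p q x x' \<longleftrightarrow>
     reach_below f p q x x' \<or> reach_below (\<lambda>t. 1 - f t) p q (flip x) (flip x')"

text \<open>Arbitrary if no motion that starts in \<open>x\<close> at time \<open>p\<close> lasts until time \<open>q\<close>.\<close>

definition flow :: "(real \<Rightarrow> real) \<Rightarrow> real \<Rightarrow> real \<Rightarrow> real \<times> real \<Rightarrow> real \<times> real" where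
  "flow f p q x = (SOME x'. reach f p q x x')"

lemma flip_flip [simp]: "flip (flip x) = x"
  by (simp add: flip_def)

text \<open>The supremum of the times up to which \<open>Q\<close> has held throughout must be
  \<open>q\<close>: \<open>left\<close> gives \<open>Q\<close> at the supremum and
  \<open>right\<close> would push it further. This form fits \<open>below\<close>, whose clauses are
  germs to the right and to the left of each time.\<close>

lemma real_induction [consumes 2, case_names base right left]:
  fixes p q t :: real
  assumes t: "p \<le> t" "t \<le> q"
    and base: "Q p"
    and right: "\<And>t. p \<le> t \<Longrightarrow> t < q \<Longrightarrow> (\<And>r. p \<le> r \<Longrightarrow> r \<le> t \<Longrightarrow> Q r) \<Longrightarrow> \<forall>\<^sub>F r in at_right t. Q r"
    and left: "\<And>t. p < t \<Longrightarrow> t \<le> q \<Longrightarrow> (\<And>r. p \<le> r \<Longrightarrow> r < t \<Longrightarrow> Q r) \<Longrightarrow> Q t"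
  shows "Q t"
proof -
  have "p \<le> q" using t by simp
  define S where "S = {t. p \<le> t \<and> t \<le> q \<and> (\<forall>r\<in>{p..t}. Q r)}"
  have S: "p \<in> S" "bdd_above S" "S \<noteq> {}"
    using \<open>p \<le> q\<close> base by (auto simp: S_def intro!: bdd_aboveI[of _ q])
  define s where "s = Sup S"
  have s: "p \<le> s" "s \<le> q"
    using S unfolding s_def by (auto intro!: cSup_upper cSup_least simp: S_def)
  have lt: "Q r" if "p \<le> r" "r < s" for r
  proof -
    obtain t where "t \<in> S" "r < t"
      using \<open>r < s\<close> S less_cSup_iff[of S r] by (auto simp: s_def)
    then show ?thesis using \<open>p \<le> r\<close> by (auto simp: S_def)
  qed
  have Qs: "Q s"
    using s lt base left[of s] by (cases "s = p") auto
  then have le: "Q r" if "p \<le> r" "r \<le> s" for r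
    using lt that by (cases "r = s") auto
  have "s = q"
  proof (rule ccontr)
    assume "s \<noteq> q"
    then have "s < q" using s by simp
    then have "\<forall>\<^sub>F r in at_right s. Q r" using right[of s] s le by auto
    then obtain b where b: "b > s" "\<And>r. s < r \<Longrightarrow> r < b \<Longrightarrow> Q r"
      unfolding eventually_at_right_field by blast
    define t where "t = min q ((s + b) / 2)"
    have t: "s < t" "t < b" "t \<le> q" using \<open>s < q\<close> b(1) by (auto simp: t_def min_def)
    have "Q r" if "r \<in> {p..t}" for r
      using le[of r] b(2)[of r] that t by (cases "r \<le> s") auto
    then have "t \<in> S" using s t by (auto simp: S_def)
    then have "t \<le> s" using S by (auto simp: s_def intro: cSup_upper)
    then show False using t by simp
  qed
  then show ?thesis using le t by simp
qed

lemma below_right: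
  assumes "below f p q y w" "p \<le> t" "t < q"
  shows "\<forall>\<^sub>F r in at_right t. w r = w t \<and> y r = y t + w t * (r - t) \<and> 0 < y r \<and> y r < f r"
  using assms unfolding below_def by auto

lemma below_left:
  assumes "below f p q y w" "p < t" "t \<le> q"
  obtains u where "\<forall>\<^sub>F r in at_left t. w r = u \<and> y r = y t + u * (r - t) \<and> 0 < y r \<and> y r < f r"
    "w t = bounce f t (y t) u"
proof -
  have "t \<in> {p<..q}" using assms by simp
  then show ?thesis using assms(1) that unfolding below_def by blast
qed

lemma below_range:
  assumes "below f p q y w" "p \<le> t" "t \<le> q"
  shows "0 \<le> y t" "y t \<le> f t"
  using assms unfolding below_def by auto

lemma eventually_in_at_left: "p < t \<Longrightarrow> \<forall>\<^sub>F r in at_left t. p < r \<and> r < t" for t :: real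
  using eventually_at_left_real[of p t] by simp

text \<open>The state determines its right germ. At a later time the left germ, an affine function
  known by induction, determines the height and the incoming velocity, and \<open>bounce\<close>
  then the outgoing one.\<close>

lemma below_unique:
  assumes b: "below f p q y w" "below f p q y' w'" and init: "y p = y' p" "w p = w' p"
    and t: "p \<le> t" "t \<le> q"
  shows "y t = y' t \<and> w t = w' t"
  using t
proof (induction t rule: real_induction)
  case base
  then show ?case using init by simp
next
  case (right t)
  have "y t = y' t \<and> w t = w' t" using right by auto
  then have "y t = y' t" "w t = w' t" by auto
  show ?case
    using below_right[OF b(1) right(1,2)] below_right[OF b(2) right(1,2)]
  proof eventually_elim
    case (elim r)
    have "y r = y' r" "w r = w' r"
      using elim unfolding \<open>y t = y' t\<close> \<open>w t = w' t\<close> by linarith+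
    then show ?case by blast
  qed
next
  case (left t)
  obtain u where u: "\<forall>\<^sub>F r in at_left t. w r = u \<and> y r = y t + u * (r - t) \<and> 0 < y r \<and> y r < f r"
    "w t = bounce f t (y t) u" using below_left[OF b(1) left(1,2)] .
  obtain u' where u': "\<forall>\<^sub>F r in at_left t. w' r = u' \<and> y' r = y' t + u' * (r - t) \<and> 0 < y' r \<and> y' r < f r"
    "w' t = bounce f t (y' t) u'" using below_left[OF b(2) left(1,2)] .
  have "\<forall>\<^sub>F r in at_left t. u = u' \<and> y t = y' t"
    using u(1) u'(1) eventually_in_at_left[OF left(1)]
  proof eventually_elim
    case (elim r)
    then show ?case using left(3)[of r] by auto
  qed
  then have "u = u' \<and> y t = y' t" by (simp add: trivial_limit_at_left_real)
  then show ?case using u u' by auto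
qed

text \<open>At the joint \<open>q\<close> the left germ comes from the first motion and the right
  germ from the second; the states agree there.\<close>

lemma below_append:
  assumes 1: "below f p q y w" and 2: "below f q s y' w'" and j: "y q = y' q" "w q = w' q" and pq: "p \<le> q" "q \<le> s"
  shows "below f p s (\<lambda>t. if t < q then y t else y' t) (\<lambda>t. if t < q then w t else w' t)"
    (is "below f p s ?y ?w")
  unfolding below_def
proof (intro conjI ballI)
  fix t assume t: "t \<in> {p..s}"
  show "0 \<le> ?y t" "?y t \<le> f t"
    using t below_range[OF 1, of t] below_range[OF 2, of t] by auto
next
  fix t assume t: "t \<in> {p..<s}"
  show "\<forall>\<^sub>F r in at_right t. ?w r = ?w t \<and> ?y r = ?y t + ?w t * (r - t) \<and> 0 < ?y r \<and> ?y r < f r"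
  proof (cases "t < q")
    case True
    have "\<forall>\<^sub>F r in at_right t. t < r \<and> r < q" using eventually_at_right_real[OF True] by simp
    moreover have "\<forall>\<^sub>F r in at_right t. w r = w t \<and> y r = y t + w t * (r - t) \<and> 0 < y r \<and> y r < f r"
      using below_right[OF 1, of t] t True by simp
    ultimately show ?thesis by eventually_elim (use True in auto)
  next
    case False
    have "\<forall>\<^sub>F r in at_right t. t < r" by (simp add: eventually_at_filter)
    moreover have "\<forall>\<^sub>F r in at_right t. w' r = w' t \<and> y' r = y' t + w' t * (r - t) \<and> 0 < y' r \<and> y' r < f r"
      using below_right[OF 2, of t] t False by simp
    ultimately show ?thesis by eventually_elim (use False in auto)
  qed
next
  fix t assume t: "t \<in> {p<..s}"
  show "\<exists>u. (\<forall>\<^sub>F r in at_left t. ?w r = u \<and> ?y r = ?y t + u * (r - t) \<and> 0 < ?y r \<and> ?y r < f r) \<and> ?w t = bounce f t (?y t) u"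
  proof (cases "t \<le> q")
    case True
    obtain u where u: "\<forall>\<^sub>F r in at_left t. w r = u \<and> y r = y t + u * (r - t) \<and> 0 < y r \<and> y r < f r"
      "w t = bounce f t (y t) u" using below_left[OF 1, of t] t True by auto
    have e: "?y t = y t" "?w t = w t" using True j by (cases "t = q"; simp)+
    have "\<forall>\<^sub>F r in at_left t. p < r \<and> r < t" using t eventually_in_at_left by simp
    with u(1) have "\<forall>\<^sub>F r in at_left t. ?w r = u \<and> ?y r = ?y t + u * (r - t) \<and> 0 < ?y r \<and> ?y r < f r"
      unfolding e by eventually_elim (use True in auto)
    then show ?thesis using u(2) unfolding e by blast
  next
    case False
    obtain u where u: "\<forall>\<^sub>F r in at_left t. w' r = u \<and> y' r = y' t + u * (r - t) \<and> 0 < y' r \<and> y' r < f r"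
      "w' t = bounce f t (y' t) u" using below_left[OF 2, of t] t False by auto
    have "\<forall>\<^sub>F r in at_left t. q < r \<and> r < t" using False eventually_in_at_left by simp
    with u(1) have "\<forall>\<^sub>F r in at_left t. ?w r = u \<and> ?y r = ?y t + u * (r - t) \<and> 0 < ?y r \<and> ?y r < f r"
      by eventually_elim (use False in auto)
    then show ?thesis using u(2) False by (intro exI[of _ u]) simp
  qed
qed

lemma reach_below_trans:
  assumes "reach_below f p q x x'" "reach_below f q s x' x''" "p \<le> q" "q \<le> s"
  shows "reach_below f p s x x''"
proof -
  obtain y w where 1: "below f p q y w" "(y p, w p) = x" "(y q, w q) = x'"
    using assms unfolding reach_below_def by auto
  obtain y' w' where 2: "below f q s y' w'" "(y' q, w' q) = x'" "(y' s, w' s) = x''"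
    using assms unfolding reach_below_def by auto
  have j: "y q = y' q" "w q = w' q" using 1 2 by auto
  let ?y = "\<lambda>t. if t < q then y t else y' t" and ?w = "\<lambda>t. if t < q then w t else w' t"
  have "?y p = y p" "?w p = w p" using j assms(3) by (cases "p = q"; simp)+
  then have "(?y p, ?w p) = x" using 1(2) by simp
  moreover have "(?y s, ?w s) = x''" using 2(3) assms(4) by simp
  ultimately show ?thesis
    unfolding reach_below_def using below_append[OF 1(1) 2(1) j assms(3,4)] by blast
qed

lemma reach_below_refl:
  assumes "0 \<le> fst x" "fst x \<le> f p" shows "reach_below f p p x x"
  unfolding reach_below_def
  by (rule exI[of _ "\<lambda>_. fst x"], rule exI[of _ "\<lambda>_. snd x"]) (use assms in \<open>auto simp: below_def\<close>)

lemma reach_below_unique: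
  assumes "reach_below f p q x x'" "reach_below f p q x x''" "p \<le> q"
  shows "x' = x''"
proof -
  obtain y w where 1: "below f p q y w" "(y p, w p) = x" "(y q, w q) = x'"
    using assms(1) unfolding reach_below_def by blast
  obtain y' w' where 2: "below f p q y' w'" "(y' p, w' p) = x" "(y' q, w' q) = x''"
    using assms(2) unfolding reach_below_def by blast
  have "y p = y' p" "w p = w' p" using 1(2) 2(2) by auto
  then show ?thesis
    using below_unique[OF 1(1) 2(1) _ _ assms(3) order_refl] 1(3) 2(3) by auto
qed

lemma reach_below_range:
  assumes "reach_below f p q x x'" "p \<le> q"
  shows "0 \<le> fst x" "fst x \<le> f p" "0 \<le> fst x'" "fst x' \<le> f q"
  using assms below_range[of f p q _ _ p] below_range[of f p q _ _ q] unfolding reach_below_def by auto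

text \<open>The building block of all explicit motions. At its ends the flight only has to lie in
  the closed chamber, so it may start on a wall and end in a collision, which \<open>bounce\<close>
  then performs.\<close>

lemma reach_below_flight:
  assumes pq: "p < q" and range: "0 \<le> y0" "y0 \<le> f p" "0 \<le> y0 + w0 * (q - p)" "y0 + w0 * (q - p) \<le> f q"
    and inside: "\<And>r. p < r \<Longrightarrow> r < q \<Longrightarrow> 0 < y0 + w0 * (r - p) \<and> y0 + w0 * (r - p) < f r"
  shows "reach_below f p q (y0, w0) (y0 + w0 * (q - p), bounce f q (y0 + w0 * (q - p)) w0)"
proof -
  define y where "y = (\<lambda>r. y0 + w0 * (r - p))"
  define w where "w = (\<lambda>r. if r < q then w0 else bounce f q (y q) w0)"
  have "below f p q y w"
    unfolding below_def
  proof (intro conjI ballI)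
    fix t assume "t \<in> {p..q}"
    then show "0 \<le> y t" "y t \<le> f t"
      using range inside[of t] by (cases "t = p"; cases "t = q"; auto simp: y_def)+
  next
    fix t assume t: "t \<in> {p..<q}"
    then have "\<forall>\<^sub>F r in at_right t. t < r \<and> r < q" using eventually_at_right_real[of t q] by simp
    then show "\<forall>\<^sub>F r in at_right t. w r = w t \<and> y r = y t + w t * (r - t) \<and> 0 < y r \<and> y r < f r"
      by eventually_elim (use t inside in \<open>auto simp: y_def w_def algebra_simps\<close>)
  next
    fix t assume t: "t \<in> {p<..q}"
    then have "\<forall>\<^sub>F r in at_left t. p < r \<and> r < t" using eventually_in_at_left by simp
    then have "\<forall>\<^sub>F r in at_left t. w r = w0 \<and> y r = y t + w0 * (r - t) \<and> 0 < y r \<and> y r < f r"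
      by eventually_elim (use t inside in \<open>auto simp: y_def w_def algebra_simps\<close>)
    moreover have "w t = bounce f t (y t) w0"
      using t inside[of t] by (cases "t = q") (auto simp: w_def bounce_def y_def)
    ultimately show "\<exists>u. (\<forall>\<^sub>F r in at_left t. w r = u \<and> y r = y t + u * (r - t) \<and> 0 < y r \<and> y r < f r) \<and> w t = bounce f t (y t) u"
      by blast
  qed
  then show ?thesis
    unfolding reach_below_def using pq
    by (intro exI[of _ y] exI[of _ w]) (auto simp: y_def w_def)
qed

text \<open>A start on the slit belongs to both closed chambers, but just afterwards the height is
  strictly on one side. Hence the side is unique on every interval of positive length.\<close>

lemma reach_excl:
  assumes "p < q" "reach_below f p q x x'" "reach_below (\<lambda>t. 1 - f t) p q (flip x) x''"
  shows False
proof -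
  obtain y w where 1: "below f p q y w" "(y p, w p) = x" using assms(2) unfolding reach_below_def by blast
  obtain y' w' where 2: "below (\<lambda>t. 1 - f t) p q y' w'" "(y' p, w' p) = flip x"
    using assms(3) unfolding reach_below_def by blast
  have e: "y' p = 1 - y p" "w' p = - w p" using 2(2) unfolding 1(2)[symmetric] flip_def by simp_all
  from eventually_happens'[OF _ eventually_conj[OF below_right[OF 1(1) order_refl assms(1)]
      below_right[OF 2(1) order_refl assms(1)]]]
  obtain r where "y r = y p + w p * (r - p)" "y r < f r" "y' r = y' p + w' p * (r - p)" "y' r < 1 - f r"
    by (metis trivial_limit_at_right_real)
  moreover have "w' p * (r - p) = - (w p * (r - p))" unfolding e(2) by simp
  ultimately show False using e(1) by linarith
qed

lemma reach_unique:
  assumes "p < q" "reach f p q x x'" "reach f p q x x''"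
  shows "x' = x''"
  using assms(2,3) unfolding reach_def
proof (elim disjE)
  assume "reach_below f p q x x'" "reach_below f p q x x''"
  then show ?thesis using reach_below_unique assms(1) by (meson less_imp_le)
next
  assume "reach_below (\<lambda>t. 1 - f t) p q (flip x) (flip x')" "reach_below (\<lambda>t. 1 - f t) p q (flip x) (flip x'')"
  then have "flip x' = flip x''" using reach_below_unique assms(1) by (meson less_imp_le)
  then show ?thesis by (metis flip_flip)
qed (use reach_excl[OF assms(1)] in blast)+

lemma flow_eq:
  assumes "p < q" "reach f p q x x'"
  shows "flow f p q x = x'"
  unfolding flow_def using assms reach_unique by (blast intro: some_equality)

lemma reach_range:
  assumes "reach f p q x x'" "p \<le> q"
  shows "fst x < f p \<Longrightarrow> reach_below f p q x x'"
    "fst x > f p \<Longrightarrow> reach_below (\<lambda>t. 1 - f t) p q (flip x) (flip x')"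
  using assms reach_below_range[of f p q x x'] reach_below_range[of "\<lambda>t. 1 - f t" p q "flip x" "flip x'"]
  unfolding reach_def by (auto simp: flip_def)

text \<open>The constants treat floor and ceiling alike, and curvature enters only through a
  Lipschitz bound, so every estimate below a slit transfers to the other chamber with the same
  constants.\<close>

lemma wall_flip: "wall a M K f \<Longrightarrow> wall a M K (\<lambda>t. 1 - f t)"
  and deriv_flip: "wall a M K f \<Longrightarrow> deriv (\<lambda>t. 1 - f t) t = - deriv f t"
proof -
  have d: "((\<lambda>t. 1 - f t) has_real_derivative - deriv f t) (at t)" if "wall a M K f" for t
    using that by (auto simp: wall_def intro!: derivative_eq_intros)
  show e: "deriv (\<lambda>t. 1 - f t) t = - deriv f t" if "wall a M K f" for t
    using d[OF that] by (rule DERIV_imp_deriv)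
  show "wall a M K (\<lambda>t. 1 - f t)" if w: "wall a M K f"
  proof -
    have k: "\<bar>- deriv f s - - deriv f t\<bar> \<le> K * \<bar>s - t\<bar>" for s t
    proof -
      have "\<bar>deriv f s - deriv f t\<bar> \<le> K * \<bar>s - t\<bar>" using w by (auto simp: wall_def)
      then show ?thesis by linarith
    qed
    have b: "a \<le> 1 - f t \<and> 1 - f t \<le> 1 - a" "\<bar>- deriv f t\<bar> \<le> M" for t
      using w unfolding wall_def by (simp_all add: algebra_simps)
    show ?thesis using w unfolding wall_def[of _ _ _ "\<lambda>t. 1 - f t"] e[OF w]
      by (intro conjI allI d b k) (simp_all add: wall_def)
  qed
qed

lemma wall_mvt:
  assumes "wall a M K f" "s < t"
  obtains z where "s < z" "z < t" "f t - f s = deriv f z * (t - s)"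
proof -
  obtain z where "s < z \<and> z < t \<and> f t - f s = (t - s) * deriv f z"
    using MVT2[of s t f "deriv f"] assms by (auto simp: wall_def)
  then show ?thesis using that by (auto simp: mult.commute)
qed

text \<open>The slope may be taken at any \<open>z\<close> of a window containing the interval. With
  \<open>z\<close> at the start of a time step, one slope serves the whole step.\<close>

lemma wall_taylor:
  assumes "wall a M K f" "c \<le> s" "s \<le> t" "t \<le> d" "c \<le> z" "z \<le> d"
  shows "\<bar>f t - f s - deriv f z * (t - s)\<bar> \<le> K * (d - c) * (t - s)"
proof (cases "s = t")
  case False
  then have "s < t" using assms by simp
  then obtain r where r: "s < r" "r < t" "f t - f s = deriv f r * (t - s)"
    using wall_mvt[OF assms(1)] by blast
  have "\<bar>deriv f r - deriv f z\<bar> \<le> K * \<bar>r - z\<bar>" using assms(1) by (auto simp: wall_def)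
  also have "\<dots> \<le> K * (d - c)"
    using assms r by (intro mult_left_mono) (auto simp: wall_def)
  finally have "\<bar>deriv f r - deriv f z\<bar> * (t - s) \<le> K * (d - c) * (t - s)"
    using \<open>s < t\<close> by (intro mult_right_mono) auto
  then show ?thesis using \<open>s < t\<close> unfolding r(3)
    by (simp add: left_diff_distrib[symmetric] abs_mult)
qed simp

text \<open>The quantity \<open>w * f - f' * y\<close> changes sign at every collision and has derivative \<open>- f'' * y\<close>
  in between, so its modulus is an adiabatic invariant at all energies.\<close>

definition action :: "(real \<Rightarrow> real) \<Rightarrow> real \<Rightarrow> real \<times> real \<Rightarrow> real" where
  "action f t x = \<bar>snd x * f t - deriv f t * fst x\<bar>"

lemma action_flight:
  assumes wall: "wall a M K f" and "s \<le> t" and range: "0 \<le> y" "y \<le> 1" "0 \<le> y + w * (t - s)" "y + w * (t - s) \<le> 1"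
  shows "\<bar>action f t (y + w * (t - s), w) - action f s (y, w)\<bar> \<le> 2 * K * (t - s)"
proof -
  define h where "h = t - s"
  define e where "e = f t - f s - deriv f t * h"
  have h: "0 \<le> h" using assms(2) by (simp add: h_def)
  have K: "0 \<le> K" using wall by (simp add: wall_def)
  \<comment> \<open>The ball stays in the table, so it travels at most 1. Hence the speed is
    absorbed by one of the two factors \<open>h\<close> of the Taylor remainder, and the estimate
    becomes independent of \<open>w\<close>.\<close>
  have wh: "\<bar>w\<bar> * h \<le> 1"
    using range h by (auto simp: h_def[symmetric] abs_if)
  have "\<bar>e\<bar> \<le> K * h * h"
    using wall_taylor[OF wall, of s s t t t] assms(2) by (simp add: e_def h_def)
  then have "\<bar>w\<bar> * \<bar>e\<bar> \<le> \<bar>w\<bar> * (K * h * h)" by (rule mult_left_mono) simp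
  also have "\<dots> = (\<bar>w\<bar> * h) * (K * h)" by (simp only: ac_simps)
  also have "\<dots> \<le> 1 * (K * h)" using wh by (rule mult_right_mono) (use K h in simp)
  finally have 1: "\<bar>w * e\<bar> \<le> K * h" by (simp add: abs_mult)
  have "\<bar>deriv f t - deriv f s\<bar> \<le> K * \<bar>t - s\<bar>" using wall unfolding wall_def by blast
  then have "\<bar>deriv f t - deriv f s\<bar> \<le> K * h" using h by (simp add: h_def)
  then have "\<bar>deriv f t - deriv f s\<bar> * y \<le> (K * h) * 1"
    using range h K by (intro mult_mono) simp_all
  then have 2: "\<bar>(deriv f t - deriv f s) * y\<bar> \<le> K * h" using range by (simp add: abs_mult)
  have "(w * f t - deriv f t * (y + w * h)) - (w * f s - deriv f s * y)
     = w * e - (deriv f t - deriv f s) * y" by (simp add: e_def algebra_simps)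
  moreover have "2 * K * (t - s) = K * h + K * h" by (simp add: h_def)
  ultimately show ?thesis using 1 2 unfolding action_def h_def[symmetric] fst_conv snd_conv by linarith
qed

lemma action_bounce: "action f t (y, bounce f t y u) = action f t (y, u)"
  by (auto simp: action_def bounce_def algebra_simps abs_minus_commute)

text \<open>Flights change the action at a rate of at most \<open>2 * K\<close> and collisions leave
  it fixed, so the bound adds up without counting the collisions.\<close>

lemma below_action:
  assumes wall: "wall a M K f" and b: "below f p q y w" and t: "p \<le> t" "t \<le> q"
  shows "\<bar>action f t (y t, w t) - action f p (y p, w p)\<bar> \<le> 2 * K * (t - p)"
proof -
  have f1: "f t \<le> 1" for t using wall_facts(6)[OF wall, of t] by simp
  have y: "0 \<le> y t" "y t \<le> 1" if "p \<le> t" "t \<le> q" for t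
    using below_range[OF b that] f1[of t] by auto
  show ?thesis
    using t
  proof (induction t rule: real_induction)
    case base
    then show ?case by simp
  next
    case (right t)
    have IH: "\<bar>action f t (y t, w t) - action f p (y p, w p)\<bar> \<le> 2 * K * (t - p)" using right by auto
    have "\<forall>\<^sub>F r in at_right t. t < r \<and> r < q" using eventually_at_right_real[of t q] right by simp
    then show ?case using below_right[OF b right(1,2)]
    proof eventually_elim
      case (elim r)
      then have "\<bar>action f r (y r, w r) - action f t (y t, w t)\<bar> \<le> 2 * K * (r - t)"
        using action_flight[OF wall, of t r "y t" "w t"] y[of t] y[of r] right by auto
      then show ?case using IH by (simp add: algebra_simps)
    qed
  next
    case (left t)
    obtain u where u: "\<forall>\<^sub>F r in at_left t. w r = u \<and> y r = y t + u * (r - t) \<and> 0 < y r \<and> y r < f r"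
      "w t = bounce f t (y t) u" using below_left[OF b left(1,2)] .
    have "\<exists>r. (w r = u \<and> y r = y t + u * (r - t) \<and> 0 < y r \<and> y r < f r) \<and> p < r \<and> r < t"
      using eventually_happens'[OF _ eventually_conj[OF u(1) eventually_in_at_left[OF left(1)]]]
      by (simp add: trivial_limit_at_left_real)
    then obtain r where r: "w r = u" "y r = y t + u * (r - t)" "p < r" "r < t" by auto
    have yt: "y t = y r + u * (t - r)" using r by (simp add: algebra_simps)
    have "\<bar>action f t (y r + u * (t - r), u) - action f r (y r, u)\<bar> \<le> 2 * K * (t - r)"
    proof (rule action_flight[OF wall])
      have "y r + u * (t - r) = y t" using yt by (rule sym)
      then show "0 \<le> y r + u * (t - r)" "y r + u * (t - r) \<le> 1" using y[of t] left(1,2) by linarith+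
      show "0 \<le> y r" "y r \<le> 1" using y[of r] r(3,4) left(2) by linarith+
      show "r \<le> t" using r by simp
    qed
    moreover have "\<bar>action f r (y r, w r) - action f p (y p, w p)\<bar> \<le> 2 * K * (r - p)"
      using left(3)[of r] r by simp
    ultimately show ?case using r(1) unfolding u(2) action_bounce yt[symmetric]
      by (simp add: algebra_simps)
  qed
qed

lemma action_speed:
  assumes "wall a M K f" "0 \<le> fst x" "fst x \<le> 1"
  shows "\<bar>action f t x - \<bar>snd x\<bar> * f t\<bar> \<le> M"
proof -
  have "\<bar>deriv f t\<bar> * fst x \<le> M * 1" using assms by (intro mult_mono) (auto simp: wall_def)
  then have "\<bar>deriv f t * fst x\<bar> \<le> M" using assms by (simp add: abs_mult)
  moreover have "\<bar>snd x\<bar> * f t = \<bar>snd x * f t\<bar>"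
    using assms by (auto simp: wall_def abs_mult) (smt (verit))
  ultimately show ?thesis unfolding action_def by linarith
qed

text \<open>At either end the action differs from speed times width by at most \<open>M\<close>. The
  total error does not depend on the speed, so it is negligible for fast balls.\<close>

lemma below_speed:
  assumes wall: "wall a M K f" and b: "below f p q y w" and t: "p \<le> t" "t \<le> q"
  shows "\<bar>\<bar>w t\<bar> * f t - \<bar>w p\<bar> * f p\<bar> \<le> 2 * M + 2 * K * (q - p)"
proof -
  have f1: "f t \<le> 1" for t using wall_facts(6)[OF wall, of t] by simp
  have y: "0 \<le> y t" "y t \<le> 1" if "p \<le> t" "t \<le> q" for t
    using below_range[OF b that] f1[of t] by auto
  have "2 * K * (t - p) \<le> 2 * K * (q - p)" using wall t by (intro mult_left_mono) (auto simp: wall_def)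
  then show ?thesis
    using below_action[OF wall b t] action_speed[OF wall, of "(y t, w t)" t] action_speed[OF wall, of "(y p, w p)" p]
      y[of t] y[of p] t by simp
qed

lemma reach_below_speed:
  assumes "wall a M K f" "reach_below f p q x x'" "p \<le> q"
  shows "\<bar>\<bar>snd x'\<bar> * f q - \<bar>snd x\<bar> * f p\<bar> \<le> 2 * M + 2 * K * (q - p)"
  using assms below_speed[OF assms(1), of p q _ _ q] unfolding reach_below_def by fastforce

section \<open>Volume and collisions\<close>

text \<open>A one-sided form of volume preservation. Only preimages are measured, and pieces with
  disjoint targets \<open>R\<close> can be put together without knowing that \<open>F\<close> is injective.\<close>

definition nonexpanding :: "'a::euclidean_space set \<Rightarrow> 'a set \<Rightarrow> ('a \<Rightarrow> 'a) \<Rightarrow> bool" where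
  "nonexpanding A R F \<longleftrightarrow> A \<in> sets borel \<and> R \<in> sets borel \<and>
     (\<forall>B\<in>sets borel. A \<inter> F -` B \<in> sets borel \<and> emeasure lborel (A \<inter> F -` B) \<le> emeasure lborel (B \<inter> R))"

lemma nonexpandingD:
  assumes "nonexpanding A R F"
  shows "A \<in> sets borel" "R \<in> sets borel" "\<And>B. B \<in> sets borel \<Longrightarrow> A \<inter> F -` B \<in> sets borel"
    "\<And>B. B \<in> sets borel \<Longrightarrow> emeasure lborel (A \<inter> F -` B) \<le> emeasure lborel (B \<inter> R)"
  using assms by (auto simp: nonexpanding_def)

lemma nonexpanding_le:
  assumes "nonexpanding A R F" "B \<in> sets borel"
  shows "emeasure lborel (A \<inter> F -` B) \<le> emeasure lborel B"
  by (rule order_trans[OF nonexpandingD(4)[OF assms]]) (use assms in \<open>auto intro: emeasure_mono\<close>)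

lemma nonexpanding_cong:
  assumes "nonexpanding A R F" "\<And>x. x \<in> A \<Longrightarrow> F x = G x"
  shows "nonexpanding A R G"
proof -
  have "A \<inter> F -` B = A \<inter> G -` B" for B using assms(2) by auto
  then show ?thesis using assms(1) by (simp add: nonexpanding_def)
qed

lemma nonexpanding_comp:
  assumes F: "nonexpanding A R F" and G: "nonexpanding A' R' G"
  shows "nonexpanding (A \<inter> F -` A') R' (G \<circ> F)"
  unfolding nonexpanding_def
proof (intro conjI ballI)
  show "A \<inter> F -` A' \<in> sets borel" "R' \<in> sets borel" using nonexpandingD[OF F] nonexpandingD[OF G] by auto
  fix B :: "'a set" assume B: "B \<in> sets borel"
  have e: "A \<inter> F -` A' \<inter> (G \<circ> F) -` B = A \<inter> F -` (A' \<inter> G -` B)" by auto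
  show "A \<inter> F -` A' \<inter> (G \<circ> F) -` B \<in> sets borel" unfolding e using nonexpandingD(3)[OF F nonexpandingD(3)[OF G B]] .
  show "emeasure lborel (A \<inter> F -` A' \<inter> (G \<circ> F) -` B) \<le> emeasure lborel (B \<inter> R')"
    unfolding e using nonexpanding_le[OF F nonexpandingD(3)[OF G B]] nonexpandingD(4)[OF G B] by (rule order_trans)
qed

lemma nonexpanding_mono:
  assumes "nonexpanding A R F" "A' \<subseteq> A" "R \<subseteq> R'" "A' \<in> sets borel" "R' \<in> sets borel"
  shows "nonexpanding A' R' F"
  unfolding nonexpanding_def
proof (intro conjI ballI assms(4,5))
  fix B :: "'a set" assume B: "B \<in> sets borel"
  have e: "A' \<inter> F -` B = A' \<inter> (A \<inter> F -` B)" using assms(2) by auto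
  show s: "A' \<inter> F -` B \<in> sets borel" unfolding e using nonexpandingD(3)[OF assms(1) B] assms(4) by simp
  have "emeasure lborel (A' \<inter> F -` B) \<le> emeasure lborel (A \<inter> F -` B)"
    using nonexpandingD(3)[OF assms(1) B] assms(2) by (intro emeasure_mono) auto
  also have "\<dots> \<le> emeasure lborel (B \<inter> R)" using nonexpandingD(4)[OF assms(1) B] .
  also have "\<dots> \<le> emeasure lborel (B \<inter> R')"
    using B assms by (intro emeasure_mono) auto
  finally show "emeasure lborel (A' \<inter> F -` B) \<le> emeasure lborel (B \<inter> R')" .
qed

lemma nonexpanding_union:
  assumes 1: "nonexpanding A R F" and 2: "nonexpanding A' R' F" and disj: "R \<inter> R' = {}"
  shows "nonexpanding (A \<union> A') (R \<union> R') F"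
  unfolding nonexpanding_def
proof (intro conjI ballI)
  show "A \<union> A' \<in> sets borel" "R \<union> R' \<in> sets borel" using nonexpandingD[OF 1] nonexpandingD[OF 2] by auto
  fix B :: "'a set" assume B: "B \<in> sets borel"
  have e: "(A \<union> A') \<inter> F -` B = (A \<inter> F -` B) \<union> (A' \<inter> F -` B)" by auto
  show "(A \<union> A') \<inter> F -` B \<in> sets borel" unfolding e using nonexpandingD(3)[OF 1 B] nonexpandingD(3)[OF 2 B] by simp
  have "emeasure lborel ((A \<union> A') \<inter> F -` B) \<le> emeasure lborel (A \<inter> F -` B) + emeasure lborel (A' \<inter> F -` B)"
    unfolding e using nonexpandingD(3)[OF 1 B] nonexpandingD(3)[OF 2 B] by (intro emeasure_subadditive) simp_all
  also have "\<dots> \<le> emeasure lborel (B \<inter> R) + emeasure lborel (B \<inter> R')"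
    using nonexpandingD(4)[OF 1 B] nonexpandingD(4)[OF 2 B] by (rule add_mono)
  also have "\<dots> = emeasure lborel (B \<inter> R \<union> B \<inter> R')"
    using nonexpandingD(2)[OF 1] nonexpandingD(2)[OF 2] B disj by (intro plus_emeasure) auto
  also have "B \<inter> R \<union> B \<inter> R' = B \<inter> (R \<union> R')" by auto
  finally show "emeasure lborel ((A \<union> A') \<inter> F -` B) \<le> emeasure lborel (B \<inter> (R \<union> R'))" .
qed

section \<open>Area by slices of constant velocity; shears and reflections\<close>

lemma emeasure_slices:
  fixes S :: "(real \<times> real) set"
  assumes "S \<in> sets borel"
  shows "emeasure lborel S = (\<integral>\<^sup>+ w. emeasure lborel ((\<lambda>y. (y, w)) -` S) \<partial>lborel)"
proof -
  have "S \<in> sets (lborel \<Otimes>\<^sub>M lborel)" unfolding lborel_prod using assms by simp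
  from lborel_pair.emeasure_pair_measure_alt2[OF this] show ?thesis unfolding lborel_prod .
qed

lemma slice_borel [measurable]:
  fixes S :: "(real \<times> real) set"
  assumes "S \<in> sets borel" shows "(\<lambda>y. (y, w)) -` S \<in> sets borel"
  by (rule measurable_sets_borel[OF _ assms]) (intro borel_measurable_continuous_onI continuous_intros)

lemma emeasure_slices_le:
  fixes S S' :: "(real \<times> real) set"
  assumes "S \<in> sets borel" "S' \<in> sets borel"
    "\<And>w. emeasure lborel {y. (y, w) \<in> S} \<le> emeasure lborel {y. (y, w) \<in> S'}"
  shows "emeasure lborel S \<le> emeasure lborel S'"
  using assms unfolding emeasure_slices[OF assms(1)] emeasure_slices[OF assms(2)]
  by (intro nn_integral_mono) (auto simp: vimage_def)

lemma nonexpanding_reflect: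
  fixes e :: "'a::euclidean_space"
  assumes A: "A \<in> sets borel" and R: "R \<in> sets borel" and sub: "\<And>x. x \<in> A \<Longrightarrow> e - x \<in> R"
  shows "nonexpanding A R (\<lambda>x. e - x)"
  unfolding nonexpanding_def
proof (intro conjI ballI A R)
  fix B :: "'a set" assume B: "B \<in> sets borel"
  have m: "(\<lambda>x. e - x) \<in> borel_measurable borel"
    by (intro borel_measurable_continuous_onI continuous_intros)
  show s: "A \<inter> (\<lambda>x. e - x) -` B \<in> sets borel" using A measurable_sets_borel[OF m B] by simp
  have "lborel = distr lborel borel (\<lambda>x. e - x)"
    using lborel_affine[of "-1" e] by (simp add: density_1)
  then have d: "emeasure lborel (B \<inter> R) = emeasure (distr lborel borel (\<lambda>x. e - x)) (B \<inter> R)" by simp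
  have "emeasure lborel (A \<inter> (\<lambda>x. e - x) -` B) \<le> emeasure lborel ((\<lambda>x. e - x) -` (B \<inter> R))"
    using sub measurable_sets_borel[OF m, of "B \<inter> R"] B R by (intro emeasure_mono) auto
  also have "\<dots> = emeasure lborel (B \<inter> R)" unfolding d using m B R by (subst emeasure_distr) auto
  finally show "emeasure lborel (A \<inter> (\<lambda>x. e - x) -` B) \<le> emeasure lborel (B \<inter> R)" .
qed

lemma nonexpanding_restrict:
  assumes m: "nonexpanding A R F" and R': "R' \<in> sets borel" and sub: "\<And>x. x \<in> A \<Longrightarrow> F x \<in> R'"
  shows "nonexpanding A (R \<inter> R') F"
  unfolding nonexpanding_def
proof (intro conjI ballI)
  show "A \<in> sets borel" "R \<inter> R' \<in> sets borel" using nonexpandingD[OF m] R' by auto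
  fix B :: "'a set" assume B: "B \<in> sets borel"
  have e: "A \<inter> F -` B = A \<inter> F -` (B \<inter> R')" using sub by auto
  have BR: "B \<inter> R' \<in> sets borel" using B R' by auto
  show "A \<inter> F -` B \<in> sets borel" using nonexpandingD(3)[OF m B] .
  have "B \<inter> (R \<inter> R') = B \<inter> R' \<inter> R" by auto
  then show "emeasure lborel (A \<inter> F -` B) \<le> emeasure lborel (B \<inter> (R \<inter> R'))"
    using nonexpandingD(4)[OF m BR] unfolding e by simp
qed

lemma flip_eq: "flip = (\<lambda>x. (1, 0) - x)"
  by (auto simp: flip_def fun_eq_iff prod_eq_iff)

lemma flip_measurable [measurable]: "flip \<in> borel_measurable borel"
  unfolding flip_def by (intro borel_measurable_continuous_onI continuous_intros)

lemma nonexpanding_flip: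
  assumes "A \<in> sets borel" shows "nonexpanding (flip -` A) A flip"
  unfolding flip_eq
  by (rule nonexpanding_reflect) (use assms measurable_sets_borel[OF flip_measurable assms] in \<open>auto simp: flip_eq\<close>)

text \<open>This is free flight for a time \<open>h\<close>. On the slice of constant velocity
  \<open>w\<close> it is the translation by \<open>w * h\<close>.\<close>

lemma nonexpanding_shear:
  assumes A: "A \<in> sets borel" and R: "R \<in> sets borel" and sub: "\<And>y w. (y, w) \<in> A \<Longrightarrow> (y + w * h, w) \<in> R"
  shows "nonexpanding A R (\<lambda>(y, w). (y + w * h, w :: real) :: real \<times> real)" (is "nonexpanding A R ?F")
  unfolding nonexpanding_def
proof (intro conjI ballI A R)
  fix B :: "(real\<times>real) set" assume B: "B \<in> sets borel"
  have m: "?F \<in> borel_measurable borel"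
    unfolding split_beta by (intro borel_measurable_continuous_onI continuous_intros)
  show s: "A \<inter> ?F -` B \<in> sets borel" using A measurable_sets_borel[OF m B] by auto
  have BR: "B \<inter> R \<in> sets borel" using B R by auto
  show "emeasure lborel (A \<inter> ?F -` B) \<le> emeasure lborel (B \<inter> R)"
  proof (rule emeasure_slices_le[OF s BR])
    fix w :: real
    have b: "{y. (y, w) \<in> B \<inter> R} \<in> sets borel" using slice_borel[OF BR] by (simp add: vimage_def)
    have "emeasure lborel {y. (y, w) \<in> A \<inter> ?F -` B} \<le> emeasure lborel ((+) (w * h) -` {y. (y, w) \<in> B \<inter> R})"
      using sub by (intro emeasure_mono) (auto simp: add.commute intro!: measurable_sets_borel[OF _ b, simplified])
    also have "\<dots> = emeasure (distr lborel borel ((+) (w * h))) {y. (y, w) \<in> B \<inter> R}"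
      using b by (subst emeasure_distr) auto
    finally show "emeasure lborel {y. (y, w) \<in> A \<inter> ?F -` B} \<le> emeasure lborel {y. (y, w) \<in> B \<inter> R}"
      by (simp add: lborel_distr_plus)
  qed
qed

lemma wall_measurable:
  assumes "wall a M K f"
  shows "f \<in> borel_measurable borel" "deriv f \<in> borel_measurable borel" "continuous_on S f" "continuous_on S (deriv f)"
proof -
  show c: "continuous_on S f" for S using assms
    by (intro continuous_at_imp_continuous_on ballI DERIV_isCont) (auto simp: wall_def)
  have "K-lipschitz_on UNIV (deriv f)"
    using assms by (intro lipschitz_onI) (auto simp: wall_def dist_real_def)
  then have d: "continuous_on UNIV (deriv f)" by (rule lipschitz_on_continuous_on)
  then show "continuous_on S (deriv f)" by (rule continuous_on_subset) simp
  show "f \<in> borel_measurable borel" "deriv f \<in> borel_measurable borel"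
    using c d by (auto intro: borel_measurable_continuous_onI)
qed

lemma wall_deriv_near:
  assumes "wall a M K f" "c \<le> t" "t \<le> d"
  shows "\<bar>deriv f t - deriv f c\<bar> \<le> K * (d - c)"
proof -
  have "\<bar>deriv f t - deriv f c\<bar> \<le> K * \<bar>t - c\<bar>" using assms unfolding wall_def by blast
  also have "\<dots> \<le> K * (d - c)" using assms by (intro mult_left_mono) (auto simp: wall_def)
  finally show ?thesis .
qed

text \<open>A collision is described by its time \<open>\<tau>\<close> and the velocity \<open>w\<close> after it. In these coordinates
  Lebesgue measure on states at a fixed time is the flux \<open>\<bar>w - f' \<tau>\<bar> d\<tau> dw\<close>, which is
  invariant under the reflection \<open>w \<mapsto> 2 f' \<tau> - w\<close>.\<close>

lemma flux_after:
  assumes wall: "wall a M K f" and cd: "c < d" and B: "B \<in> sets borel"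
  shows "(\<integral>\<^sup>+ w. \<integral>\<^sup>+ \<tau>. indicator {..deriv f c - K * (d - c)} w * (indicator B (f \<tau> + w * (d - \<tau>), w)
      * ennreal (deriv f \<tau> - w) * indicator {c..d} \<tau>) \<partial>lborel \<partial>lborel)
    \<le> emeasure lborel (B \<inter> {(y, w). f c + w * (d - c) \<le> y \<and> y \<le> f d})" (is "?L \<le> emeasure lborel (B \<inter> ?R)")
proof -
  note [measurable] = wall_measurable(1,2)[OF wall] B
  have R: "?R \<in> sets borel"
    unfolding split_beta by (intro borel_closed closed_Collect_conj closed_Collect_le continuous_intros)
  have BR: "B \<inter> ?R \<in> sets borel" using B R by auto
  show ?thesis
    unfolding emeasure_slices[OF BR]
  proof (rule nn_integral_mono)
    fix w :: real
    show "(\<integral>\<^sup>+ \<tau>. indicator {..deriv f c - K * (d - c)} w * (indicator B (f \<tau> + w * (d - \<tau>), w)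
      * ennreal (deriv f \<tau> - w) * indicator {c..d} \<tau>) \<partial>lborel) \<le> emeasure lborel ((\<lambda>y. (y, w)) -` (B \<inter> ?R))"
    proof (cases "w \<le> deriv f c - K * (d - c)")
      case True
      \<comment> \<open>Throughout the step the ball leaves faster than the slit can follow. Hence
        the arrival height \<open>f \<tau> + w * (d - \<tau>)\<close> increases with \<tau>, and the
        flux density is its derivative.\<close>
      have nn: "0 \<le> deriv f t - w" if "t \<in> {c..d}" for t
        using wall_deriv_near[OF wall, of c t d] that True by auto
      have Bw: "(\<lambda>y. indicator B (y, w) :: ennreal) \<in> borel_measurable borel"
      proof -
        have "(\<lambda>y. indicator B (y, w)) = (indicator ((\<lambda>y. (y, w)) -` B) :: real \<Rightarrow> ennreal)"
          by (auto simp: indicator_def)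
        then show ?thesis using slice_borel[OF B, of w] by simp
      qed
      have "(\<integral>\<^sup>+ \<tau>. indicator B (f \<tau> + w * (d - \<tau>), w) * ennreal (deriv f \<tau> - w) * indicator {c..d} \<tau> \<partial>lborel)
        = (\<integral>\<^sup>+ y. indicator B (y, w) * indicator {f c + w * (d - c)..f d + w * (d - d)} y \<partial>lborel)"
        by (rule nn_integral_substitution_aux[where g = "\<lambda>\<tau>. f \<tau> + w * (d - \<tau>)" and f = "\<lambda>y. indicator B (y, w)", symmetric])
           (use Bw wall nn cd in \<open>auto intro!: derivative_eq_intros continuous_intros wall_measurable(4)[OF wall] simp: wall_def\<close>)
      also have "\<dots> = (\<integral>\<^sup>+ y. indicator ((\<lambda>y. (y, w)) -` (B \<inter> ?R)) y \<partial>lborel)"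
        by (intro nn_integral_cong) (auto simp: indicator_def)
      also have "\<dots> = emeasure lborel ((\<lambda>y. (y, w)) -` (B \<inter> ?R))"
        using slice_borel[OF BR, of w] by (intro nn_integral_indicator) simp
      finally show ?thesis using True by simp
    qed simp
  qed
qed

text \<open>The incoming counterpart: for fixed \<open>w\<close> the starting height
  \<open>f \<tau> - w * (\<tau> - c)\<close> of the ball that hits at \<tau> decreases with \<tau>,
  and the flux density is the modulus of its derivative. Heights are negated in the proof to make
  the substitution increasing.\<close>

lemma flux_before:
  assumes wall: "wall a M K f" and cd: "c < d" and S: "S \<in> sets borel"
    and w: "w > deriv f c + K * (d - c)"
    and sub: "\<And>y. y \<in> S \<Longrightarrow> f d - w * (d - c) \<le> y \<and> y \<le> f c"
  shows "emeasure lborel S = (\<integral>\<^sup>+ \<tau>. indicator S (f \<tau> - w * (\<tau> - c)) * ennreal (w - deriv f \<tau>) * indicator {c..d} \<tau> \<partial>lborel)"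
proof -
  have nn: "0 \<le> w - deriv f t" if "t \<in> {c..d}" for t
    using wall_deriv_near[OF wall, of c t d] that w by auto
  have Sm: "(\<lambda>x. indicator S (- x) :: ennreal) \<in> borel_measurable borel" using S by measurable
  have "emeasure lborel S = (\<integral>\<^sup>+ x. indicator S x \<partial>lborel)" using S by simp
  also have "\<dots> = (\<integral>\<^sup>+ x. indicator S (- x) \<partial>lborel)"
    using nn_integral_real_affine[of "indicator S" "-1" 0] S by simp
  also have "\<dots> = (\<integral>\<^sup>+ x. indicator S (- x) * indicator {w * (c - c) - f c..w * (d - c) - f d} x \<partial>lborel)"
    using sub by (intro nn_integral_cong) (fastforce simp: indicator_def)
  also have "\<dots> = (\<integral>\<^sup>+ \<tau>. indicator S (- (w * (\<tau> - c) - f \<tau>)) * ennreal (w - deriv f \<tau>) * indicator {c..d} \<tau> \<partial>lborel)"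
    by (rule nn_integral_substitution_aux[where g = "\<lambda>\<tau>. w * (\<tau> - c) - f \<tau>" and f = "\<lambda>x. indicator S (- x)"])
       (use Sm wall nn cd in \<open>auto intro!: derivative_eq_intros continuous_intros wall_measurable(4)[OF wall] simp: wall_def\<close>)
  finally show ?thesis by simp
qed


text \<open>During the step the slit rises at a rate of at most
  \<open>deriv f c + K * (d - c)\<close>, and a faster ball closes the gap monotonically. So it hits
  at most once, and whether it has hit before a time \<open>s\<close> can be read off at
  \<open>s\<close>.\<close>

lemma gap_decreasing:
  assumes wall: "wall a M K f" and w: "w > deriv f c + K * (d - c)" and t: "c \<le> s" "s < t" "t \<le> d"
  shows "f t - w * t < f s - w * s"
proof -
  have "\<bar>f t - f s - deriv f c * (t - s)\<bar> \<le> K * (d - c) * (t - s)"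
    using wall_taylor[OF wall, of c s t d c] t by simp
  then have "f t - f s \<le> (deriv f c + K * (d - c)) * (t - s)" by (simp add: algebra_simps abs_le_iff)
  also have "\<dots> < w * (t - s)" using w t by (intro mult_strict_right_mono) auto
  finally show ?thesis by (simp add: algebra_simps)
qed

text \<open>The map is factored through hit time and velocity; there the reflection at a fixed hit
  time preserves the flux. The constant 3 comes from \<open>2 * deriv f \<tau> - w\<close>: the
  slope of the slit varies by up to \<open>K * (d - c)\<close>, which counts twice, and
  \<open>flux_after\<close> asks for a further margin \<open>K * (d - c)\<close> after the
  reflection.\<close>

lemma nonexpanding_collision:
  assumes wall: "wall a M K f" and cd: "c < d" and G: "G \<in> sets borel"
    and fast: "\<And>y w. (y, w) \<in> G \<Longrightarrow> w > deriv f c + 3 * K * (d - c) \<and> f d - w * (d - c) \<le> y \<and> y \<le> f c"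
    and T: "\<And>y w. (y, w) \<in> G \<Longrightarrow> c \<le> T (y, w) \<and> T (y, w) \<le> d \<and> y + w * (T (y, w) - c) = f (T (y, w))"
    and meas: "\<And>B. B \<in> sets borel \<Longrightarrow> G \<inter> \<phi> -` B \<in> sets borel"
    and \<phi>: "\<And>y w. (y, w) \<in> G \<Longrightarrow> \<phi> (y, w) = (f (T (y, w)) + (2 * deriv f (T (y, w)) - w) * (d - T (y, w)), 2 * deriv f (T (y, w)) - w)"
  shows "nonexpanding G {(y, w). f c + w * (d - c) \<le> y \<and> y \<le> f d} \<phi>" (is "nonexpanding G ?R \<phi>")
  unfolding nonexpanding_def
proof (intro conjI ballI G meas)
  show "?R \<in> sets borel"
    unfolding split_beta by (intro borel_closed closed_Collect_conj closed_Collect_le continuous_intros)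
  fix B :: "(real \<times> real) set" assume B: "B \<in> sets borel"
  note [measurable] = wall_measurable(1,2)[OF wall] B
  have K: "0 \<le> K" using wall by (simp add: wall_def)
  \<comment> \<open>\<open>Q\<close> is the incoming and \<open>H\<close> the outgoing flux density
    over pairs of hit time and velocity, cut off to the admissible velocities and restricted to
    arrivals in \<open>B\<close>.\<close>
  define Q where "Q = (\<lambda>\<tau> w. (indicator {deriv f c + 3 * K * (d - c)<..} w * indicator B (f \<tau> + (2 * deriv f \<tau> - w) * (d - \<tau>), 2 * deriv f \<tau> - w)
      * ennreal (w - deriv f \<tau>) * indicator {c..d} \<tau>) :: ennreal)"
  define H where "H = (\<lambda>\<tau> w. (indicator {..deriv f c - K * (d - c)} w * (indicator B (f \<tau> + w * (d - \<tau>), w)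
      * ennreal (deriv f \<tau> - w) * indicator {c..d} \<tau>)) :: ennreal)"
  have BB: "B \<in> sets (borel \<Otimes>\<^sub>M borel)" using B unfolding borel_prod .
  note [measurable] = BB
  have Qm[measurable]: "case_prod Q \<in> borel_measurable (lborel \<Otimes>\<^sub>M lborel)"
    unfolding Q_def by measurable
  have Hm[measurable]: "case_prod H \<in> borel_measurable (lborel \<Otimes>\<^sub>M lborel)"
    unfolding H_def by measurable
  define S where "S = G \<inter> \<phi> -` B"
  have S: "S \<in> sets borel" unfolding S_def using meas[OF B] .
  have "emeasure lborel S = (\<integral>\<^sup>+ w. emeasure lborel ((\<lambda>y. (y, w)) -` S) \<partial>lborel)" by (rule emeasure_slices[OF S])
  also have "\<dots> \<le> (\<integral>\<^sup>+ w. \<integral>\<^sup>+ \<tau>. Q \<tau> w \<partial>lborel \<partial>lborel)"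
  proof (rule nn_integral_mono)
    fix w :: real
    let ?S = "(\<lambda>y. (y, w)) -` S"
    show "emeasure lborel ?S \<le> (\<integral>\<^sup>+ \<tau>. Q \<tau> w \<partial>lborel)"
    proof (cases "w > deriv f c + 3 * K * (d - c)")
      case False
      then have "?S = {}" using fast by (fastforce simp: S_def)
      then show ?thesis by simp
    next
      case True
      have Kh: "0 \<le> K * (d - c)" using K cd by simp
      have w: "w > deriv f c + K * (d - c)" using True Kh by linarith
      have "emeasure lborel ?S = (\<integral>\<^sup>+ \<tau>. indicator ?S (f \<tau> - w * (\<tau> - c)) * ennreal (w - deriv f \<tau>) * indicator {c..d} \<tau> \<partial>lborel)"
        by (rule flux_before[OF wall cd slice_borel[OF S] w]) (use fast in \<open>auto simp: S_def\<close>)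
      also have "\<dots> \<le> (\<integral>\<^sup>+ \<tau>. Q \<tau> w \<partial>lborel)"
      proof (rule nn_integral_mono)
        fix \<tau> :: real
        show "indicator ?S (f \<tau> - w * (\<tau> - c)) * ennreal (w - deriv f \<tau>) * indicator {c..d} \<tau> \<le> Q \<tau> w"
        proof (cases "\<tau> \<in> {c..d} \<and> f \<tau> - w * (\<tau> - c) \<in> ?S")
          case t: True
          define y where "y = f \<tau> - w * (\<tau> - c)"
          define s where "s = T (y, w)"
          have yG: "(y, w) \<in> G" "\<phi> (y, w) \<in> B" using t by (auto simp: S_def y_def)
          have s: "c \<le> s" "s \<le> d" "f \<tau> - w * \<tau> = f s - w * s"
            using T[OF yG(1)] by (auto simp: s_def y_def algebra_simps)
          \<comment> \<open>The gap is strictly decreasing, so \<tau> is the only hit time of this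
            ball and coincides with the prescribed \<open>T\<close>.\<close>
          have "s = \<tau>"
            using gap_decreasing[OF wall w s(1), of \<tau>] gap_decreasing[OF wall w _ _ s(2), of \<tau>] s(3) t
            by (metis atLeastAtMost_iff less_irrefl linorder_neqE_linordered_idom)
          then have "(f \<tau> + (2 * deriv f \<tau> - w) * (d - \<tau>), 2 * deriv f \<tau> - w) \<in> B"
            using \<phi>[OF yG(1)] yG(2) by (simp add: s_def[symmetric])
          then show ?thesis using True t by (simp add: Q_def)
        qed (auto simp: indicator_def)
      qed
      finally show ?thesis .
    qed
  qed
  \<comment> \<open>The order of integration is exchanged because the reflection acts at a fixed hit
    time, where it is an isometry in the velocity.\<close>
  also have "\<dots> = (\<integral>\<^sup>+ \<tau>. \<integral>\<^sup>+ w. Q \<tau> w \<partial>lborel \<partial>lborel)"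
    by (rule lborel_pair.Fubini'[OF Qm])
  also have "\<dots> \<le> (\<integral>\<^sup>+ \<tau>. \<integral>\<^sup>+ w. H \<tau> w \<partial>lborel \<partial>lborel)"
  proof (rule nn_integral_mono)
    fix \<tau> :: real
    have "Q \<tau> \<in> borel_measurable borel" using measurable_Pair2[OF Qm, of \<tau>] by simp
    then have "(\<integral>\<^sup>+ w. Q \<tau> w \<partial>lborel) = (\<integral>\<^sup>+ w. Q \<tau> (2 * deriv f \<tau> + (-1) * w) \<partial>lborel)"
      using nn_integral_real_affine[of "Q \<tau>" "-1" "2 * deriv f \<tau>"] by simp
    also have "\<dots> \<le> (\<integral>\<^sup>+ w. H \<tau> w \<partial>lborel)"
    proof (rule nn_integral_mono)
      fix w
      show "Q \<tau> (2 * deriv f \<tau> + (-1) * w) \<le> H \<tau> w"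
      proof (cases "\<tau> \<in> {c..d} \<and> 2 * deriv f \<tau> - w > deriv f c + 3 * K * (d - c)")
        case True
        then have "\<bar>deriv f \<tau> - deriv f c\<bar> \<le> K * (d - c)" using wall_deriv_near[OF wall] by auto
        then have "w \<le> deriv f c - K * (d - c)" using True by linarith
        then show ?thesis using True by (simp add: Q_def H_def)
      qed (auto simp: Q_def indicator_def)
    qed
    finally show "(\<integral>\<^sup>+ w. Q \<tau> w \<partial>lborel) \<le> (\<integral>\<^sup>+ w. H \<tau> w \<partial>lborel)" .
  qed
  also have "\<dots> = (\<integral>\<^sup>+ w. \<integral>\<^sup>+ \<tau>. H \<tau> w \<partial>lborel \<partial>lborel)"
    by (rule lborel_pair.Fubini'[OF Hm, symmetric])
  also have "\<dots> \<le> emeasure lborel (B \<inter> ?R)"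
    unfolding H_def by (rule flux_after[OF wall cd B])
  finally show "emeasure lborel (G \<inter> \<phi> -` B) \<le> emeasure lborel (B \<inter> ?R)" unfolding S_def .
qed

section \<open>Short time steps\<close>

lemma fst_borel [measurable]: "(fst :: real \<times> real \<Rightarrow> real) \<in> borel_measurable borel"
  and snd_borel [measurable]: "(snd :: real \<times> real \<Rightarrow> real) \<in> borel_measurable borel"
  by (auto intro!: borel_measurable_continuous_onI continuous_intros)

lemma linear_pos:
  fixes y w s h :: real
  assumes "0 < y" "0 < y + w * h" "0 \<le> s" "s \<le> h"
  shows "0 < y + w * s"
proof (cases "0 \<le> w")
  case True
  then show ?thesis using assms by (simp add: add_pos_nonneg)
next
  case False
  then have "w * h \<le> w * s" using assms by (intro mult_left_mono_neg) auto
  then show ?thesis using assms by linarith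
qed

lemma wall_lower:
  assumes "wall a M K f" "c \<le> s" "s \<le> t" "t \<le> d"
  shows "(deriv f c - K * (d - c)) * (t - s) \<le> f t - f s"
  using wall_taylor[OF assms(1), of c s t d c] assms by (simp add: algebra_simps abs_le_iff)

text \<open>From a good state at time \<open>c\<close> there is at most one collision until time \<open>d\<close>: a small speed
  relative to the slit is allowed only if the slit is out of reach.\<close>

definition good_states :: "real \<Rightarrow> real \<Rightarrow> real \<Rightarrow> (real \<Rightarrow> real) \<Rightarrow> real \<Rightarrow> real \<Rightarrow> (real \<times> real) set" where
  "good_states a M K f c d = {x. 0 < fst x \<and> fst x < f c \<and> (\<bar>snd x\<bar> + 2 * M) * (d - c) < a \<and>
     fst x + snd x * (d - c) \<noteq> 0 \<and> fst x + snd x * (d - c) \<noteq> f d \<and>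
     (3 * K * (d - c) < \<bar>snd x - deriv f c\<bar> \<or> 4 * K * (d - c)\<^sup>2 < f c - fst x)}"

definition chamber :: "(real \<Rightarrow> real) \<Rightarrow> real \<Rightarrow> (real \<times> real) set" where
  "chamber f t = {x. 0 < fst x \<and> fst x < f t}"

lemma chamber_borel [measurable]: "chamber f t \<in> sets borel"
  unfolding chamber_def by (intro borel_open open_Collect_conj open_Collect_less continuous_intros)

lemma emeasure_line: "emeasure lborel {x::real\<times>real. fst x + snd x * h = b} = 0"
proof -
  have "{x::real\<times>real. fst x + snd x * h = b} \<in> sets borel"
    by (intro borel_closed closed_Collect_eq continuous_intros)
  moreover have "(\<lambda>y. (y, w)) -` {x::real\<times>real. fst x + snd x * h = b} = {b - w * h}" for w by auto
  ultimately show ?thesis by (subst emeasure_slices) simp_all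
qed

context
  fixes a M K :: real and f :: "real \<Rightarrow> real" and c d :: real
  assumes wall: "wall a M K f" and cd: "c < d"
begin

lemmas bounds = wall_facts[OF wall]

text \<open>A state that is not fast upwards either has a velocity not exceeding any slope of the
  slit in the step, or starts too far away to catch up. So the collision formula is only ever needed
  for fast states.\<close>

lemma fast_or_far:
  assumes "(y, w) \<in> good_states a M K f c d"
  shows "deriv f c + 3 * K * (d - c) < w \<or> (\<forall>r. c \<le> r \<and> r \<le> d \<longrightarrow> y + w * (r - c) < f r)"
proof (cases "deriv f c + 3 * K * (d - c) < w")
  case False
  define h where "h = d - c"
  have h: "0 < h" using cd by (simp add: h_def)
  have w: "w \<le> deriv f c + 3 * K * h" using False by (simp add: h_def)
  have "y + w * (r - c) < f r" if r: "c \<le> r" "r \<le> d" for r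
  proof -
    have L: "(deriv f c - K * h) * (r - c) \<le> f r - f c"
      using wall_lower[OF wall, of c c r d] r by (simp add: h_def)
    have rc: "0 \<le> r - c" "r - c \<le> h" using r by (auto simp: h_def)
    show ?thesis
    proof (cases "3 * K * h < \<bar>w - deriv f c\<bar>")
      case True
      have "0 \<le> K * h" using bounds(3) h by simp
      then have "w \<le> deriv f c - K * h" using True w by linarith
      then have "w * (r - c) \<le> (deriv f c - K * h) * (r - c)" using rc by (intro mult_right_mono) auto
      then show ?thesis using L assms by (auto simp: good_states_def)
    next
      \<comment> \<open>The ball gains on the slit at a rate of at most \<open>4 * K * h\<close>: 3
        parts from its own excess and 1 from the variation of the slope. Over a time
        \<open>h\<close> this is less than the initial gap.\<close>
      case far: False
      have "w * (r - c) \<le> (deriv f c + 3 * K * h) * (r - c)" using w rc by (intro mult_right_mono) auto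
      moreover have "(4 * K * h) * (r - c) \<le> (4 * K * h) * h" using rc bounds(3) h by (intro mult_left_mono) auto
      moreover have "4 * K * h\<^sup>2 < f c - y" using far assms by (auto simp: good_states_def h_def)
      ultimately show ?thesis using L by (simp add: algebra_simps power2_eq_square)
    qed
  qed
  then show ?thesis by blast
qed simp

text \<open>Only the end point has to be checked: a line with positive ends stays above the floor,
  and for a fast ball the gap to the slit decreases, so it is positive throughout if it is positive
  at \<open>d\<close>.\<close>

lemma free_step:
  assumes g: "(y, w) \<in> good_states a M K f c d" and y': "0 < y + w * (d - c)" "y + w * (d - c) < f d"
  shows "reach_below f c d (y, w) (y + w * (d - c), w)"
proof -
  have y: "0 < y" "y < f c" using g by (auto simp: good_states_def)
  have "0 < y + w * (r - c) \<and> y + w * (r - c) < f r" if r: "c < r" "r < d" for r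
  proof
    show "0 < y + w * (r - c)" using linear_pos[OF y(1) y'(1), of "r - c"] r by simp
    show "y + w * (r - c) < f r"
      using fast_or_far[OF g]
    proof
      assume w: "deriv f c + 3 * K * (d - c) < w"
      have "0 \<le> K * (d - c)" using bounds(3) cd by simp
      then have "deriv f c + K * (d - c) < w" using w by linarith
      from gap_decreasing[OF wall this, of r d] r y'
      show ?thesis by (simp add: algebra_simps)
    qed (use r in auto)
  qed
  from reach_below_flight[OF cd _ _ _ _ this] y y' show ?thesis by (simp add: bounce_def)
qed

text \<open>In one step the ball travels less than \<open>a\<close>, a lower bound for the height of
  the slit. So a ball that touches the floor meets the slit neither before nor after in the same
  step.\<close>

lemma floor_step:
  assumes g: "(y, w) \<in> good_states a M K f c d" and y': "y + w * (d - c) < 0"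
  shows "reach_below f c d (y, w) (- (y + w * (d - c)), - w)"
    "0 < - (y + w * (d - c))" "- (y + w * (d - c)) < f d"
proof -
  have y: "0 < y" "y < f c" and wh: "(\<bar>w\<bar> + 2 * M) * (d - c) < a" using g by (auto simp: good_states_def)
  have "w * (d - c) < 0" using y y' by linarith
  then have w: "w < 0" using cd by (simp add: mult_less_0_iff)
  have wa: "- w * s < a" if "s \<le> d - c" for s
  proof -
    have "- w * s \<le> - w * (d - c)" using w that by (intro mult_left_mono) auto
    also have "\<dots> \<le> (\<bar>w\<bar> + 2 * M) * (d - c)" using w cd bounds(2) by (intro mult_right_mono) auto
    finally show ?thesis using wh by simp
  qed
  define \<tau> where "\<tau> = c - y / w"
  have \<tau>: "y + w * (\<tau> - c) = 0" using w by (simp add: \<tau>_def field_simps)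
  have c\<tau>: "c < \<tau>" using y w by (simp add: \<tau>_def divide_neg_pos divide_pos_neg)
  have "w * (d - c) < w * (\<tau> - c)" using \<tau> y' by linarith
  then have \<tau>d: "\<tau> < d" using w by simp
  have 1: "0 < y + w * (r - c) \<and> y + w * (r - c) < f r" if r: "c < r" "r < \<tau>" for r
  proof -
    have e: "y + w * (r - c) = - w * (\<tau> - r)" using \<tau> by (simp add: algebra_simps)
    have "0 < - w * (\<tau> - r)" using w r by (intro mult_pos_pos) auto
    moreover have "- w * (\<tau> - r) < a" using \<tau>d r by (intro wa) auto
    ultimately show ?thesis using bounds(4)[of r] unfolding e by linarith
  qed
  have 2: "0 < 0 + - w * (r - \<tau>) \<and> 0 + - w * (r - \<tau>) < f r" if r: "\<tau> < r" "r \<le> d" for r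
  proof -
    have "0 < - w * (r - \<tau>)" using w r by (intro mult_pos_pos) auto
    moreover have "- w * (r - \<tau>) < a" using c\<tau> r by (intro wa) auto
    ultimately show ?thesis using bounds(4)[of r] by linarith
  qed
  have e: "- (y + w * (d - c)) = 0 + - w * (d - \<tau>)" using \<tau> by (simp add: algebra_simps)
  show b: "0 < - (y + w * (d - c))" "- (y + w * (d - c)) < f d" using 2[of d] \<tau>d unfolding e by auto
  have f1: "reach_below f c \<tau> (y, w) (0, - w)"
    using reach_below_flight[OF c\<tau> _ _ _ _ 1] y \<tau> bounds(5)[of \<tau>] by (simp add: bounce_def)
  have f2: "reach_below f \<tau> d (0, - w) (- (y + w * (d - c)), - w)"
    using reach_below_flight[OF \<tau>d _ _ _ _ 2] b bounds(5)[of \<tau>]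
    unfolding e[symmetric] by (simp add: bounce_def)
  show "reach_below f c d (y, w) (- (y + w * (d - c)), - w)"
    using reach_below_trans[OF f1 f2] c\<tau> \<tau>d by simp
qed

text \<open>The reflected speed is at most \<open>\<bar>w\<bar> + 2 * M\<close>, whence the term
  \<open>2 * M\<close> in the good states: from a height of at least \<open>a\<close> the ball
  cannot reach the floor. A second hit is excluded because the reflected velocity is below every
  slope of the slit in the step.\<close>

lemma slit_step:
  assumes g: "(y, w) \<in> good_states a M K f c d" and y': "f d < y + w * (d - c)"
  shows "deriv f c + 3 * K * (d - c) < w"
    "\<exists>\<tau>. c < \<tau> \<and> \<tau> < d \<and> y + w * (\<tau> - c) = f \<tau>"
    "\<And>\<tau>. c < \<tau> \<Longrightarrow> \<tau> < d \<Longrightarrow> y + w * (\<tau> - c) = f \<tau> \<Longrightarrow>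
      reach_below f c d (y, w) (f \<tau> + (2 * deriv f \<tau> - w) * (d - \<tau>), 2 * deriv f \<tau> - w) \<and>
      0 < f \<tau> + (2 * deriv f \<tau> - w) * (d - \<tau>) \<and> f \<tau> + (2 * deriv f \<tau> - w) * (d - \<tau>) < f d"
proof -
  have y: "0 < y" "y < f c" and wh: "(\<bar>w\<bar> + 2 * M) * (d - c) < a" using g by (auto simp: good_states_def)
  have Kh: "0 \<le> K * (d - c)" using bounds(3) cd by simp
  show w: "deriv f c + 3 * K * (d - c) < w"
  proof (rule ccontr)
    assume "\<not> deriv f c + 3 * K * (d - c) < w"
    then have "y + w * (d - c) < f d" using fast_or_far[OF g] cd by simp
    then show False using y' by simp
  qed
  have w1: "deriv f c + K * (d - c) < w" using w Kh by linarith
  show "\<exists>\<tau>. c < \<tau> \<and> \<tau> < d \<and> y + w * (\<tau> - c) = f \<tau>"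
  proof -
    have "\<exists>\<tau>. c \<le> \<tau> \<and> \<tau> \<le> d \<and> f \<tau> - (y + w * (\<tau> - c)) = 0"
      using y y' cd by (intro IVT2') (auto intro!: continuous_intros wall_measurable(3)[OF wall])
    then obtain \<tau> where \<tau>: "c \<le> \<tau>" "\<tau> \<le> d" "y + w * (\<tau> - c) = f \<tau>" by auto
    then have "\<tau> \<noteq> c" "\<tau> \<noteq> d" using y y' by auto
    then show ?thesis using \<tau> by (intro exI[of _ \<tau>]) auto
  qed
  fix \<tau> assume \<tau>: "c < \<tau>" "\<tau> < d" "y + w * (\<tau> - c) = f \<tau>"
  define v where "v = 2 * deriv f \<tau> - w"
  have "\<bar>deriv f \<tau> - deriv f c\<bar> \<le> K * (d - c)" using wall_deriv_near[OF wall, of c \<tau> d] \<tau> by simp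
  then have v: "v < deriv f c - K * (d - c)" using w by (simp add: v_def abs_le_iff)
  have v2: "\<bar>v\<bar> \<le> \<bar>w\<bar> + 2 * M" using bounds(7)[of \<tau>] unfolding v_def by linarith
  have 1: "0 < y + w * (r - c) \<and> y + w * (r - c) < f r" if r: "c < r" "r < \<tau>" for r
  proof
    have "0 < y + w * (\<tau> - c)" using \<tau>(3) bounds(5)[of \<tau>] by simp
    from linear_pos[OF y(1) this, of "r - c"] show "0 < y + w * (r - c)" using r by simp
    have "f \<tau> - w * \<tau> < f r - w * r" using gap_decreasing[OF wall w1, of r \<tau>] r \<tau> by simp
    then show "y + w * (r - c) < f r" using \<tau>(3) by (simp add: algebra_simps)
  qed
  have 2: "0 < f \<tau> + v * (r - \<tau>) \<and> f \<tau> + v * (r - \<tau>) < f r" if r: "\<tau> < r" "r \<le> d" for r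
  proof
    have "\<bar>v * (r - \<tau>)\<bar> \<le> (\<bar>w\<bar> + 2 * M) * (d - c)"
      unfolding abs_mult using v2 r \<tau> by (intro mult_mono) auto
    then show "0 < f \<tau> + v * (r - \<tau>)" using wh bounds(4)[of \<tau>] by linarith
    have "v * (r - \<tau>) < (deriv f c - K * (d - c)) * (r - \<tau>)" using v r by (intro mult_strict_right_mono) auto
    also have "\<dots> \<le> f r - f \<tau>" using wall_lower[OF wall, of c \<tau> r d] r \<tau> by simp
    finally show "f \<tau> + v * (r - \<tau>) < f r" by simp
  qed
  have f1: "reach_below f c \<tau> (y, w) (f \<tau>, v)"
    using reach_below_flight[OF \<tau>(1) _ _ _ _ 1] y \<tau>(3) bounds(5)[of \<tau>] by (simp add: bounce_def v_def)
  have f2: "reach_below f \<tau> d (f \<tau>, v) (f \<tau> + v * (d - \<tau>), v)"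
    using reach_below_flight[OF \<tau>(2) _ _ _ _ 2] 2[of d] \<tau>(2) bounds(5)[of \<tau>]
    by (simp add: bounce_def)
  show "reach_below f c d (y, w) (f \<tau> + (2 * deriv f \<tau> - w) * (d - \<tau>), 2 * deriv f \<tau> - w) \<and>
      0 < f \<tau> + (2 * deriv f \<tau> - w) * (d - \<tau>) \<and> f \<tau> + (2 * deriv f \<tau> - w) * (d - \<tau>) < f d"
    using reach_below_trans[OF f1 f2] \<tau> 2[of d] by (simp add: v_def)
qed

lemma flow_below: "reach_below f c d x x' \<Longrightarrow> flow f c d x = x'"
  using flow_eq[OF cd] by (simp add: reach_def)

lemma good_states_borel [measurable]: "good_states a M K f c d \<in> sets borel"
  unfolding good_states_def by measurable

lemma good_step:
  assumes "x \<in> good_states a M K f c d"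
  shows "reach_below f c d x (flow f c d x) \<and> flow f c d x \<in> chamber f d"
proof -
  obtain y w where x: "x = (y, w)" by force
  have "y + w * (d - c) \<noteq> 0" "y + w * (d - c) \<noteq> f d" using assms x by (auto simp: good_states_def)
  then consider "y + w * (d - c) < 0" | "0 < y + w * (d - c)" "y + w * (d - c) < f d" | "f d < y + w * (d - c)"
    by linarith
  then show ?thesis
  proof cases
    case 1
    then show ?thesis using floor_step[of y w] flow_below[of x] assms unfolding x by (auto simp: chamber_def)
  next
    case 2
    then show ?thesis using free_step[of y w] flow_below[of x] assms unfolding x by (auto simp: chamber_def)
  next
    case 3
    then obtain \<tau> where \<tau>: "c < \<tau>" "\<tau> < d" "y + w * (\<tau> - c) = f \<tau>" using slit_step(2)[of y w] assms x by auto
    then show ?thesis using slit_step(3)[OF _ 3 \<tau>] flow_below[of x] assms unfolding x by (auto simp: chamber_def)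
  qed
qed

text \<open>The end point of the unobstructed flight decides which explicit map applies: a shear, a
  shear followed by a point reflection, or the collision map.\<close>

lemma nonexpanding_step: "nonexpanding (good_states a M K f c d) (chamber f d) (flow f c d)"
proof -
  define h where "h = d - c"
  define G where "G = good_states a M K f c d"
  have G: "G \<in> sets borel" unfolding G_def by (rule good_states_borel)
  note [measurable] = G wall_measurable(1,2)[OF wall]
  define G0 where "G0 = G \<inter> {x. 0 < fst x + snd x * h \<and> fst x + snd x * h < f d}"
  define G1 where "G1 = G \<inter> {x. fst x + snd x * h < 0}"
  define G2 where "G2 = G \<inter> {x. f d < fst x + snd x * h}"
  \<comment> \<open>The images are told apart by tracing the final state back along a straight line
    to time \<open>c\<close>: it arrives inside the chamber, below the floor, or not below the slit.
    So the three targets are disjoint.\<close>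
  define R0 where "R0 = {x::real\<times>real. 0 < fst x - snd x * h \<and> fst x - snd x * h < f c}"
  define R1 where "R1 = {x::real\<times>real. fst x - snd x * h < 0}"
  define R2 where "R2 = {x::real\<times>real. f c \<le> fst x - snd x * h}"
  have [measurable]: "G0 \<in> sets borel" "G1 \<in> sets borel" "G2 \<in> sets borel"
    "R0 \<in> sets borel" "R1 \<in> sets borel" "R2 \<in> sets borel"
    unfolding G0_def G1_def G2_def R0_def R1_def R2_def by measurable
  have 0: "nonexpanding G0 R0 (flow f c d)"
  proof (rule nonexpanding_cong)
    show "nonexpanding G0 R0 (\<lambda>(y, w). (y + w * h, w))"
      by (rule nonexpanding_shear) (auto simp: G0_def G_def R0_def good_states_def)
    show "(case x of (y, w) \<Rightarrow> (y + w * h, w)) = flow f c d x" if "x \<in> G0" for x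
      using flow_below[OF free_step[of "fst x" "snd x"]] that
      by (auto simp: G0_def G_def h_def split_beta)
  qed
  have 1: "nonexpanding G1 R1 (flow f c d)"
  proof (rule nonexpanding_cong)
    let ?S = "\<lambda>(y, w). (y + w * h, w) :: real \<times> real"
    define R where "R = {x::real\<times>real. fst x < 0 \<and> 0 < fst x - snd x * h}"
    have [measurable]: "R \<in> sets borel" unfolding R_def by measurable
    have "nonexpanding (G1 \<inter> ?S -` R) R1 ((\<lambda>x. 0 - x) \<circ> ?S)"
      by (rule nonexpanding_comp[OF nonexpanding_shear nonexpanding_reflect]) (auto simp: G1_def G_def R1_def R_def good_states_def)
    moreover have "G1 \<inter> ?S -` R = G1" by (auto simp: G1_def G_def R_def good_states_def)
    ultimately show "nonexpanding G1 R1 ((\<lambda>x. 0 - x) \<circ> ?S)" by simp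
    show "((\<lambda>x. 0 - x) \<circ> ?S) x = flow f c d x" if "x \<in> G1" for x
      using flow_below[OF floor_step(1)[of "fst x" "snd x"]] that
      by (auto simp: G1_def G_def h_def split_beta)
  qed
  have 2: "nonexpanding G2 R2 (flow f c d)"
  proof -
    define T where "T = (\<lambda>x::real\<times>real. if x \<in> G2 then SOME \<tau>. c < \<tau> \<and> \<tau> < d \<and> fst x + snd x * (\<tau> - c) = f \<tau> else c)"
    have T: "c < T (y, w) \<and> T (y, w) < d \<and> y + w * (T (y, w) - c) = f (T (y, w))" if "(y, w) \<in> G2" for y w
      using someI_ex[OF slit_step(2)[of y w]] that by (simp add: T_def G2_def G_def h_def)
    have fast: "deriv f c + 3 * K * (d - c) < w" "f d - w * (d - c) \<le> y" "y \<le> f c" if "(y, w) \<in> G2" for y w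
      using slit_step(1)[of y w] that by (auto simp: G2_def G_def h_def good_states_def)
    \<comment> \<open>The hit time is obtained by choice; it is measurable because hitting before
      \<open>s\<close> means that the straight flight is above the slit at \<open>s\<close>, a Borel
      condition. Outside \<open>G2\<close> the default is \<open>c\<close>.\<close>
    have "T x < s \<longleftrightarrow> (if s \<le> c then False else if d \<le> s then True else x \<in> G2 \<longrightarrow> f s < fst x + snd x * (s - c))" for x s
    proof (cases "x \<in> G2")
      case True
      obtain y w where x: "x = (y, w)" by force
      have "0 \<le> K * (d - c)" using bounds(3) cd by simp
      then have "deriv f c + K * (d - c) < w" using fast(1)[of y w] True x by simp
      note g = gap_decreasing[OF wall this, of "T x" s] gap_decreasing[OF wall this, of s "T x"]
      have Tx: "c < T x" "T x < d" "y + w * (T x - c) = f (T x)" using T[of y w] True x by auto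
      have "T x < s \<longleftrightarrow> f s < y + w * (s - c)" if "c < s" "s < d"
      proof (cases "T x" s rule: linorder_cases)
        case less
        then show ?thesis using g(1) Tx that by (auto simp: algebra_simps)
      next
        case greater
        then show ?thesis using g(2) Tx that by (auto simp: algebra_simps)
      qed (use Tx in auto)
      then show ?thesis using True Tx by (auto simp: x)
    qed (use cd in \<open>auto simp: T_def\<close>)
    then have "T \<in> borel_measurable borel"
      by (intro borel_measurable_iff_less[THEN iffD2] allI) simp
    note [measurable] = this
    define \<phi> where "\<phi> = (\<lambda>x. (f (T x) + (2 * deriv f (T x) - snd x) * (d - T x), 2 * deriv f (T x) - snd x))"
    have \<phi>m: "\<phi> \<in> borel_measurable borel" unfolding \<phi>_def by measurable
    have "nonexpanding G2 {(y, w). f c + w * (d - c) \<le> y \<and> y \<le> f d} \<phi>"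
    proof (rule nonexpanding_collision[OF wall cd, where T = T])
      show "G2 \<inter> \<phi> -` B \<in> sets borel" if "B \<in> sets borel" for B
        using measurable_sets_borel[OF \<phi>m that] by simp
    qed (use T fast in \<open>auto simp: \<phi>_def less_imp_le\<close>)
    then have "nonexpanding G2 R2 \<phi>" by (rule nonexpanding_mono) (auto simp: R2_def h_def)
    then show ?thesis
    proof (rule nonexpanding_cong)
      show "\<phi> x = flow f c d x" if "x \<in> G2" for x
      proof -
        obtain y w where x: "x = (y, w)" by force
        have "T x > c" "T x < d" "y + w * (T x - c) = f (T x)" using T[of y w] that x by auto
        from flow_below[OF conjunct1[OF slit_step(3)[OF _ _ this]]]
        show ?thesis using that unfolding x by (simp add: \<phi>_def G2_def G_def h_def)
      qed
    qed
  qed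
  have "nonexpanding (G0 \<union> G1 \<union> G2) (R0 \<union> R1 \<union> R2) (flow f c d)"
    using bounds(5)[of c] by (intro nonexpanding_union 0 1 2) (auto simp: R0_def R1_def R2_def)
  moreover have "G0 \<union> G1 \<union> G2 = G" by (auto simp: G0_def G1_def G2_def G_def good_states_def h_def)
  ultimately have "nonexpanding G ((R0 \<union> R1 \<union> R2) \<inter> chamber f d) (flow f c d)"
    using good_step chamber_borel by (intro nonexpanding_restrict) (auto simp: G_def)
  then show ?thesis unfolding G_def
    by (rule nonexpanding_mono) (auto intro: good_states_borel chamber_borel)
qed

text \<open>Apart from two lines, whose states would end exactly on a wall, the bad states lie in a
  rectangle with sides \<open>4 * K * h^2\<close> and \<open>6 * K * h\<close>, where
  \<open>h = d - c\<close>. The third power of \<open>h\<close> makes the sum over about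
  \<open>1 / h\<close> steps tend to 0.\<close>

lemma bad_step:
  assumes "(B + 2 * M) * (d - c) < a"
  shows "emeasure lborel ({x. x \<in> chamber f c \<and> \<bar>snd x\<bar> \<le> B} - good_states a M K f c d)
    \<le> ennreal (24 * K\<^sup>2 * (d - c) ^ 3)"
proof -
  define h where "h = d - c"
  have h: "0 < h" using cd by (simp add: h_def)
  let ?N = "\<lambda>b. {x::real\<times>real. fst x + snd x * h = b}"
  let ?R = "{f c - 4 * K * h\<^sup>2..f c} \<times> {deriv f c - 3 * K * h..deriv f c + 3 * K * h}"
  have sub: "{x. x \<in> chamber f c \<and> \<bar>snd x\<bar> \<le> B} - good_states a M K f c d \<subseteq> (?N 0 \<union> ?N (f d)) \<union> ?R"
  proof
    fix x assume x: "x \<in> {x. x \<in> chamber f c \<and> \<bar>snd x\<bar> \<le> B} - good_states a M K f c d"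
    have "(\<bar>snd x\<bar> + 2 * M) * h \<le> (B + 2 * M) * h" using x h by (intro mult_right_mono) auto
    then have "(\<bar>snd x\<bar> + 2 * M) * h < a" using assms by (simp add: h_def)
    then show "x \<in> (?N 0 \<union> ?N (f d)) \<union> ?R"
      using x by (cases x) (auto simp: good_states_def chamber_def h_def[symmetric] abs_le_iff)
  qed
  have N: "?N b \<in> sets lborel" for b
    by simp
  have R: "?R \<in> sets lborel" by (simp add: borel_Times)
  have "emeasure lborel ({x. x \<in> chamber f c \<and> \<bar>snd x\<bar> \<le> B} - good_states a M K f c d)
    \<le> emeasure lborel ((?N 0 \<union> ?N (f d)) \<union> ?R)"
    using N R by (intro emeasure_mono sub) auto
  also have "\<dots> \<le> (emeasure lborel (?N 0) + emeasure lborel (?N (f d))) + emeasure lborel ?R"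
    using N R by (intro order_trans[OF emeasure_subadditive] add_mono emeasure_subadditive order_refl) auto
  also have "\<dots> = emeasure lborel ?R" by (simp add: emeasure_line)
  also have "\<dots> = emeasure lborel {f c - 4 * K * h\<^sup>2..f c} * emeasure lborel {deriv f c - 3 * K * h..deriv f c + 3 * K * h}"
    using lborel.emeasure_pair_measure_Times[of "{f c - 4 * K * h\<^sup>2..f c}" lborel "{deriv f c - 3 * K * h..deriv f c + 3 * K * h}"]
    unfolding lborel_prod by simp
  also have "\<dots> = ennreal (4 * K * h\<^sup>2) * ennreal (6 * K * h)"
    using bounds(3) h by (simp add: mult.assoc)
  also have "\<dots> = ennreal (24 * K\<^sup>2 * h ^ 3)"
    using bounds(3) h by (subst ennreal_mult[symmetric]) (auto simp: power2_eq_square power3_eq_cube algebra_simps)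
  finally show ?thesis by (simp add: h_def)
qed

end

section \<open>The flow is defined almost everywhere\<close>

lemma reach_belowI: "reach_below f p q x x' \<Longrightarrow> reach f p q x x'"
  by (simp add: reach_def)

text \<open>In each of \<open>n\<close> equal steps, the states newly lost are those whose image so
  far is bad, and pulling back does not increase area. So the losses add up to at most
  \<open>n * \<beta>\<close>.\<close>

lemma grid_flow:
  fixes B e :: real
  assumes wall: "wall a M K f" and pq: "p < q" and B: "0 \<le> B" and e: "0 < e"
  shows "\<exists>A. nonexpanding A (chamber f q) (flow f p q) \<and> A \<subseteq> chamber f p \<and>
    (\<forall>x\<in>A. flow f p q x \<in> chamber f q \<and> reach_below f p q x (flow f p q x)) \<and>
    emeasure lborel ({x. x \<in> chamber f p \<and> \<bar>snd x\<bar> \<le> B} - A) \<le> ennreal e"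
proof -
  note wf = wall_facts[OF wall]
  \<comment> \<open>A bound for the speed at all grid times, by adiabatic invariance and division by
    the lower bound \<open>a\<close> for the width. It allows the step length to be fixed in
    advance.\<close>
  define B1 where "B1 = (B + 2 * M + 2 * K * (q - p)) / a"
  \<comment> \<open>The three entries make \<open>n\<close> positive, make the steps short for a
    ball of speed \<open>B1\<close>, and bring the total loss
    \<open>24 * K^2 * (q - p)^3 / n^2\<close> below \<open>e\<close>.\<close>
  define N where "N = max 1 (max ((B1 + 2 * M) * (q - p) / a) (24 * K\<^sup>2 * (q - p) ^ 3 / e))"
  obtain n :: nat where n: "N < real n" using reals_Archimedean2 by blast
  have n1: "1 < real n" "(B1 + 2 * M) * (q - p) / a < real n" "24 * K\<^sup>2 * (q - p) ^ 3 / e < real n"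
    using n by (auto simp: N_def)
  define h where "h = (q - p) / n"
  define c where "c = (\<lambda>i::nat. p + i * h)"
  have h: "0 < h" using pq n1 by (simp add: h_def)
  have small: "(B1 + 2 * M) * h < a"
    using n1 wf(1) by (simp add: h_def field_simps)
  have cn: "c n = q" using n1 by (simp add: c_def h_def)
  define \<beta> where "\<beta> = 24 * K\<^sup>2 * h ^ 3"
  have \<beta>: "0 \<le> \<beta>" using h by (simp add: \<beta>_def)
  have n\<beta>: "n * \<beta> \<le> e"
  proof -
    have "n * \<beta> = 24 * K\<^sup>2 * (q - p) ^ 3 / n\<^sup>2"
      using n1 by (simp add: \<beta>_def h_def power2_eq_square power3_eq_cube field_simps)
    also have "\<dots> \<le> 24 * K\<^sup>2 * (q - p) ^ 3 / n"
      using n1 pq by (intro divide_left_mono) (auto simp: power2_eq_square)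
    also have "\<dots> \<le> e" using n1 e by (simp add: field_simps)
    finally show ?thesis .
  qed
  define X where "X = {x. x \<in> chamber f p \<and> \<bar>snd x\<bar> \<le> B}"
  have X: "X \<in> sets borel" unfolding X_def by measurable
  \<comment> \<open>The composed map \<open>F\<close> is kept abstract, since the induction starts
    with an interval of length 0, to which \<open>flow_eq\<close> does not apply. It is identified
    with the flow at the end.\<close>
  have "i \<le> n \<Longrightarrow> \<exists>A F. nonexpanding A (chamber f (c i)) F \<and> A \<subseteq> X \<and>
    (\<forall>x\<in>A. F x \<in> chamber f (c i) \<and> reach_below f p (c i) x (F x)) \<and> emeasure lborel (X - A) \<le> ennreal (i * \<beta>)" for i
  proof (induction i)
    case 0
    have "nonexpanding X (chamber f p) (\<lambda>x. x)"
      unfolding nonexpanding_def using X by (auto intro!: emeasure_mono simp: X_def)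
    moreover have "reach_below f p p x x" if "x \<in> X" for x
      using that by (intro reach_below_refl) (auto simp: X_def chamber_def)
    ultimately show ?case by (intro exI[of _ X] exI[of _ "\<lambda>x. x"]) (auto simp: c_def X_def)
  next
    case (Suc i)
    then obtain A F where A: "nonexpanding A (chamber f (c i)) F" "A \<subseteq> X"
      "\<And>x. x \<in> A \<Longrightarrow> F x \<in> chamber f (c i) \<and> reach_below f p (c i) x (F x)"
      "emeasure lborel (X - A) \<le> ennreal (i * \<beta>)" by auto
    have cc: "c i < c (Suc i)" and hc: "c (Suc i) - c i = h" using h by (auto simp: c_def algebra_simps)
    have pc: "p \<le> c i" using h by (simp add: c_def)
    have ciq: "c i \<le> q" unfolding cn[symmetric] using Suc h by (auto simp: c_def intro!: mult_right_mono)
    define \<Gamma> where "\<Gamma> = good_states a M K f (c i) (c (Suc i))"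
    define Y where "Y = {x. x \<in> chamber f (c i) \<and> \<bar>snd x\<bar> \<le> B1}"
    have \<Gamma>: "\<Gamma> \<in> sets borel" unfolding \<Gamma>_def by (rule good_states_borel[OF wall cc])
    have Y: "Y \<in> sets borel" unfolding Y_def by measurable
    let ?A = "A \<inter> F -` \<Gamma>" and ?F = "flow f (c i) (c (Suc i)) \<circ> F"
    have m: "nonexpanding ?A (chamber f (c (Suc i))) ?F"
      unfolding \<Gamma>_def by (rule nonexpanding_comp[OF A(1) nonexpanding_step[OF wall cc]])
    have r: "?F x \<in> chamber f (c (Suc i)) \<and> reach_below f p (c (Suc i)) x (?F x)" if "x \<in> ?A" for x
      using good_step[OF wall cc, of "F x"] A(3)[of x] that reach_below_trans[of f p "c i" x "F x"] pc cc
      by (auto simp: \<Gamma>_def)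
    have speed: "F x \<in> Y" if "x \<in> A" for x
    proof -
      have x: "\<bar>snd x\<bar> \<le> B" using A(2) that by (auto simp: X_def)
      have "\<bar>\<bar>snd (F x)\<bar> * f (c i) - \<bar>snd x\<bar> * f p\<bar> \<le> 2 * M + 2 * K * (c i - p)"
        using reach_below_speed[OF wall conjunct2[OF A(3)[OF that]] pc] .
      moreover have "\<bar>snd (F x)\<bar> * a \<le> \<bar>snd (F x)\<bar> * f (c i)" using wf(4) by (intro mult_left_mono) auto
      moreover have "\<bar>snd x\<bar> * f p \<le> B * 1" using x wf(5,6)[of p] B by (intro mult_mono) auto
      moreover have "2 * K * (c i - p) \<le> 2 * K * (q - p)" using ciq wf(3) by (intro mult_left_mono) auto
      ultimately have "\<bar>snd (F x)\<bar> * a \<le> B + 2 * M + 2 * K * (q - p)" by linarith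
      then have "\<bar>snd (F x)\<bar> \<le> B1" using wf(1) by (simp add: B1_def field_simps)
      then show ?thesis using A(3)[OF that] by (simp add: Y_def)
    qed
    have YG: "Y - \<Gamma> \<in> sets borel" using Y \<Gamma> by auto
    have XA: "X - A \<in> sets lborel" using X nonexpandingD(1)[OF A(1)] by auto
    have "emeasure lborel (X - ?A) \<le> emeasure lborel ((X - A) \<union> (A \<inter> F -` (Y - \<Gamma>)))"
      using speed XA nonexpandingD(3)[OF A(1) YG] by (intro emeasure_mono) auto
    also have "\<dots> \<le> emeasure lborel (X - A) + emeasure lborel (A \<inter> F -` (Y - \<Gamma>))"
      using XA nonexpandingD(3)[OF A(1) YG] by (intro emeasure_subadditive) auto
    also have "\<dots> \<le> ennreal (i * \<beta>) + ennreal \<beta>"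
    proof (intro add_mono A(4))
      have "emeasure lborel (A \<inter> F -` (Y - \<Gamma>)) \<le> emeasure lborel (Y - \<Gamma>)" by (rule nonexpanding_le[OF A(1) YG])
      also have "\<dots> \<le> ennreal \<beta>"
        using bad_step[OF wall cc, of B1] small unfolding hc Y_def \<Gamma>_def \<beta>_def by simp
      finally show "emeasure lborel (A \<inter> F -` (Y - \<Gamma>)) \<le> ennreal \<beta>" .
    qed
    also have "\<dots> = ennreal (Suc i * \<beta>)" using \<beta> by (subst ennreal_plus[symmetric]) (auto simp: algebra_simps)
    finally have e: "emeasure lborel (X - ?A) \<le> ennreal (Suc i * \<beta>)" .
    have "?A \<subseteq> X" using A(2) by auto
    with m e r show ?case by blast
  qed
  from this[of n] obtain A F where A: "nonexpanding A (chamber f q) F" "A \<subseteq> X"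
    "\<And>x. x \<in> A \<Longrightarrow> F x \<in> chamber f q \<and> reach_below f p q x (F x)"
    "emeasure lborel (X - A) \<le> ennreal (n * \<beta>)" unfolding cn by auto
  have fl: "F x = flow f p q x" if "x \<in> A" for x
    using flow_eq[OF pq reach_belowI] A(3)[OF that] by metis
  have "emeasure lborel (X - A) \<le> ennreal e"
    using A(4) n\<beta> by (meson ennreal_leI order_trans)
  then show ?thesis
    using nonexpanding_cong[OF A(1) fl] A(2,3) fl by (intro exI[of _ A]) (auto simp: X_def)
qed

text \<open>Exhaustion by speed bounds \<open>b\<close> and tolerances \<open>1 / Suc k\<close>. The
  sets \<open>A b k\<close> need not be nested; the area inequality survives their union because,
  within a speed bound, a single \<open>A b k\<close> contains all but an arbitrarily small
  area.\<close>

lemma interval_below: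
  assumes wall: "wall a M K f" and pq: "p < q"
  shows "\<exists>A. nonexpanding A (chamber f q) (flow f p q) \<and> A \<subseteq> chamber f p \<and>
    (\<forall>x\<in>A. flow f p q x \<in> chamber f q \<and> reach_below f p q x (flow f p q x)) \<and>
    emeasure lborel (chamber f p - A) = 0"
proof -
  define X where "X = (\<lambda>b::nat. {x. x \<in> chamber f p \<and> \<bar>snd x\<bar> \<le> real b})"
  define F where "F = flow f p q"
  have "\<forall>b k::nat. \<exists>A. nonexpanding A (chamber f q) F \<and> A \<subseteq> chamber f p \<and>
    (\<forall>x\<in>A. F x \<in> chamber f q \<and> reach_below f p q x (F x)) \<and>
    emeasure lborel (X b - A) \<le> ennreal (1 / Suc k)"
    unfolding F_def X_def by (intro allI grid_flow[OF wall pq]) auto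
  then obtain A where A: "\<And>b k. nonexpanding (A b k) (chamber f q) F" "\<And>b k. A b k \<subseteq> chamber f p"
    "\<And>b k x. x \<in> A b k \<Longrightarrow> F x \<in> chamber f q \<and> reach_below f p q x (F x)"
    "\<And>b k. emeasure lborel (X b - A b k) \<le> ennreal (1 / Suc k)"
    by metis
  define U where "U = (\<Union>b. \<Union>k. A b k)"
  have Ab: "A b k \<in> sets borel" for b k using nonexpandingD(1)[OF A(1)] .
  have U: "U \<in> sets borel" unfolding U_def using Ab by auto
  have Xb[measurable]: "X b \<in> sets borel" for b unfolding X_def by measurable
  have inc: "incseq X" by (rule incseq_SucI) (auto simp: X_def)
  have XU: "(\<Union>b. X b) = chamber f p"
  proof -
    have "\<exists>b. \<bar>snd x\<bar> \<le> real b" for x :: "real \<times> real" using real_arch_simple by blast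
    then show ?thesis by (auto simp: X_def)
  qed
  have e0: "\<exists>k. 1 / Suc k \<le> e" if "0 < e" for e :: real
    using reals_Archimedean[OF that] by (auto simp: inverse_eq_divide intro: less_imp_le)
  have SUP: "emeasure lborel S = (SUP b. emeasure lborel (S \<inter> X b))" if "S \<in> sets borel" "S \<subseteq> chamber f p" for S
  proof -
    have "incseq (\<lambda>b. S \<inter> X b)" using inc by (auto simp: incseq_def)
    then have "(SUP b. emeasure lborel (S \<inter> X b)) = emeasure lborel (\<Union>b. S \<inter> X b)"
      using that by (intro SUP_emeasure_incseq) auto
    also have "(\<Union>b. S \<inter> X b) = S" using that XU by blast
    finally show ?thesis by simp
  qed
  have m: "nonexpanding U (chamber f q) F"
    unfolding nonexpanding_def
  proof (intro conjI ballI U)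
    show "chamber f q \<in> sets borel" by measurable
    fix B :: "(real \<times> real) set" assume B: "B \<in> sets borel"
    have eq: "U \<inter> F -` B = (\<Union>b. \<Union>k. A b k \<inter> F -` B)" by (auto simp: U_def)
    show s: "U \<inter> F -` B \<in> sets borel" unfolding eq using nonexpandingD(3)[OF A(1) B]
      by (intro sets.countable_UN' image_subsetI countableI_type)
    have "U \<inter> F -` B \<subseteq> chamber f p" using A(2) by (auto simp: U_def)
    note SUP[OF s this]
    also have "(SUP b. emeasure lborel (U \<inter> F -` B \<inter> X b)) \<le> emeasure lborel (B \<inter> chamber f q)"
    proof (rule SUP_least, rule ennreal_le_epsilon)
      fix b :: nat and e :: real assume "0 < e"
      then obtain k where k: "1 / Suc k \<le> e" using e0 by blast
      have "emeasure lborel (U \<inter> F -` B \<inter> X b) \<le> emeasure lborel ((A b k \<inter> F -` B) \<union> (X b - A b k))"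
        using nonexpandingD(3)[OF A(1) B] Xb Ab by (intro emeasure_mono) auto
      also have "\<dots> \<le> emeasure lborel (A b k \<inter> F -` B) + emeasure lborel (X b - A b k)"
        using nonexpandingD(3)[OF A(1) B] Xb Ab by (intro emeasure_subadditive) auto
      also have "\<dots> \<le> emeasure lborel (B \<inter> chamber f q) + ennreal e"
        using nonexpandingD(4)[OF A(1) B] A(4)[of b k] k by (intro add_mono) (auto intro: order_trans ennreal_leI)
      finally show "emeasure lborel (U \<inter> F -` B \<inter> X b) \<le> emeasure lborel (B \<inter> chamber f q) + ennreal e" .
    qed
    finally show "emeasure lborel (U \<inter> F -` B) \<le> emeasure lborel (B \<inter> chamber f q)" .
  qed
  have "chamber f p - U \<in> sets borel" using U by measurable
  from SUP[OF this] have "emeasure lborel (chamber f p - U) = (SUP b. emeasure lborel ((chamber f p - U) \<inter> X b))" by auto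
  also have "\<dots> \<le> 0"
  proof (rule SUP_least, rule ennreal_le_epsilon)
    fix b :: nat and e :: real assume "0 < e"
    then obtain k where k: "1 / Suc k \<le> e" using e0 by blast
    have "emeasure lborel ((chamber f p - U) \<inter> X b) \<le> emeasure lborel (X b - A b k)"
      using Xb Ab by (intro emeasure_mono) (auto simp: U_def)
    also have "\<dots> \<le> ennreal e" using A(4)[of b k] k by (auto intro: order_trans ennreal_leI)
    finally show "emeasure lborel ((chamber f p - U) \<inter> X b) \<le> 0 + ennreal e" by simp
  qed
  finally have "emeasure lborel (chamber f p - U) = 0" by simp
  then show ?thesis using m A(2,3) unfolding F_def by (intro exI[of _ U]) (auto simp: U_def)
qed

section \<open>Both chambers together\<close>

definition table :: "(real \<Rightarrow> real) \<Rightarrow> real \<Rightarrow> (real \<times> real) set" where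
  "table f t = {x. 0 < fst x \<and> fst x < 1 \<and> fst x \<noteq> f t}"

lemma table_borel [measurable]: "table f t \<in> sets borel"
  unfolding table_def by measurable

lemma table_chamber:
  assumes "wall a M K f"
  shows "table f t = chamber f t \<union> flip -` chamber (\<lambda>t. 1 - f t) t" "chamber f t \<inter> flip -` chamber (\<lambda>t. 1 - f t) t = {}"
proof -
  have f: "0 < f t" "f t < 1" using wall_facts(5,6)[OF assms] by auto
  show "table f t = chamber f t \<union> flip -` chamber (\<lambda>t. 1 - f t) t" "chamber f t \<inter> flip -` chamber (\<lambda>t. 1 - f t) t = {}"
    using f by (auto simp: table_def chamber_def flip_def)
qed

lemma flow_flip:
  assumes "p < q" "reach_below (\<lambda>t. 1 - f t) p q (flip x) x'"
  shows "flow f p q x = flip x'" "reach f p q x (flip x')"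
proof -
  show "reach f p q x (flip x')" using assms(2) by (simp add: reach_def)
  then show "flow f p q x = flip x'" by (rule flow_eq[OF assms(1)])
qed

text \<open>The upper chamber is the lower one of the turned table, conjugated by
  \<open>flip\<close>. The targets are disjoint, so the two pieces can be united.\<close>

lemma interval_flow:
  assumes wall: "wall a M K f" and pq: "p < q"
  shows "\<exists>A. nonexpanding A (table f q) (flow f p q) \<and> A \<subseteq> table f p \<and>
    (\<forall>x\<in>A. flow f p q x \<in> table f q \<and> reach f p q x (flow f p q x)) \<and>
    emeasure lborel (table f p - A) = 0"
proof -
  let ?g = "\<lambda>t. 1 - f t"
  have wg: "wall a M K ?g" using wall_flip[OF wall] .
  obtain A1 where A1: "nonexpanding A1 (chamber f q) (flow f p q)" "A1 \<subseteq> chamber f p"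
    "\<And>x. x \<in> A1 \<Longrightarrow> flow f p q x \<in> chamber f q \<and> reach_below f p q x (flow f p q x)"
    "emeasure lborel (chamber f p - A1) = 0" using interval_below[OF wall pq] by auto
  obtain A2 where A2: "nonexpanding A2 (chamber ?g q) (flow ?g p q)" "A2 \<subseteq> chamber ?g p"
    "\<And>x. x \<in> A2 \<Longrightarrow> flow ?g p q x \<in> chamber ?g q \<and> reach_below ?g p q x (flow ?g p q x)"
    "emeasure lborel (chamber ?g p - A2) = 0" using interval_below[OF wg pq] by auto
  note [measurable] = nonexpandingD(1)[OF A1(1)] nonexpandingD(1)[OF A2(1)]
  have fA2: "flow f p q x = flip (flow ?g p q (flip x))" "reach f p q x (flow f p q x)" if "x \<in> flip -` A2" for x
    using flow_flip[OF pq, of f x "flow ?g p q (flip x)"] A2(3)[of "flip x"] that by auto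
  have ff: "flip -` flip -` S = S" for S by (simp add: vimage_def)
  have m: "nonexpanding (flip -` A2 \<inter> flip -` A2) (chamber ?g q) (flow ?g p q \<circ> flip)"
    by (rule nonexpanding_comp[OF nonexpanding_flip A2(1)]) measurable
  have c: "flip -` chamber ?g q \<in> sets borel" using measurable_sets_borel[OF flip_measurable] by simp
  have "nonexpanding ((flip -` A2 \<inter> flip -` A2) \<inter> (flow ?g p q \<circ> flip) -` chamber ?g q) (flip -` chamber ?g q) (flip \<circ> (flow ?g p q \<circ> flip))"
    using nonexpanding_comp[OF m nonexpanding_flip[OF c, unfolded ff]] .
  moreover have "(flip -` A2 \<inter> flip -` A2) \<inter> (flow ?g p q \<circ> flip) -` chamber ?g q = flip -` A2" using A2(3) by auto
  ultimately have "nonexpanding (flip -` A2) (flip -` chamber ?g q) (flip \<circ> (flow ?g p q \<circ> flip))" by simp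
  then have m2: "nonexpanding (flip -` A2) (flip -` chamber ?g q) (flow f p q)"
    by (rule nonexpanding_cong) (simp add: fA2)
  define A where "A = A1 \<union> flip -` A2"
  have mA: "nonexpanding A (table f q) (flow f p q)"
    unfolding A_def table_chamber(1)[OF wall] by (rule nonexpanding_union[OF A1(1) m2 table_chamber(2)[OF wall]])
  have N: "chamber ?g p - A2 \<in> sets borel" by measurable
  have N': "flip -` (chamber ?g p - A2) \<in> sets borel" using measurable_sets_borel[OF flip_measurable N] .
  have "emeasure lborel (flip -` (chamber ?g p - A2) \<inter> flip -` (chamber ?g p - A2)) \<le> emeasure lborel (chamber ?g p - A2)"
    by (rule nonexpanding_le[OF nonexpanding_flip[OF N] N])
  then have z: "emeasure lborel (flip -` (chamber ?g p - A2)) = 0" using A2(4) by simp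
  have "emeasure lborel (table f p - A) \<le> emeasure lborel ((chamber f p - A1) \<union> flip -` (chamber ?g p - A2))"
    unfolding A_def table_chamber(1)[OF wall] using N' by (intro emeasure_mono) auto
  also have "\<dots> \<le> emeasure lborel (chamber f p - A1) + emeasure lborel (flip -` (chamber ?g p - A2))"
    using N' by (intro emeasure_subadditive) auto
  finally have "emeasure lborel (table f p - A) = 0" using z A1(4) by simp
  moreover have "A \<subseteq> table f p" using A1(2) A2(2) unfolding A_def table_chamber(1)[OF wall] by auto
  moreover have "flow f p q x \<in> table f q \<and> reach f p q x (flow f p q x)" if "x \<in> A" for x
    using that A1(3)[of x] A2(3)[of "flip x"] fA2[of x] reach_belowI[of f p q x "flow f p q x"]
    unfolding table_chamber(1)[OF wall] A_def by auto
  ultimately show ?thesis using mA by blast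
qed

text \<open>The weaker notion for initial conditions on the slit, where the flux density destroys
  the area inequality. Unlike \<open>nonexpanding\<close> it passes to countable unions even if the
  images overlap.\<close>

definition null_preserving :: "(real \<times> real) set \<Rightarrow> (real \<times> real \<Rightarrow> real \<times> real) \<Rightarrow> bool" where
  "null_preserving A F \<longleftrightarrow> A \<in> sets borel \<and> (\<forall>B\<in>sets borel. A \<inter> F -` B \<in> sets borel \<and>
     (emeasure lborel B = 0 \<longrightarrow> emeasure lborel (A \<inter> F -` B) = 0))"

lemma null_preservingD:
  assumes "null_preserving A F"
  shows "A \<in> sets borel" "\<And>B. B \<in> sets borel \<Longrightarrow> A \<inter> F -` B \<in> sets borel"
    "\<And>B. B \<in> sets borel \<Longrightarrow> emeasure lborel B = 0 \<Longrightarrow> emeasure lborel (A \<inter> F -` B) = 0"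
  using assms by (auto simp: null_preserving_def)

lemma nonexpanding_null_preserving: "nonexpanding A R F \<Longrightarrow> null_preserving A F"
  unfolding null_preserving_def using nonexpandingD[of A R F] nonexpanding_le[of A R F] by (metis le_zero_eq)

lemma null_preserving_cong:
  assumes "null_preserving A F" "\<And>x. x \<in> A \<Longrightarrow> F x = G x"
  shows "null_preserving A G"
proof -
  have "A \<inter> F -` B = A \<inter> G -` B" for B using assms(2) by auto
  then show ?thesis using assms(1) by (simp add: null_preserving_def)
qed

lemma null_preserving_comp:
  assumes F: "null_preserving A F" and G: "null_preserving A' G"
  shows "null_preserving (A \<inter> F -` A') (G \<circ> F)"
  unfolding null_preserving_def
proof (intro conjI ballI impI)
  show "A \<inter> F -` A' \<in> sets borel" using null_preservingD(2)[OF F null_preservingD(1)[OF G]] .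
  fix B :: "(real \<times> real) set" assume B: "B \<in> sets borel"
  have e: "A \<inter> F -` A' \<inter> (G \<circ> F) -` B = A \<inter> F -` (A' \<inter> G -` B)" by auto
  show "A \<inter> F -` A' \<inter> (G \<circ> F) -` B \<in> sets borel"
    unfolding e using null_preservingD(2)[OF F null_preservingD(2)[OF G B]] .
  assume "emeasure lborel B = 0"
  then show "emeasure lborel (A \<inter> F -` A' \<inter> (G \<circ> F) -` B) = 0"
    unfolding e using null_preservingD(3)[OF F null_preservingD(2)[OF G B] null_preservingD(3)[OF G B]] by simp
qed

lemma null_preserving_UN:
  assumes "countable J" "\<And>j. j \<in> J \<Longrightarrow> null_preserving (A j) F"
  shows "null_preserving (\<Union>j\<in>J. A j) F"
  unfolding null_preserving_def
proof (intro conjI ballI impI)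
  show "(\<Union>j\<in>J. A j) \<in> sets borel"
    using assms null_preservingD(1) by (intro sets.countable_UN') auto
  fix B :: "(real \<times> real) set" assume B: "B \<in> sets borel"
  have e: "(\<Union>j\<in>J. A j) \<inter> F -` B = (\<Union>j\<in>J. A j \<inter> F -` B)" by auto
  have s: "A j \<inter> F -` B \<in> sets borel" if "j \<in> J" for j using null_preservingD(2)[OF assms(2)[OF that] B] .
  show "(\<Union>j\<in>J. A j) \<inter> F -` B \<in> sets borel" unfolding e using assms(1) s by (intro sets.countable_UN') auto
  assume z: "emeasure lborel B = 0"
  have "(\<Union>j\<in>J. A j \<inter> F -` B) \<in> null_sets lborel"
    using assms(1) s null_preservingD(3)[OF assms(2) B z] by (intro null_sets_UN') auto
  then show "emeasure lborel ((\<Union>j\<in>J. A j) \<inter> F -` B) = 0" unfolding e by auto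
qed


text \<open>Initial conditions are pairs \<open>(t, v)\<close>, describing the state \<open>(f t, v)\<close> at time \<open>t\<close>.\<close>

definition launch :: "(real \<Rightarrow> real) \<Rightarrow> real \<Rightarrow> real \<times> real \<Rightarrow> real \<times> real" where
  "launch f q x = flow f (fst x) q (f (fst x), snd x)"

text \<open>Launch times in a short window and velocities so far below the slopes of the slit that
  the ball leaves at once and flies freely until \<open>d\<close>, too slow to reach the floor by
  then.\<close>

definition launch_box :: "real \<Rightarrow> real \<Rightarrow> real \<Rightarrow> (real \<Rightarrow> real) \<Rightarrow> real \<Rightarrow> real \<Rightarrow> (real \<times> real) set" where
  "launch_box a M K f c d = {x. c < fst x \<and> fst x < d \<and> snd x < deriv f c - K * (d - c) \<and> (\<bar>snd x\<bar> + 2 * M) * (d - c) < a}"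

lemma launch_box_flight:
  assumes wall: "wall a M K f" and x: "(t, v) \<in> launch_box a M K f c d"
  shows "reach_below f t d (f t, v) (f t + v * (d - t), v)" "(f t + v * (d - t), v) \<in> chamber f d"
proof -
  have t: "c < t" "t < d" and v: "v < deriv f c - K * (d - c)" and va: "(\<bar>v\<bar> + 2 * M) * (d - c) < a"
    using x by (auto simp: launch_box_def)
  note wf = wall_facts[OF wall]
  have 2: "0 < f t + v * (r - t) \<and> f t + v * (r - t) < f r" if r: "t < r" "r \<le> d" for r
  proof
    have "\<bar>v * (r - t)\<bar> \<le> (\<bar>v\<bar> + 2 * M) * (d - c)"
      unfolding abs_mult using r t wf(2) by (intro mult_mono) auto
    then show "0 < f t + v * (r - t)" using va wf(4)[of t] by linarith
    have "v * (r - t) < (deriv f c - K * (d - c)) * (r - t)" using v r by (intro mult_strict_right_mono) auto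
    also have "\<dots> \<le> f r - f t" using wall_lower[OF wall, of c t r d] r t by simp
    finally show "f t + v * (r - t) < f r" by simp
  qed
  show "reach_below f t d (f t, v) (f t + v * (d - t), v)"
    using reach_below_flight[OF t(2) _ _ _ _ 2] 2[of d] t(2) wf(5)[of t] by (simp add: bounce_def)
  show "(f t + v * (d - t), v) \<in> chamber f d" using 2[of d] t by (simp add: chamber_def)
qed

text \<open>By \<open>flux_after\<close> the flux over the preimage of a null set is 0. On the box
  the density \<open>deriv f \<tau> - w\<close> is positive, so the preimage itself is null.\<close>

lemma launch_box_null_preserving:
  assumes wall: "wall a M K f" and cd: "c < d"
  shows "null_preserving (launch_box a M K f c d) (\<lambda>x. (f (fst x) + snd x * (d - fst x), snd x))"
    (is "null_preserving ?G ?C")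
  unfolding null_preserving_def
proof (intro conjI ballI impI)
  note [measurable] = wall_measurable(1,2)[OF wall]
  show G: "?G \<in> sets borel" unfolding launch_box_def by measurable
  fix B :: "(real \<times> real) set" assume B: "B \<in> sets borel"
  have "?C \<in> borel_measurable borel" by measurable
  then show E: "?G \<inter> ?C -` B \<in> sets borel" using G measurable_sets_borel[OF _ B, of ?C] by auto
  assume z: "emeasure lborel B = 0"
  have BB[measurable]: "B \<in> sets (borel \<Otimes>\<^sub>M borel)" using B unfolding borel_prod .
  define H where "H = (\<lambda>(\<tau>, w). (indicator {..deriv f c - K * (d - c)} w * (indicator B (f \<tau> + w * (d - \<tau>), w)
      * ennreal (deriv f \<tau> - w) * indicator {c..d} \<tau>)) :: ennreal)"
  have Hm: "H \<in> borel_measurable (lborel \<Otimes>\<^sub>M lborel)" unfolding H_def by measurable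
  have "integral\<^sup>N lborel H = (\<integral>\<^sup>+ w. \<integral>\<^sup>+ \<tau>. H (\<tau>, w) \<partial>lborel \<partial>lborel)"
    unfolding lborel_pair.nn_integral_snd[OF Hm] lborel_prod ..
  also have "\<dots> \<le> emeasure lborel (B \<inter> {(y, w). f c + w * (d - c) \<le> y \<and> y \<le> f d})"
    unfolding H_def prod.case by (rule flux_after[OF wall cd B])
  also have "\<dots> \<le> emeasure lborel B" using B by (intro emeasure_mono) auto
  finally have "integral\<^sup>N lborel H = 0" using z by simp
  moreover have "H \<in> borel_measurable lborel" using Hm unfolding lborel_prod .
  ultimately have "AE x in lborel. H x = 0" by (simp add: nn_integral_0_iff_AE)
  moreover have "H x \<noteq> 0" if "x \<in> ?G \<inter> ?C -` B" for x
  proof -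
    obtain \<tau> w where x: "x = (\<tau>, w)" by force
    have "\<bar>deriv f \<tau> - deriv f c\<bar> \<le> K * (d - c)"
      using wall_deriv_near[OF wall, of c \<tau> d] that x by (auto simp: launch_box_def)
    then have "w < deriv f \<tau>" using that x by (auto simp: launch_box_def abs_le_iff)
    then show ?thesis using that x by (auto simp: H_def launch_box_def indicator_def)
  qed
  ultimately have "AE x in lborel. x \<notin> ?G \<inter> ?C -` B" by (auto elim!: eventually_mono)
  then show "emeasure lborel (?G \<inter> ?C -` B) = 0"
    using AE_iff_null_sets[of "?G \<inter> ?C -` B" lborel] E by auto
qed

text \<open>A launch away from the slit is a free flight up to some later \<open>d\<close>, followed
  by the flow from \<open>d\<close> to \<open>q\<close>. Boxes with rational end points leave only
  countably many such factorizations, so the exceptional sets stay null.\<close>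

lemma launch_below:
  assumes wall: "wall a M K f" and pq: "p < q"
  shows "\<exists>A. null_preserving A (launch f q) \<and> A \<subseteq> {x. p < fst x \<and> fst x < q \<and> snd x < deriv f (fst x)} \<and>
    (\<forall>x\<in>A. launch f q x \<in> chamber f q \<and> reach_below f (fst x) q (f (fst x), snd x) (launch f q x)) \<and>
    emeasure lborel ({x. p < fst x \<and> fst x < q \<and> snd x < deriv f (fst x)} - A) = 0"
proof -
  note [measurable] = wall_measurable(1,2)[OF wall]
  define J where "J = {cd \<in> \<rat> \<times> \<rat>. p < fst cd \<and> fst cd < snd cd \<and> snd cd < q}"
  have J: "countable J" unfolding J_def using countable_rat
    by (intro countable_Collect countable_SIGMA) auto
  have "\<forall>d. d < q \<longrightarrow> (\<exists>A. nonexpanding A (chamber f q) (flow f d q) \<and> A \<subseteq> chamber f d \<and>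
    (\<forall>x\<in>A. flow f d q x \<in> chamber f q \<and> reach_below f d q x (flow f d q x)) \<and>
    emeasure lborel (chamber f d - A) = 0)"
    by (intro allI impI interval_below[OF wall])
  then obtain A where A: "\<And>d. d < q \<Longrightarrow> nonexpanding (A d) (chamber f q) (flow f d q)"
    "\<And>d x. d < q \<Longrightarrow> x \<in> A d \<Longrightarrow> flow f d q x \<in> chamber f q \<and> reach_below f d q x (flow f d q x)"
    "\<And>d. d < q \<Longrightarrow> emeasure lborel (chamber f d - A d) = 0"
    by metis
  define C where "C = (\<lambda>d x. (f (fst x) + snd x * (d - fst x), snd x))"
  define G where "G = (\<lambda>cd. launch_box a M K f (fst cd) (snd cd))"
  define U where "U = (\<lambda>cd. G cd \<inter> C (snd cd) -` A (snd cd))"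
  have C: "null_preserving (G cd) (C (snd cd))" if "cd \<in> J" for cd
    unfolding G_def C_def using launch_box_null_preserving[OF wall] that by (auto simp: J_def)
  have U: "null_preserving (U cd) (launch f q)"
    "\<And>x. x \<in> U cd \<Longrightarrow> launch f q x \<in> chamber f q \<and> reach_below f (fst x) q (f (fst x), snd x) (launch f q x)"
    if cd: "cd \<in> J" for cd
  proof -
    have dq: "snd cd < q" using cd by (auto simp: J_def)
    have r: "launch f q x = flow f (snd cd) q (C (snd cd) x)"
      "launch f q x \<in> chamber f q \<and> reach_below f (fst x) q (f (fst x), snd x) (launch f q x)" if x: "x \<in> U cd" for x
    proof -
      have tv: "(fst x, snd x) \<in> launch_box a M K f (fst cd) (snd cd)" "C (snd cd) x \<in> A (snd cd)"
        using x by (auto simp: U_def G_def)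
      have t: "fst x < snd cd" using tv(1) by (simp add: launch_box_def)
      have "reach_below f (fst x) q (f (fst x), snd x) (flow f (snd cd) q (C (snd cd) x))"
        using reach_below_trans[OF launch_box_flight(1)[OF wall tv(1)]] A(2)[OF dq tv(2)] t dq by (auto simp: C_def)
      moreover from this show "launch f q x = flow f (snd cd) q (C (snd cd) x)"
        unfolding launch_def using t dq by (intro flow_eq reach_belowI) auto
      ultimately show "launch f q x \<in> chamber f q \<and> reach_below f (fst x) q (f (fst x), snd x) (launch f q x)"
        using A(2)[OF dq tv(2)] by simp
    qed
    show "null_preserving (U cd) (launch f q)"
    proof (rule null_preserving_cong)
      show "null_preserving (U cd) (flow f (snd cd) q \<circ> C (snd cd))"
        unfolding U_def by (rule null_preserving_comp[OF C[OF cd] nonexpanding_null_preserving[OF A(1)[OF dq]]])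
    qed (simp add: r(1))
    show "\<And>x. x \<in> U cd \<Longrightarrow> launch f q x \<in> chamber f q \<and> reach_below f (fst x) q (f (fst x), snd x) (launch f q x)"
      by (rule r(2))
  qed
  define V where "V = {x. p < fst x \<and> fst x < q \<and> snd x < deriv f (fst x)}"
  have V: "V \<in> sets borel" unfolding V_def by measurable
  have sub: "G cd \<subseteq> V" if "cd \<in> J" for cd
  proof
    fix x assume x: "x \<in> G cd"
    have "\<bar>deriv f (fst x) - deriv f (fst cd)\<bar> \<le> K * (snd cd - fst cd)"
      using wall_deriv_near[OF wall, of "fst cd" "fst x" "snd cd"] x by (auto simp: G_def launch_box_def)
    then have "snd x < deriv f (fst x)" using x by (auto simp: G_def launch_box_def abs_le_iff)
    then show "x \<in> V" using x that by (auto simp: G_def launch_box_def V_def J_def)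
  qed
  have cover: "\<exists>cd\<in>J. x \<in> G cd" if "x \<in> V" for x
  proof -
    obtain t v where x: "x = (t, v)" by force
    have t: "p < t" "t < q" "v < deriv f t" using that x by (auto simp: V_def)
    note wf = wall_facts[OF wall]
    \<comment> \<open>Keeps the box inside the interval, the variation of the slope below a quarter
      of \<open>deriv f t - v\<close>, and the distance travelled below \<open>a / 2\<close>; the
      box may be up to \<open>2 * \<delta>\<close> long, hence the factors 8 and 4.\<close>
    define \<delta> where "\<delta> = Min {(t - p), (q - t), (deriv f t - v) / (8 * (K + 1)), a / (4 * (\<bar>v\<bar> + 2 * M + 1))}"
    have "0 < \<delta>" using t wf(1-3) by (auto simp: \<delta>_def intro!: divide_pos_pos)
    have \<delta>: "\<delta> \<le> t - p" "\<delta> \<le> q - t" "\<delta> \<le> (deriv f t - v) / (8 * (K + 1))" "\<delta> \<le> a / (4 * (\<bar>v\<bar> + 2 * M + 1))"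
      by (auto simp: \<delta>_def)
    obtain c where c: "c \<in> \<rat>" "t - \<delta> < c" "c < t" using Rats_dense_in_real[of "t - \<delta>" t] \<open>0 < \<delta>\<close> by auto
    obtain d where d: "d \<in> \<rat>" "t < d" "d < t + \<delta>" using Rats_dense_in_real[of t "t + \<delta>"] \<open>0 < \<delta>\<close> by auto
    have dc: "0 < d - c" "d - c < 2 * \<delta>" using c d by auto
    have "K * (d - c) \<le> (K + 1) * (2 * \<delta>)" using dc wf(3) by (intro mult_mono) auto
    also have "\<dots> \<le> (K + 1) * (2 * ((deriv f t - v) / (8 * (K + 1))))" using \<delta>(3) wf(3) by (intro mult_left_mono) auto
    also have "\<dots> = (deriv f t - v) / 4" using wf(3) by (simp add: field_simps)
    finally have k: "K * (d - c) \<le> (deriv f t - v) / 4" .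
    have "\<bar>deriv f t - deriv f c\<bar> \<le> K * (d - c)" using wall_deriv_near[OF wall, of c t d] c d by simp
    then have 1: "v < deriv f c - K * (d - c)" using k t(3) by (simp add: abs_le_iff)
    have "(\<bar>v\<bar> + 2 * M) * (d - c) \<le> (\<bar>v\<bar> + 2 * M + 1) * (2 * \<delta>)" using dc wf(2) by (intro mult_mono) auto
    also have "\<dots> \<le> (\<bar>v\<bar> + 2 * M + 1) * (2 * (a / (4 * (\<bar>v\<bar> + 2 * M + 1))))" using \<delta>(4) wf(2) by (intro mult_left_mono) auto
    also have "\<dots> = a / 2" using wf(2) by (simp add: field_simps)
    finally have 2: "(\<bar>v\<bar> + 2 * M) * (d - c) < a" using wf(1) by simp
    show ?thesis
      using c d \<delta> 1 2 by (intro bexI[of _ "(c, d)"]) (auto simp: G_def launch_box_def x J_def)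
  qed
  define W where "W = (\<Union>cd\<in>J. U cd)"
  have W: "null_preserving W (launch f q)" unfolding W_def by (rule null_preserving_UN[OF J U(1)])
  have "(\<Union>cd\<in>J. G cd \<inter> C (snd cd) -` (chamber f (snd cd) - A (snd cd))) \<in> null_sets lborel"
  proof (intro null_sets_UN' J)
    fix cd assume cd: "cd \<in> J"
    have dq: "snd cd < q" using cd by (auto simp: J_def)
    have N: "chamber f (snd cd) - A (snd cd) \<in> sets borel" using nonexpandingD(1)[OF A(1)[OF dq]] by measurable
    show "G cd \<inter> C (snd cd) -` (chamber f (snd cd) - A (snd cd)) \<in> null_sets lborel"
      using null_preservingD(2)[OF C[OF cd] N] null_preservingD(3)[OF C[OF cd] N A(3)[OF dq]] by auto
  qed
  moreover have "V - W \<subseteq> (\<Union>cd\<in>J. G cd \<inter> C (snd cd) -` (chamber f (snd cd) - A (snd cd)))"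
  proof
    fix x assume x: "x \<in> V - W"
    then obtain cd where cd: "cd \<in> J" "x \<in> G cd" using cover[of x] by blast
    then have "C (snd cd) x \<in> chamber f (snd cd)"
      using launch_box_flight(2)[OF wall, of "fst x" "snd x" "fst cd" "snd cd"] by (simp add: G_def C_def)
    moreover have "C (snd cd) x \<notin> A (snd cd)" using x cd by (auto simp: W_def U_def)
    ultimately show "x \<in> (\<Union>cd\<in>J. G cd \<inter> C (snd cd) -` (chamber f (snd cd) - A (snd cd)))" using cd by blast
  qed
  ultimately have "V - W \<in> null_sets lborel"
    using V null_preservingD(1)[OF W] by (auto intro: null_sets_subset)
  moreover have "W \<subseteq> V" using sub by (auto simp: W_def U_def)
  moreover have "launch f q x \<in> chamber f q \<and> reach_below f (fst x) q (f (fst x), snd x) (launch f q x)" if "x \<in> W" for x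
    using that U(2)[of _ x] unfolding W_def by blast
  ultimately show ?thesis using W unfolding V_def by (intro exI[of _ W]) auto
qed


lemma null_preserving_flip: "S \<in> sets borel \<Longrightarrow> null_preserving (flip -` S) flip"
  by (rule nonexpanding_null_preserving[OF nonexpanding_flip])

text \<open>On initial conditions, turning the table reverses the velocity and keeps the time; the
  height is implied by the time.\<close>

lemma null_preserving_reverse:
  assumes S: "S \<in> sets borel"
  shows "null_preserving ((\<lambda>x. (fst x, - snd x)) -` S) (\<lambda>x. (fst x, - snd x))"
    (is "null_preserving _ ?r")
proof -
  have r: "?r \<in> borel_measurable borel" by measurable
  have z: "emeasure lborel (?r -` B) = 0" if B: "B \<in> sets borel" "emeasure lborel B = 0" for B
  proof -
    define g where "g = (\<lambda>w. emeasure lborel ((\<lambda>y. (y, w)) -` B))"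
    have B': "B \<in> sets (lborel \<Otimes>\<^sub>M lborel)" unfolding lborel_prod using B by simp
    have g: "g \<in> borel_measurable borel"
      using lborel_pair.measurable_emeasure_Pair2[OF B'] unfolding g_def by simp
    have "(\<lambda>y. (y, w)) -` ?r -` B = (\<lambda>y. (y, - w)) -` B" for w by auto
    then have "emeasure lborel (?r -` B) = (\<integral>\<^sup>+ w. g (0 + - 1 * w) \<partial>lborel)"
      by (subst emeasure_slices[OF measurable_sets_borel[OF r B(1)]]) (simp add: g_def)
    also have "\<dots> = (\<integral>\<^sup>+ w. g w \<partial>lborel)"
      using nn_integral_real_affine[OF g, of "-1" 0] by simp
    also have "\<dots> = emeasure lborel B" unfolding g_def by (rule emeasure_slices[OF B(1), symmetric])
    finally show ?thesis using B(2) by simp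
  qed
  have e: "?r -` S \<inter> ?r -` B = ?r -` (B \<inter> S)" for B by auto
  have sub: "emeasure lborel (B \<inter> S) = 0" if "B \<in> sets borel" "emeasure lborel B = 0" for B
    using that S emeasure_mono[of "B \<inter> S" B lborel] by auto
  show ?thesis
    unfolding null_preserving_def e
  proof (intro conjI ballI impI)
    show "?r -` S \<in> sets borel" using measurable_sets_borel[OF r S] .
    fix B :: "(real \<times> real) set" assume B: "B \<in> sets borel"
    then show "?r -` (B \<inter> S) \<in> sets borel" using measurable_sets_borel[OF r, of "B \<inter> S"] S by blast
    assume "emeasure lborel B = 0"
    then show "emeasure lborel (?r -` (B \<inter> S)) = 0" using z[of "B \<inter> S"] sub[of B] B S by blast
  qed
qed

lemma launch_flow:
  assumes wall: "wall a M K f" and pq: "p < q"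
  shows "\<exists>A. null_preserving A (launch f q) \<and> A \<subseteq> {x. p < fst x \<and> fst x < q} \<and>
    (\<forall>x\<in>A. launch f q x \<in> table f q \<and> reach f (fst x) q (f (fst x), snd x) (launch f q x)) \<and>
    emeasure lborel ({x. p < fst x \<and> fst x < q} - A) = 0"
proof -
  let ?g = "\<lambda>t. 1 - f t" and ?r = "\<lambda>x::real\<times>real. (fst x, - snd x)"
  have wg: "wall a M K ?g" using wall_flip[OF wall] .
  have dg: "deriv ?g t = - deriv f t" for t by (rule deriv_flip[OF wall])
  note [measurable] = wall_measurable(1,2)[OF wall]
  obtain A1 where A1: "null_preserving A1 (launch f q)"
    "A1 \<subseteq> {x. p < fst x \<and> fst x < q \<and> snd x < deriv f (fst x)}"
    "\<And>x. x \<in> A1 \<Longrightarrow> launch f q x \<in> chamber f q \<and> reach_below f (fst x) q (f (fst x), snd x) (launch f q x)"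
    "emeasure lborel ({x. p < fst x \<and> fst x < q \<and> snd x < deriv f (fst x)} - A1) = 0"
    using launch_below[OF wall pq] by auto
  obtain A2 where A2: "null_preserving A2 (launch ?g q)"
    "A2 \<subseteq> {x. p < fst x \<and> fst x < q \<and> snd x < deriv ?g (fst x)}"
    "\<And>x. x \<in> A2 \<Longrightarrow> launch ?g q x \<in> chamber ?g q \<and> reach_below ?g (fst x) q (?g (fst x), snd x) (launch ?g q x)"
    "emeasure lborel ({x. p < fst x \<and> fst x < q \<and> snd x < deriv ?g (fst x)} - A2) = 0"
    using launch_below[OF wg pq] by auto
  note A2s = null_preservingD(1)[OF A2(1)]
  have l: "launch f q x = flip (launch ?g q (?r x))" "launch f q x \<in> table f q"
    "reach f (fst x) q (f (fst x), snd x) (launch f q x)" if x: "x \<in> ?r -` A2" for x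
  proof -
    have "fst x < q" using x A2(2) by auto
    moreover have "reach_below ?g (fst x) q (flip (f (fst x), snd x)) (launch ?g q (?r x))"
      using A2(3)[of "?r x"] x by (simp add: flip_def)
    ultimately show e: "launch f q x = flip (launch ?g q (?r x))"
      and "reach f (fst x) q (f (fst x), snd x) (launch f q x)"
      using flow_flip[of "fst x" q f "(f (fst x), snd x)" "launch ?g q (?r x)"]
      by (simp_all add: launch_def[of f])
    show "launch f q x \<in> table f q"
      unfolding e table_chamber(1)[OF wall] using A2(3)[of "?r x"] x by simp
  qed
  define U where "U = ?r -` A2"
  have U: "null_preserving U (launch f q)"
  proof (rule null_preserving_cong)
    have 1: "null_preserving (?r -` A2 \<inter> ?r -` A2) (launch ?g q \<circ> ?r)"
      by (rule null_preserving_comp[OF null_preserving_reverse[OF A2s] A2(1)])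
    have f: "null_preserving UNIV flip" using null_preserving_flip[of UNIV] by simp
    show "null_preserving U (flip \<circ> (launch ?g q \<circ> ?r))"
      using null_preserving_comp[OF 1 f] by (simp add: U_def)
  qed (simp add: l(1) U_def)
  define A where "A = (\<Union>i\<in>{0::nat, 1}. if i = 0 then A1 else U)"
  have A: "null_preserving A (launch f q)" unfolding A_def
    by (rule null_preserving_UN) (use A1(1) U in \<open>auto split: if_splits\<close>)
  have AU: "A = A1 \<union> U" by (auto simp: A_def)
  define N1 where "N1 = {x. p < fst x \<and> fst x < q \<and> snd x < deriv f (fst x)} - A1"
  define N2 where "N2 = {x. p < fst x \<and> fst x < q \<and> snd x < deriv ?g (fst x)} - A2"
  \<comment> \<open>Launches with exactly the velocity of the slit form the graph of
    \<open>deriv f\<close>, a null set, and are discarded.\<close>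
  define N3 where "N3 = {x. snd x = deriv f (fst x)}"
  have N1: "N1 \<in> null_sets lborel" unfolding N1_def using A1(4) null_preservingD(1)[OF A1(1)] by auto
  have N2s: "N2 \<in> sets borel" unfolding N2_def dg using A2s by auto
  have N2: "?r -` N2 \<in> null_sets lborel"
    using null_preservingD(3)[OF null_preserving_reverse[OF N2s] N2s] A2(4)
      null_preservingD(1)[OF null_preserving_reverse[OF N2s]] by (auto simp: N2_def)
  have N3: "N3 \<in> null_sets lborel"
  proof -
    have s: "N3 \<in> sets borel" unfolding N3_def by measurable
    then have s': "N3 \<in> sets (lborel \<Otimes>\<^sub>M lborel)" unfolding lborel_prod by simp
    have "Pair t -` N3 = {deriv f t}" for t by (auto simp: N3_def)
    then have "emeasure lborel N3 = 0"
      using lborel.emeasure_pair_measure_alt[OF s'] unfolding lborel_prod by simp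
    then show ?thesis using s by auto
  qed
  have "N1 \<union> ?r -` N2 \<union> N3 \<in> null_sets lborel" using N1 N2 N3 by (intro null_sets.Un)
  moreover have "{x. p < fst x \<and> fst x < q} - A \<subseteq> N1 \<union> ?r -` N2 \<union> N3"
    unfolding AU by (auto simp: N1_def N2_def N3_def U_def dg)
  moreover have "{x. p < fst x \<and> fst x < q} - A \<in> sets lborel"
    using null_preservingD(1)[OF A] by auto
  ultimately have "{x. p < fst x \<and> fst x < q} - A \<in> null_sets lborel"
    by (auto intro: null_sets_subset)
  moreover have "A \<subseteq> {x. p < fst x \<and> fst x < q}" using A1(2) A2(2) by (auto simp: AU U_def)
  moreover have "launch f q x \<in> table f q \<and> reach f (fst x) q (f (fst x), snd x) (launch f q x)" if "x \<in> A" for x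
  proof (cases "x \<in> A1")
    case True
    then show ?thesis using A1(3)[OF True] reach_belowI table_chamber(1)[OF wall] by blast
  next
    case False
    then show ?thesis using l(2,3)[of x] that by (simp add: AU U_def)
  qed
  ultimately show ?thesis using A by blast
qed

section \<open>Trapping below the slits\<close>

lemma reach_low:
  assumes wall: "wall a M K f" and r: "reach f s t x x'" and st: "s \<le> t" "t \<le> s + 2" and low: "fst x < f s"
  shows "fst x' \<le> f t" "\<bar>\<bar>snd x'\<bar> * f t - \<bar>snd x\<bar> * f s\<bar> \<le> 2 * M + 4 * K"
proof -
  have b: "reach_below f s t x x'" using reach_range(1)[OF r st(1) low] .
  show "fst x' \<le> f t" using reach_below_range[OF b st(1)] by simp
  have "2 * K * (t - s) \<le> 2 * K * 2" using st wall by (intro mult_left_mono) (auto simp: wall_def)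
  then show "\<bar>\<bar>snd x'\<bar> * f t - \<bar>snd x\<bar> * f s\<bar> \<le> 2 * M + 4 * K"
    using reach_below_speed[OF wall b st(1)] by linarith
qed

lemma reach_high:
  assumes wall: "wall a M K f" and r: "reach f s t x x'" and st: "s \<le> t" "t \<le> s + 2" and high: "f s < fst x"
  shows "f t \<le> fst x'" "\<bar>\<bar>snd x'\<bar> * (1 - f t) - \<bar>snd x\<bar> * (1 - f s)\<bar> \<le> 2 * M + 4 * K"
proof -
  have b: "reach_below (\<lambda>t. 1 - f t) s t (flip x) (flip x')" using reach_range(2)[OF r st(1) high] .
  show "f t \<le> fst x'" using reach_below_range(4)[OF b st(1)] by (simp add: flip_def)
  have "2 * K * (t - s) \<le> 2 * K * 2" using st wall by (intro mult_left_mono) (auto simp: wall_def)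
  then show "\<bar>\<bar>snd x'\<bar> * (1 - f t) - \<bar>snd x\<bar> * (1 - f s)\<bar> \<le> 2 * M + 4 * K"
    using reach_below_speed[OF wall_flip[OF wall] b st(1)] by (simp add: flip_def)
qed

text \<open>Here \<open>u0\<close>, \<open>u1\<close>, \<open>u2\<close> are the speeds at
  successive passages, and \<open>A0\<close>, \<open>A1\<close> and \<open>B1\<close>,
  \<open>B2\<close> the widths at the ends of the two intervals between them. At the middle passage
  the width jumps from \<open>A1\<close> to \<open>B1\<close> while the speed does not.\<close>

lemma two_step_lower:
  fixes u0 u1 u2 A0 A1 B1 B2 C :: real
  assumes pos: "0 < A0" "0 < A1" "0 < B1" "0 < B2"
    and 1: "u0 * A0 - C \<le> u1 * A1" and 2: "u1 * B1 - C \<le> u2 * B2"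
  shows "u0 * (A0 * B1 / (A1 * B2)) - (C * B1 / (A1 * B2) + C / B2) \<le> u2"
proof -
  have "(u0 * A0 - C) / A1 \<le> u1" using 1 pos by (simp add: field_simps)
  then have "(u0 * A0 - C) / A1 * B1 \<le> u1 * B1" using pos by (intro mult_right_mono) auto
  then have "(u0 * A0 - C) / A1 * B1 - C \<le> u2 * B2" using 2 by linarith
  then have "((u0 * A0 - C) / A1 * B1 - C) / B2 \<le> u2" using pos by (simp add: field_simps)
  moreover have "((u0 * A0 - C) / A1 * B1 - C) / B2 = u0 * (A0 * B1 / (A1 * B2)) - (C * B1 / (A1 * B2) + C / B2)"
    using pos by (simp add: field_simps)
  ultimately show ?thesis by simp
qed

lemma two_step_upper:
  fixes u0 u1 u2 A0 A1 B1 B2 C :: real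
  assumes pos: "0 < A0" "0 < A1" "0 < B1" "0 < B2"
    and 1: "u1 * A1 \<le> u0 * A0 + C" and 2: "u2 * B2 \<le> u1 * B1 + C"
  shows "u2 \<le> (A0 * B1 / (A1 * B2)) * u0 + (C * B1 / (A1 * B2) + C / B2)"
  using two_step_lower[of A0 A1 B1 B2 "- u0" C "- u1" "- u2"] assms by (simp add: mult.commute)

text \<open>The ordering in which the slit is raised at both passages, with \<open>p\<close> and
  \<open>u\<close> in the roles of \<open>t1\<close> and \<open>t2\<close>: the right slit is
  current between \<open>p\<close> and \<open>u\<close>, the left one between \<open>u\<close> and
  \<open>p + 2\<close>.\<close>

locale switching =
  fixes a M K :: real and fL fR :: "real \<Rightarrow> real" and p u :: real
  assumes walls: "wall a M K fL" "wall a M K fR"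
    and times: "p < u" "u < p + 2"
    and periodic: "\<And>t. fL (t + 2) = fL t" "\<And>t. fR (t + 2) = fR t"
    and order: "fL p < fR p" "fR u < fL u"
begin

definition period_map :: "real \<times> real \<Rightarrow> real \<times> real" where
  "period_map = flow fL u (p + 2) \<circ> flow fR p u"

lemma f_bounds: "0 < fL t" "fL t < 1" "0 < fR t" "fR t < 1" "0 < a" "0 \<le> M" "0 \<le> K" "a \<le> fL t" "a \<le> fR t" "a \<le> 1 - fL t" "a \<le> 1 - fR t"
  using wall_facts[OF walls(1)] wall_facts[OF walls(2)]
    wall_facts[OF wall_flip[OF walls(1)]] wall_facts[OF wall_flip[OF walls(2)]] by auto

text \<open>Below the slits the width of the chamber is \<open>fR p\<close> after time \<open>p\<close>, \<open>fL u\<close> after time \<open>u\<close>,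
  but only \<open>fR u\<close> and \<open>fL p\<close> before; so the speed grows over a period. Above the slits it
  decreases, and the ball cannot return from below.\<close>

lemma dichotomy:
  obtains V r \<rho> C where "0 < V" "1 < r" "0 < \<rho>" "\<rho> < 1" "0 \<le> C"
    "\<And>x x' x''. reach fR p u x x' \<Longrightarrow> reach fL u (p + 2) x' x'' \<Longrightarrow> fst x < fR p \<Longrightarrow>
       fst x'' < fR p \<and> (V < \<bar>snd x\<bar> \<longrightarrow> r * \<bar>snd x\<bar> \<le> \<bar>snd x''\<bar>)"
    "\<And>x x' x''. reach fR p u x x' \<Longrightarrow> reach fL u (p + 2) x' x'' \<Longrightarrow> fst x \<noteq> fR p \<Longrightarrow> fst x' \<noteq> fL u \<Longrightarrow>
       fR p \<le> fst x'' \<Longrightarrow> \<bar>snd x''\<bar> \<le> \<rho> * \<bar>snd x\<bar> + C"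
proof -
  define C0 where "C0 = 2 * M + 4 * K"
  have C0: "0 \<le> C0" using f_bounds(6,7) by (simp add: C0_def)
  have tt: "p \<le> u" "u \<le> p + 2" "u \<le> p + 2" "p + 2 \<le> u + 2" using times by auto
  define r0 where "r0 = fR p * fL u / (fR u * fL p)"
  define C1 where "C1 = C0 * fL u / (fR u * fL p) + C0 / fL p"
  define \<rho> where "\<rho> = (1 - fR p) * (1 - fL u) / ((1 - fR u) * (1 - fL p))"
  define C where "C = C0 * (1 - fL u) / ((1 - fR u) * (1 - fL p)) + C0 / (1 - fL p)"
  have r0: "1 < r0"
  proof -
    have "fR u * fL p < fL u * fR p" using order f_bounds by (intro mult_strict_mono) (auto intro: less_imp_le)
    then show ?thesis using f_bounds by (simp add: r0_def field_simps)
  qed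
  have \<rho>: "0 < \<rho>" "\<rho> < 1"
  proof -
    show "0 < \<rho>" using f_bounds by (simp add: \<rho>_def)
    have "(1 - fR p) * (1 - fL u) < (1 - fL p) * (1 - fR u)" using order f_bounds by (intro mult_strict_mono) (auto intro: less_imp_le)
    then show "\<rho> < 1"
      using f_bounds unfolding \<rho>_def by (subst divide_less_eq_1_pos) (simp_all add: mult.commute)
  qed
  have C1: "0 \<le> C1" using C0 f_bounds by (simp add: C1_def less_imp_le)
  have C: "0 \<le> C" using C0 f_bounds by (simp add: C_def less_imp_le)
  \<comment> \<open>Above \<open>V\<close> the error \<open>C1\<close> consumes at most half of the
    gain \<open>(r0 - 1) * \<bar>w\<bar>\<close>, which leaves the factor \<open>r\<close> halfway
    between 1 and \<open>r0\<close>.\<close>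
  define V where "V = 2 * C1 / (r0 - 1) + 1"
  define r where "r = (1 + r0) / 2"
  show ?thesis
  proof (rule that[of V r \<rho> C])
    show "0 < V" using C1 r0 by (simp add: V_def add_nonneg_pos)
    show "1 < r" using r0 by (simp add: r_def)
    fix x x' x'' assume R: "reach fR p u x x'" "reach fL u (p + 2) x' x''"
    {
      assume low: "fst x < fR p"
      note 1 = reach_low[OF walls(2) R(1) tt(1,2) low]
      have "fst x' < fL u" using 1(1) order by simp
      note 2 = reach_low[OF walls(1) R(2) tt(3,4) this, unfolded periodic]
      have "\<bar>snd x\<bar> * r0 - C1 \<le> \<bar>snd x''\<bar>"
        unfolding r0_def C1_def using 1(2) 2(2) f_bounds
        by (intro two_step_lower[where ?u1.0 = "\<bar>snd x'\<bar>"]) (auto simp: C0_def abs_le_iff)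
      moreover have "r * \<bar>snd x\<bar> \<le> \<bar>snd x\<bar> * r0 - C1" if "V < \<bar>snd x\<bar>"
      proof -
        have "2 * C1 / (r0 - 1) \<le> \<bar>snd x\<bar>" using that by (simp add: V_def)
        then have "2 * C1 \<le> \<bar>snd x\<bar> * (r0 - 1)" using r0 by (simp add: field_simps)
        then show ?thesis by (simp add: r_def field_simps)
      qed
      ultimately show "fst x'' < fR p \<and> (V < \<bar>snd x\<bar> \<longrightarrow> r * \<bar>snd x\<bar> \<le> \<bar>snd x''\<bar>)"
        using 2(1) order(1) by force
    }
    {
      assume ne: "fst x \<noteq> fR p" "fst x' \<noteq> fL u" and up: "fR p \<le> fst x''"
      \<comment> \<open>Argued backwards in time: from below the left slit at \<open>u\<close> the
        ball would end no higher than \<open>fL p < fR p\<close>, and from below the right slit at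
        \<open>p\<close> it would be below the left slit at \<open>u\<close>.\<close>
      have h': "fL u < fst x'"
        using reach_low(1)[OF walls(1) R(2) tt(3,4), unfolded periodic] up order ne by force
      have h: "fR p < fst x"
        using reach_low(1)[OF walls(2) R(1) tt(1,2)] h' order ne by force
      note 1 = reach_high(2)[OF walls(2) R(1) tt(1,2) h]
      note 2 = reach_high(2)[OF walls(1) R(2) tt(3,4) h', unfolded periodic]
      show "\<bar>snd x''\<bar> \<le> \<rho> * \<bar>snd x\<bar> + C"
        unfolding \<rho>_def C_def using 1 2 f_bounds
        by (intro two_step_upper[where ?u1.0 = "\<bar>snd x'\<bar>"]) (auto simp: C0_def abs_le_iff)
    }
  qed (use \<rho> C in auto)
qed

end

text \<open>A state of \<open>X\<close> outside \<open>D\<close> leaves \<open>A\<close> at a first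
  time \<open>k\<close>. Until then the iterates are defined and remain in \<open>X\<close>, so the
  state lies in the preimage of the null set \<open>X - A\<close> under the \<open>k\<close>-th
  iterate.\<close>

lemma null_preserving_iterate:
  assumes P: "null_preserving A P" and X: "X \<in> sets borel" and inv: "\<forall>x\<in>A. P x \<in> X"
    and null: "emeasure lborel (X - A) = 0"
  defines "D \<equiv> {x. \<forall>k. (P ^^ k) x \<in> A}"
  shows "\<And>B k. B \<in> sets borel \<Longrightarrow> D \<inter> (P ^^ k) -` B \<in> sets borel"
    "emeasure lborel (X - D) = 0"
proof -
  define Dk where "Dk = (\<lambda>k. {x. \<forall>j<k. (P ^^ j) x \<in> A})"
  have np: "null_preserving (Dk k) (P ^^ k)" for k
  proof (induction k)
    case 0
    show ?case by (simp add: Dk_def null_preserving_def)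
  next
    case (Suc k)
    have "Dk (Suc k) = Dk k \<inter> (P ^^ k) -` A" by (auto simp: Dk_def less_Suc_eq)
    then show ?case using null_preserving_comp[OF Suc P] by (simp add: comp_def)
  qed
  have D: "D = (\<Inter>k. Dk k)" unfolding D_def Dk_def by auto
  have Db: "D \<in> sets borel" unfolding D using null_preservingD(1)[OF np]
    by (intro sets.countable_INT'' ) auto
  show "D \<inter> (P ^^ k) -` B \<in> sets borel" if "B \<in> sets borel" for B k
  proof -
    have "D \<inter> (P ^^ k) -` B = D \<inter> (Dk k \<inter> (P ^^ k) -` B)" by (auto simp: D)
    then show ?thesis using Db null_preservingD(2)[OF np that, of k] by simp
  qed
  have XA: "X - A \<in> sets borel" using X null_preservingD(1)[OF P] by auto
  have "(\<Union>k. Dk k \<inter> (P ^^ k) -` (X - A)) \<in> null_sets lborel"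
    using null_preservingD(2)[OF np XA] null_preservingD(3)[OF np XA null]
    by (intro null_sets_UN) auto
  moreover have "X - D \<subseteq> (\<Union>k. Dk k \<inter> (P ^^ k) -` (X - A))"
  proof
    fix x assume x: "x \<in> X - D"
    then obtain k where "(P ^^ k) x \<notin> A" by (auto simp: D_def)
    define k where "k = (LEAST k. (P ^^ k) x \<notin> A)"
    have k: "(P ^^ k) x \<notin> A" unfolding k_def by (rule LeastI) fact
    have j: "(P ^^ j) x \<in> A" if "j < k" for j using not_less_Least[of j "\<lambda>k. (P ^^ k) x \<notin> A"] that by (auto simp: k_def)
    have "(P ^^ k) x \<in> X"
    proof (cases k)
      case (Suc i)
      then show ?thesis using inv j[of i] by simp
    qed (use x in simp)
    then show "x \<in> (\<Union>k. Dk k \<inter> (P ^^ k) -` (X - A))" using k j by (auto simp: Dk_def)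
  qed
  moreover have "X - D \<in> sets lborel" using X Db by auto
  ultimately have "X - D \<in> null_sets lborel" by (auto intro: null_sets_subset)
  then show "emeasure lborel (X - D) = 0" by auto
qed

context switching
begin

text \<open>A common reference set for the tables at different times, each of which omits from it
  only the null line at the height of the slit.\<close>

definition strip :: "(real \<times> real) set" where
  "strip = {x. 0 < fst x \<and> fst x < 1}"

text \<open>At a passage the height must avoid both slits, the one left behind and the one ahead,
  since orbits with a collision at \<open>x = lam\<close> are excluded. Avoiding \<open>fR\<close>
  at the end of the period is left to the next iterate.\<close>

definition orbit_states :: "(real \<times> real) set" where
  "orbit_states = {x. x \<in> table fR p \<and> reach fR p u x (flow fR p u x) \<and> flow fR p u x \<in> table fR u \<and> flow fR p u x \<in> table fL u \<and>
     reach fL u (p + 2) (flow fR p u x) (period_map x) \<and> period_map x \<in> table fL p}"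

lemma strip_table: "strip - table f t \<in> null_sets lborel"
proof (rule null_sets_subset)
  show "{x::real\<times>real. fst x + snd x * 0 = f t} \<in> null_sets lborel"
    using emeasure_line[of 0 "f t"] by auto
  show "strip - table f t \<in> sets lborel" unfolding strip_def table_def by measurable
qed (auto simp: strip_def table_def)

lemma strip_diff_null:
  assumes "A \<in> sets borel" "emeasure lborel (table f t - A) = 0"
  shows "strip - A \<in> null_sets lborel"
proof (rule null_sets_subset)
  have "table f t - A \<in> null_sets lborel" using assms by auto
  then show "(strip - table f t) \<union> (table f t - A) \<in> null_sets lborel"
    by (intro null_sets.Un strip_table)
  show "strip - A \<in> sets lborel" unfolding strip_def using assms(1) by measurable
qed auto

lemma period_flow:
  obtains A where "nonexpanding A (table fL p) period_map" "A \<subseteq> orbit_states" "emeasure lborel (strip - A) = 0"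
proof -
  obtain A1 where A1: "nonexpanding A1 (table fR u) (flow fR p u)" "A1 \<subseteq> table fR p"
    "\<And>x. x \<in> A1 \<Longrightarrow> flow fR p u x \<in> table fR u \<and> reach fR p u x (flow fR p u x)"
    "emeasure lborel (table fR p - A1) = 0" using interval_flow[OF walls(2) times(1)] by auto
  have pp: "fL (p + 2) = fL p" by (rule periodic)
  have tp: "table fL (p + 2) = table fL p" by (simp add: table_def pp)
  obtain A2 where A2: "nonexpanding A2 (table fL p) (flow fL u (p + 2))" "A2 \<subseteq> table fL u"
    "\<And>x. x \<in> A2 \<Longrightarrow> flow fL u (p + 2) x \<in> table fL p \<and> reach fL u (p + 2) x (flow fL u (p + 2) x)"
    "emeasure lborel (table fL u - A2) = 0" using interval_flow[OF walls(1) times(2)] unfolding tp by auto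
  define A where "A = A1 \<inter> flow fR p u -` A2"
  have A: "nonexpanding A (table fL p) period_map" unfolding A_def period_map_def by (rule nonexpanding_comp[OF A1(1) A2(1)])
  have 1: "strip - A1 \<in> null_sets lborel" by (rule strip_diff_null[OF nonexpandingD(1)[OF A1(1)] A1(4)])
  have 2: "strip - A2 \<in> null_sets lborel" by (rule strip_diff_null[OF nonexpandingD(1)[OF A2(1)] A2(4)])
  have s2: "strip - A2 \<in> sets borel" using 2 by auto
  have "A1 \<inter> flow fR p u -` (strip - A2) \<in> null_sets lborel"
    using 2 by (intro null_setsI null_preservingD(3)[OF nonexpanding_null_preserving[OF A1(1)] s2])
      (auto simp: nonexpandingD(3)[OF A1(1) s2])
  then have "(strip - A1) \<union> (A1 \<inter> flow fR p u -` (strip - A2)) \<in> null_sets lborel" using 1 by auto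
  moreover have "strip - A \<subseteq> (strip - A1) \<union> (A1 \<inter> flow fR p u -` (strip - A2))"
  proof
    fix x assume x: "x \<in> strip - A"
    show "x \<in> (strip - A1) \<union> (A1 \<inter> flow fR p u -` (strip - A2))"
    proof (cases "x \<in> A1")
      case True
      then have "flow fR p u x \<in> strip" using A1(3)[OF True] by (simp add: table_def strip_def)
      then show ?thesis using True x by (simp add: A_def)
    qed (use x in simp)
  qed
  moreover have "strip - A \<in> sets lborel" unfolding strip_def using nonexpandingD(1)[OF A] by measurable
  ultimately have "strip - A \<in> null_sets lborel" by (auto intro: null_sets_subset)
  moreover have "A \<subseteq> orbit_states"
  proof
    fix x assume x: "x \<in> A"
    then have "x \<in> A1" "flow fR p u x \<in> A2" by (auto simp: A_def)
    then show "x \<in> orbit_states"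
      using A1(2) A1(3)[of x] A2(2) A2(3)[of "flow fR p u x"] by (auto simp: orbit_states_def period_map_def)
  qed
  ultimately show ?thesis using A that by auto
qed

definition trap :: "real \<Rightarrow> (real \<times> real) set" where
  "trap V = {x. fst x < fR p \<and> V < \<bar>snd x\<bar>}"

lemma section_dynamics:
  obtains D V r \<rho> C W where
    "0 < V" "1 < r" "0 < \<rho>" "\<rho> < 1" "0 \<le> C" "D \<in> sets borel" "emeasure lborel (strip - D) = 0"
    "\<And>x k. x \<in> D \<Longrightarrow> (period_map ^^ k) x \<in> orbit_states"
    "\<And>x. x \<in> orbit_states \<Longrightarrow> x \<in> trap V \<Longrightarrow> period_map x \<in> trap V \<and> r * \<bar>snd x\<bar> \<le> \<bar>snd (period_map x)\<bar>"
    "\<And>x. x \<in> orbit_states \<Longrightarrow> period_map x \<notin> trap V \<Longrightarrow> \<bar>snd (period_map x)\<bar> \<le> max V (\<rho> * \<bar>snd x\<bar> + C)"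
    "{x \<in> D. \<exists>k. (period_map ^^ k) x \<in> trap V} \<in> sets borel"
    "emeasure lborel {x \<in> D. W < \<bar>snd x\<bar> \<and> (\<forall>k. (period_map ^^ k) x \<notin> trap V)} = 0"
proof -
  obtain A where A: "nonexpanding A (table fL p) period_map" "A \<subseteq> orbit_states" "emeasure lborel (strip - A) = 0"
    by (rule period_flow)
  obtain V r \<rho> C where c: "0 < V" "1 < r" "0 < \<rho>" "\<rho> < 1" "0 \<le> C"
    "\<And>x x' x''. reach fR p u x x' \<Longrightarrow> reach fL u (p + 2) x' x'' \<Longrightarrow> fst x < fR p \<Longrightarrow>
       fst x'' < fR p \<and> (V < \<bar>snd x\<bar> \<longrightarrow> r * \<bar>snd x\<bar> \<le> \<bar>snd x''\<bar>)"
    "\<And>x x' x''. reach fR p u x x' \<Longrightarrow> reach fL u (p + 2) x' x'' \<Longrightarrow> fst x \<noteq> fR p \<Longrightarrow> fst x' \<noteq> fL u \<Longrightarrow>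
       fR p \<le> fst x'' \<Longrightarrow> \<bar>snd x''\<bar> \<le> \<rho> * \<bar>snd x\<bar> + C"
    by (rule dichotomy) blast
  let ?P = period_map
  define D where "D = {x. \<forall>k. (?P ^^ k) x \<in> A}"
  have strip: "strip \<in> sets borel" unfolding strip_def by measurable
  have inv: "\<forall>x\<in>A. ?P x \<in> strip"
    using A(2) by (auto simp: orbit_states_def table_def strip_def)
  note it = null_preserving_iterate[OF nonexpanding_null_preserving[OF A(1)] strip inv A(3), folded D_def]
  have D: "D \<in> sets borel" using it(1)[of UNIV 0] by simp
  have orb: "(?P ^^ k) x \<in> orbit_states" if "x \<in> D" for x k using that A(2) by (auto simp: D_def)
  have DA: "x \<in> A" if "x \<in> D" for x using that unfolding D_def by (metis (mono_tags) funpow_0 mem_Collect_eq)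
  have PD: "?P x \<in> D" if "x \<in> D" for x
  proof -
    have "(?P ^^ k) (?P x) \<in> A" for k
      using that unfolding D_def by (metis (mono_tags) comp_apply funpow_Suc_right mem_Collect_eq)
    then show ?thesis by (simp add: D_def)
  qed
  have trap: "?P x \<in> trap V \<and> r * \<bar>snd x\<bar> \<le> \<bar>snd (?P x)\<bar>" if x: "x \<in> orbit_states" "x \<in> trap V" for x
  proof -
    have "fst (?P x) < fR p \<and> (V < \<bar>snd x\<bar> \<longrightarrow> r * \<bar>snd x\<bar> \<le> \<bar>snd (?P x)\<bar>)"
      using c(6)[of x "flow fR p u x" "?P x"] x by (auto simp: orbit_states_def trap_def)
    moreover have "V < \<bar>snd x\<bar>" using x by (simp add: trap_def)
    moreover have "1 * \<bar>snd x\<bar> \<le> r * \<bar>snd x\<bar>" using c(2) by (intro mult_right_mono) auto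
    ultimately show ?thesis by (auto simp: trap_def)
  qed
  have slow: "\<bar>snd (?P x)\<bar> \<le> max V (\<rho> * \<bar>snd x\<bar> + C)" if x: "x \<in> orbit_states" "?P x \<notin> trap V" for x
  proof (cases "fst (?P x) < fR p")
    case True
    then show ?thesis using x by (simp add: trap_def)
  next
    case False
    then have "\<bar>snd (?P x)\<bar> \<le> \<rho> * \<bar>snd x\<bar> + C"
      using c(7)[of x "flow fR p u x" "?P x"] x by (auto simp: orbit_states_def table_def)
    then show ?thesis by simp
  qed
  have tV: "trap V \<in> sets borel" unfolding trap_def by measurable
  have E: "{x \<in> D. \<exists>k. (?P ^^ k) x \<in> trap V} \<in> sets borel"
  proof -
    have e: "{x \<in> D. \<exists>k. (?P ^^ k) x \<in> trap V} = (\<Union>k. D \<inter> (?P ^^ k) -` trap V)" by blast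
    show ?thesis unfolding e using it(1)[OF tV] by (intro sets.countable_UN' image_subsetI countableI_type)
  qed
  \<comment> \<open>\<open>period_map\<close> maps \<open>N\<close> into itself, because a state is
    trapped at some time if its image is. This invariance makes \<open>step\<close> an inclusion
    between sets of one family.\<close>
  define N where "N = D - {x \<in> D. \<exists>k. (?P ^^ k) x \<in> trap V}"
  have N: "N \<in> sets borel" unfolding N_def using D E by auto
  have Ntrap: "(?P ^^ k) x \<notin> trap V" "x \<in> D" if "x \<in> N" for x k using that by (auto simp: N_def)
  have PN: "?P x \<in> N" if "x \<in> N" for x
  proof -
    have "(?P ^^ k) (?P x) \<notin> trap V" for k using Ntrap(1)[OF that, of "Suc k"] by (simp add: funpow_swap1)
    then show ?thesis using PD[OF Ntrap(2)[OF that]] by (simp add: N_def)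
  qed
  define \<theta> where "\<theta> = (1 + \<rho>) / 2"
  have \<theta>: "0 < \<theta>" "\<theta> < 1" "\<rho> < \<theta>" using c by (auto simp: \<theta>_def)
  \<comment> \<open>From this scale on, both \<open>V\<close> and \<open>\<rho> * w + C\<close> are
    at most \<open>\<theta> * w\<close>; \<theta> is chosen above \<rho> to absorb
    \<open>C\<close>.\<close>
  define W where "W = max (V / \<theta>) (2 * C / (1 - \<rho>) + 1)"
  have W0: "0 < W" using c by (simp add: W_def add_nonneg_pos less_max_iff_disj)
  define NW where "NW = (\<lambda>w. {x \<in> N. \<bar>snd x\<bar> \<le> w})"
  have NW: "NW w \<in> sets borel" for w
  proof -
    have "NW w = N \<inter> {x. \<bar>snd x\<bar> \<le> w}" by (auto simp: NW_def)
    then show ?thesis using N by simp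
  qed
  have step: "NW w \<subseteq> A \<inter> ?P -` NW (\<theta> * w)" if w: "W \<le> w" for w
  proof
    fix x assume x: "x \<in> NW w"
    have xN: "x \<in> N" "\<bar>snd x\<bar> \<le> w" using x by (auto simp: NW_def)
    have "x \<in> orbit_states" using DA[OF Ntrap(2)[OF xN(1)]] A(2) by auto
    moreover have "?P x \<notin> trap V" using Ntrap(1)[OF xN(1), of 1] by simp
    ultimately have s: "\<bar>snd (?P x)\<bar> \<le> max V (\<rho> * \<bar>snd x\<bar> + C)" using slow by blast
    have "V \<le> \<theta> * w"
    proof -
      have "V / \<theta> \<le> w" using w by (simp add: W_def)
      then show ?thesis using \<theta> by (simp add: field_simps)
    qed
    moreover have "\<rho> * \<bar>snd x\<bar> + C \<le> \<theta> * w"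
    proof -
      have "2 * C / (1 - \<rho>) \<le> w" using w by (simp add: W_def)
      then have "2 * C \<le> w * (1 - \<rho>)" using c by (simp add: field_simps)
      moreover have "\<rho> * \<bar>snd x\<bar> \<le> \<rho> * w" using xN c by (intro mult_left_mono) auto
      ultimately show ?thesis by (simp add: \<theta>_def field_simps)
    qed
    ultimately have "\<bar>snd (?P x)\<bar> \<le> \<theta> * w" using s by linarith
    then show "x \<in> A \<inter> ?P -` NW (\<theta> * w)"
      using DA[OF Ntrap(2)[OF xN(1)]] PN[OF xN(1)] by (simp add: NW_def)
  qed
  have fin: "emeasure lborel (NW w) < \<infinity>" for w
  proof -
    have "NW w \<subseteq> cbox (0, - w) (1, w)"
    proof
      fix x assume x: "x \<in> NW w"
      then have "x \<in> N" by (simp add: NW_def)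
      then have "x \<in> orbit_states" using DA[OF Ntrap(2)] A(2) by blast
      then have "0 \<le> fst x" "fst x \<le> 1" by (auto simp: orbit_states_def table_def)
      moreover have "- w \<le> snd x" "snd x \<le> w" using x by (auto simp: NW_def)
      ultimately show "x \<in> cbox (0, - w) (1, w)" by (cases x) (simp add: cbox_Pair_eq)
    qed
    then have "emeasure lborel (NW w) \<le> emeasure lborel (cbox (0::real, - w) (1, w))"
      by (intro emeasure_mono) auto
    then show ?thesis using emeasure_lborel_cbox_finite by (rule le_less_trans)
  qed
  \<comment> \<open>\<open>NW w\<close> lies in the preimage of its subset
    \<open>NW (\<theta> * w)\<close>, which therefore has at least the same area. Areas are finite,
    so the difference is null.\<close>
  have shell: "NW w - NW (\<theta> * w) \<in> null_sets lborel" if w: "W \<le> w" for w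
  proof -
    have le: "emeasure lborel (NW w) \<le> emeasure lborel (NW (\<theta> * w))"
    proof -
      have "emeasure lborel (NW w) \<le> emeasure lborel (A \<inter> ?P -` NW (\<theta> * w))"
        using step[OF w] nonexpandingD(3)[OF A(1) NW] by (intro emeasure_mono) auto
      also have "\<dots> \<le> emeasure lborel (NW (\<theta> * w))" by (rule nonexpanding_le[OF A(1) NW])
      finally show ?thesis .
    qed
    have "\<theta> * w \<le> 1 * w" using \<theta> w W0 by (intro mult_right_mono) auto
    then have sub: "NW (\<theta> * w) \<subseteq> NW w" by (auto simp: NW_def)
    have "emeasure lborel (NW w - NW (\<theta> * w)) = emeasure lborel (NW w) - emeasure lborel (NW (\<theta> * w))"
      using NW fin[of "\<theta> * w"] sub by (intro emeasure_Diff) auto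
    also have "\<dots> = 0" using le fin[of w] by (simp add: diff_eq_0_iff_ennreal less_top[symmetric])
    finally show ?thesis using NW by auto
  qed
  \<comment> \<open>The scales \<open>W / \<theta> ^ j\<close> grow to infinity and each shell
    reaches down to the preceding scale, so the shells cover all speeds above
    \<open>W\<close>.\<close>
  have "(\<Union>j::nat. NW (W / \<theta> ^ j) - NW (\<theta> * (W / \<theta> ^ j))) \<in> null_sets lborel"
    using \<theta> W0 by (intro null_sets_UN shell) (auto simp: field_simps power_le_one)
  moreover have "{x \<in> N. W < \<bar>snd x\<bar>} \<subseteq> (\<Union>j::nat. NW (W / \<theta> ^ j) - NW (\<theta> * (W / \<theta> ^ j)))"
  proof
    fix x assume x: "x \<in> {x \<in> N. W < \<bar>snd x\<bar>}"
    have "\<exists>j. \<bar>snd x\<bar> \<le> W / \<theta> ^ j"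
    proof -
      obtain j where "\<theta> ^ j < W / (\<bar>snd x\<bar> + 1)" using real_arch_pow_inv[of "W / (\<bar>snd x\<bar> + 1)" \<theta>] \<theta> W0 by auto
      then have "\<theta> ^ j * (\<bar>snd x\<bar> + 1) < W" by (simp add: field_simps)
      moreover have "\<theta> ^ j * (\<bar>snd x\<bar> + 1) = \<bar>snd x\<bar> * \<theta> ^ j + \<theta> ^ j" by (simp add: algebra_simps)
      ultimately have "\<bar>snd x\<bar> * \<theta> ^ j \<le> W" using zero_less_power[OF \<theta>(1), of j] by linarith
      then show ?thesis using \<theta> by (intro exI[of _ j]) (simp add: field_simps)
    qed
    then obtain j where j: "\<bar>snd x\<bar> \<le> W / \<theta> ^ j" "\<And>i. i < j \<Longrightarrow> \<not> \<bar>snd x\<bar> \<le> W / \<theta> ^ i"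
      using exists_least_iff[of "\<lambda>j. \<bar>snd x\<bar> \<le> W / \<theta> ^ j"] by blast
    have "j \<noteq> 0" using j(1) x by (cases j) auto
    then obtain i where i: "j = Suc i" by (cases j) auto
    have "\<theta> * (W / \<theta> ^ j) = W / \<theta> ^ i" using \<theta> by (simp add: i)
    then have "\<not> \<bar>snd x\<bar> \<le> \<theta> * (W / \<theta> ^ j)" using j(2)[of i] i by simp
    then have "x \<in> NW (W / \<theta> ^ j) - NW (\<theta> * (W / \<theta> ^ j))" using j(1) x by (simp add: NW_def)
    then show "x \<in> (\<Union>j::nat. NW (W / \<theta> ^ j) - NW (\<theta> * (W / \<theta> ^ j)))" by blast
  qed
  moreover have "{x \<in> N. W < \<bar>snd x\<bar>} \<in> sets lborel"
  proof -
    have "{x \<in> N. W < \<bar>snd x\<bar>} = N \<inter> {x. W < \<bar>snd x\<bar>}" by auto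
    then show ?thesis using N by simp
  qed
  ultimately have "{x \<in> N. W < \<bar>snd x\<bar>} \<in> null_sets lborel" by (auto intro: null_sets_subset)
  moreover have "{x \<in> N. W < \<bar>snd x\<bar>} = {x \<in> D. W < \<bar>snd x\<bar> \<and> (\<forall>k. (?P ^^ k) x \<notin> trap V)}"
    by (auto simp: N_def)
  ultimately have "emeasure lborel {x \<in> D. W < \<bar>snd x\<bar> \<and> (\<forall>k. (?P ^^ k) x \<notin> trap V)} = 0" by auto
  then show ?thesis using that[OF c(1-5) D it(2) orb trap slow E] by blast
qed

end

section \<open>Orbits as chains of motions in a chamber\<close>

definition seg :: "(real \<Rightarrow> real) \<Rightarrow> real \<Rightarrow> real \<Rightarrow> (real \<Rightarrow> real) \<Rightarrow> (real \<Rightarrow> real) \<Rightarrow> bool" where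
  "seg f p q y w \<longleftrightarrow> below f p q y w \<or> below (\<lambda>t. 1 - f t) p q (\<lambda>t. 1 - y t) (\<lambda>t. - w t)"

lemma reach_seg: "reach f p q x x' \<longleftrightarrow> (\<exists>y w. seg f p q y w \<and> (y p, w p) = x \<and> (y q, w q) = x')"
proof
  assume "reach f p q x x'"
  then consider "reach_below f p q x x'" | "reach_below (\<lambda>t. 1 - f t) p q (flip x) (flip x')"
    unfolding reach_def by blast
  then show "\<exists>y w. seg f p q y w \<and> (y p, w p) = x \<and> (y q, w q) = x'"
  proof cases
    case 1
    then show ?thesis unfolding reach_below_def seg_def by blast
  next
    case 2
    then obtain y w where b: "below (\<lambda>t. 1 - f t) p q y w" "(y p, w p) = flip x" "(y q, w q) = flip x'"
      unfolding reach_below_def by blast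
    have "seg f p q (\<lambda>t. 1 - y t) (\<lambda>t. - w t)" using b(1) by (simp add: seg_def)
    moreover have "(1 - y p, - w p) = x" "(1 - y q, - w q) = x'"
      using arg_cong[OF b(2), of flip] arg_cong[OF b(3), of flip] by (simp_all add: flip_def)
    ultimately show ?thesis by blast
  qed
next
  assume "\<exists>y w. seg f p q y w \<and> (y p, w p) = x \<and> (y q, w q) = x'"
  then obtain y w where s: "seg f p q y w" "(y p, w p) = x" "(y q, w q) = x'" by blast
  from s(1) show "reach f p q x x'"
    unfolding seg_def
  proof
    assume "below f p q y w"
    then show ?thesis using s(2,3) unfolding reach_def reach_below_def by blast
  next
    assume b: "below (\<lambda>t. 1 - f t) p q (\<lambda>t. 1 - y t) (\<lambda>t. - w t)"
    have "(1 - y p, - w p) = flip x" "(1 - y q, - w q) = flip x'" using s(2,3) by (auto simp: flip_def)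
    then show ?thesis using b unfolding reach_def reach_below_def by blast
  qed
qed

definition reflect :: "(real \<Rightarrow> real) \<Rightarrow> real \<Rightarrow> real \<Rightarrow> real \<Rightarrow> real" where
  "reflect f t y u = (if y = 0 \<or> y = 1 then - u else if y = f t then - u + 2 * deriv f t else u)"

lemma seg_facts:
  assumes wall: "wall a M K f" and s: "seg f p q y w"
  shows "p \<le> t \<Longrightarrow> t \<le> q \<Longrightarrow> 0 \<le> y t \<and> y t \<le> 1"
    "(\<forall>t\<in>{p..q}. y t \<le> f t) \<or> (\<forall>t\<in>{p..q}. f t \<le> y t)"
    "p \<le> t \<Longrightarrow> t < q \<Longrightarrow> \<forall>\<^sub>F r in at_right t. w r = w t \<and> y r = y t + w t * (r - t) \<and> y r \<notin> {0, 1, f r}"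
    "p < t \<Longrightarrow> t \<le> q \<Longrightarrow> \<exists>u. (\<forall>\<^sub>F r in at_left t. w r = u \<and> y r = y t + u * (r - t) \<and> y r \<notin> {0, 1, f r}) \<and>
       w t = reflect f t (y t) u"
proof -
  note f1 = wall_facts(5,6)[OF wall]
  have "(p \<le> t \<longrightarrow> t \<le> q \<longrightarrow> 0 \<le> y t \<and> y t \<le> 1) \<and>
    ((\<forall>t\<in>{p..q}. y t \<le> f t) \<or> (\<forall>t\<in>{p..q}. f t \<le> y t)) \<and>
    (p \<le> t \<longrightarrow> t < q \<longrightarrow> (\<forall>\<^sub>F r in at_right t. w r = w t \<and> y r = y t + w t * (r - t) \<and> y r \<notin> {0, 1, f r})) \<and>
    (p < t \<longrightarrow> t \<le> q \<longrightarrow> (\<exists>u. (\<forall>\<^sub>F r in at_left t. w r = u \<and> y r = y t + u * (r - t) \<and> y r \<notin> {0, 1, f r}) \<and>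
       w t = reflect f t (y t) u))"
    using s unfolding seg_def
  proof
    assume b: "below f p q y w"
    show ?thesis
    proof (intro conjI impI)
      assume t: "p \<le> t" "t \<le> q"
      show "0 \<le> y t" "y t \<le> 1" using below_range[OF b t] f1[of t] by linarith+
    next
      show "(\<forall>t\<in>{p..q}. y t \<le> f t) \<or> (\<forall>t\<in>{p..q}. f t \<le> y t)" using below_range(2)[OF b] by simp
    next
      assume t: "p \<le> t" "t < q"
      show "\<forall>\<^sub>F r in at_right t. w r = w t \<and> y r = y t + w t * (r - t) \<and> y r \<notin> {0, 1, f r}"
        using below_right[OF b t]
      proof eventually_elim
        case (elim r)
        then show ?case using f1[of r] by (intro conjI) auto
      qed
    next
      assume t: "p < t" "t \<le> q"
      obtain u where u: "\<forall>\<^sub>F r in at_left t. w r = u \<and> y r = y t + u * (r - t) \<and> 0 < y r \<and> y r < f r"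
        "w t = bounce f t (y t) u" using below_left[OF b t] .
      have "\<forall>\<^sub>F r in at_left t. w r = u \<and> y r = y t + u * (r - t) \<and> y r \<notin> {0, 1, f r}"
        using u(1)
      proof eventually_elim
        case (elim r)
        then show ?case using f1[of r] by (intro conjI) auto
      qed
      moreover have "y t \<noteq> 1" using below_range[OF b, of t] t f1[of t] by auto
      then have "w t = reflect f t (y t) u" using u(2) by (simp add: bounce_def reflect_def)
      ultimately show "\<exists>u. (\<forall>\<^sub>F r in at_left t. w r = u \<and> y r = y t + u * (r - t) \<and> y r \<notin> {0, 1, f r}) \<and>
       w t = reflect f t (y t) u" by blast
    qed
  next
    assume b: "below (\<lambda>t. 1 - f t) p q (\<lambda>t. 1 - y t) (\<lambda>t. - w t)"
    show ?thesis
    proof (intro conjI impI)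
      assume t: "p \<le> t" "t \<le> q"
      show "0 \<le> y t" "y t \<le> 1" using below_range[OF b t] f1[of t] by linarith+
    next
      show "(\<forall>t\<in>{p..q}. y t \<le> f t) \<or> (\<forall>t\<in>{p..q}. f t \<le> y t)" using below_range(2)[OF b] by simp
    next
      assume t: "p \<le> t" "t < q"
      show "\<forall>\<^sub>F r in at_right t. w r = w t \<and> y r = y t + w t * (r - t) \<and> y r \<notin> {0, 1, f r}"
        using below_right[OF b t]
      proof eventually_elim
        case (elim r)
        then have "- w r = - w t" "1 - y r = 1 - y t + - w t * (r - t)" "0 < 1 - y r" "1 - y r < 1 - f r" by blast+
        then show ?case using f1[of r] by (intro conjI) auto
      qed
    next
      assume t: "p < t" "t \<le> q"
      obtain u where u: "\<forall>\<^sub>F r in at_left t. - w r = u \<and> 1 - y r = 1 - y t + u * (r - t) \<and> 0 < 1 - y r \<and> 1 - y r < 1 - f r"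
        "- w t = bounce (\<lambda>t. 1 - f t) t (1 - y t) u" using below_left[OF b t] .
      have "\<forall>\<^sub>F r in at_left t. w r = - u \<and> y r = y t + - u * (r - t) \<and> y r \<notin> {0, 1, f r}"
        using u(1)
      proof eventually_elim
        case (elim r)
        then have "- w r = u" "1 - y r = 1 - y t + u * (r - t)" "0 < 1 - y r" "1 - y r < 1 - f r" by blast+
        then show ?case using f1[of r] by (intro conjI) auto
      qed
      moreover have "y t \<noteq> 0" using below_range[OF b, of t] t f1[of t] by auto
      then have "w t = reflect f t (y t) (- u)" using u(2) deriv_flip[OF wall, of t]
        by (auto simp: bounce_def reflect_def split: if_splits)
      ultimately show "\<exists>u. (\<forall>\<^sub>F r in at_left t. w r = u \<and> y r = y t + u * (r - t) \<and> y r \<notin> {0, 1, f r}) \<and>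
       w t = reflect f t (y t) u" by blast
    qed
  qed
  then show "p \<le> t \<Longrightarrow> t \<le> q \<Longrightarrow> 0 \<le> y t \<and> y t \<le> 1"
    "(\<forall>t\<in>{p..q}. y t \<le> f t) \<or> (\<forall>t\<in>{p..q}. f t \<le> y t)"
    "p \<le> t \<Longrightarrow> t < q \<Longrightarrow> \<forall>\<^sub>F r in at_right t. w r = w t \<and> y r = y t + w t * (r - t) \<and> y r \<notin> {0, 1, f r}"
    "p < t \<Longrightarrow> t \<le> q \<Longrightarrow> \<exists>u. (\<forall>\<^sub>F r in at_left t. w r = u \<and> y r = y t + u * (r - t) \<and> y r \<notin> {0, 1, f r}) \<and>
       w t = reflect f t (y t) u"
    by blast+
qed

text \<open>Converse of \<open>seg_facts\<close>: once the motion is known to stay weakly on one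
  side, avoiding the three heights in a germ amounts to the strict inequalities of
  \<open>below\<close>.\<close>

lemma segI:
  assumes wall: "wall a M K f" and pq: "p < q"
    and range: "\<And>t. p \<le> t \<Longrightarrow> t \<le> q \<Longrightarrow> 0 \<le> y t \<and> y t \<le> 1"
    and side: "(\<forall>t\<in>{p..q}. y t \<le> f t) \<or> (\<forall>t\<in>{p..q}. f t \<le> y t)"
    and right: "\<And>t. p \<le> t \<Longrightarrow> t < q \<Longrightarrow> \<forall>\<^sub>F r in at_right t. w r = w t \<and> y r = y t + w t * (r - t) \<and> y r \<notin> {0, 1, f r}"
    and left: "\<And>t. p < t \<Longrightarrow> t \<le> q \<Longrightarrow> \<exists>u. (\<forall>\<^sub>F r in at_left t. w r = u \<and> y r = y t + u * (r - t) \<and> y r \<notin> {0, 1, f r}) \<and>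
       w t = reflect f t (y t) u"
  shows "seg f p q y w"
proof -
  note f1 = wall_facts(5,6)[OF wall]
  have R: "\<forall>\<^sub>F r in at_right t. t < r \<and> r < q" if "t < q" for t using eventually_at_right_real[OF that] by simp
  from side show ?thesis
  proof
    assume lo: "\<forall>t\<in>{p..q}. y t \<le> f t"
    have "below f p q y w"
      unfolding below_def
    proof (intro conjI ballI)
      fix t assume "t \<in> {p..q}"
      then show "0 \<le> y t" "y t \<le> f t" using range lo by auto
    next
      fix t assume t: "t \<in> {p..<q}"
      then have t': "p \<le> t" "t < q" by auto
      show "\<forall>\<^sub>F r in at_right t. w r = w t \<and> y r = y t + w t * (r - t) \<and> 0 < y r \<and> y r < f r"
        using right[OF t'] R[OF t'(2)]
      proof eventually_elim
        case (elim r)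
        then have "r \<in> {p..q}" "y r \<noteq> 0" "y r \<noteq> f r" using t' by auto
        then have "0 < y r" "y r < f r" using range[of r] lo by force+
        then show ?case using elim by blast
      qed
    next
      fix t assume t: "t \<in> {p<..q}"
      then have t': "p < t" "t \<le> q" by auto
      obtain u where u: "\<forall>\<^sub>F r in at_left t. w r = u \<and> y r = y t + u * (r - t) \<and> y r \<notin> {0, 1, f r}" "w t = reflect f t (y t) u"
        using left[OF t'] by blast
      have "\<forall>\<^sub>F r in at_left t. w r = u \<and> y r = y t + u * (r - t) \<and> 0 < y r \<and> y r < f r"
        using u(1) eventually_in_at_left[OF t'(1)]
      proof eventually_elim
        case (elim r)
        then have "r \<in> {p..q}" "y r \<noteq> 0" "y r \<noteq> f r" using t' by auto
        then have "0 < y r" "y r < f r" using range[of r] lo by force+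
        then show ?case using elim by blast
      qed
      moreover have "y t \<le> f t" using lo t by auto
      then have "y t \<noteq> 1" using f1[of t] by linarith
      then have "w t = bounce f t (y t) u" using u(2) by (simp add: bounce_def reflect_def)
      ultimately show "\<exists>u. (\<forall>\<^sub>F r in at_left t. w r = u \<and> y r = y t + u * (r - t) \<and> 0 < y r \<and> y r < f r) \<and> w t = bounce f t (y t) u"
        by blast
    qed
    then show ?thesis by (simp add: seg_def)
  next
    assume hi: "\<forall>t\<in>{p..q}. f t \<le> y t"
    have "below (\<lambda>t. 1 - f t) p q (\<lambda>t. 1 - y t) (\<lambda>t. - w t)"
      unfolding below_def
    proof (intro conjI ballI)
      fix t assume "t \<in> {p..q}"
      then show "0 \<le> 1 - y t" "1 - y t \<le> 1 - f t" using range hi by auto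
    next
      fix t assume t: "t \<in> {p..<q}"
      then have t': "p \<le> t" "t < q" by auto
      show "\<forall>\<^sub>F r in at_right t. - w r = - w t \<and> 1 - y r = 1 - y t + - w t * (r - t) \<and> 0 < 1 - y r \<and> 1 - y r < 1 - f r"
        using right[OF t'] R[OF t'(2)]
      proof eventually_elim
        case (elim r)
        then have "r \<in> {p..q}" "y r \<noteq> 1" "y r \<noteq> f r" using t' by auto
        then have "0 < 1 - y r" "1 - y r < 1 - f r" using range[of r] hi by force+
        moreover have "- w r = - w t" using elim by simp
        moreover have "1 - y r = 1 - y t + - w t * (r - t)" using elim by linarith
        ultimately show ?case by blast
      qed
    next
      fix t assume t: "t \<in> {p<..q}"
      then have t': "p < t" "t \<le> q" by auto
      obtain u where u: "\<forall>\<^sub>F r in at_left t. w r = u \<and> y r = y t + u * (r - t) \<and> y r \<notin> {0, 1, f r}" "w t = reflect f t (y t) u"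
        using left[OF t'] by blast
      have "\<forall>\<^sub>F r in at_left t. - w r = - u \<and> 1 - y r = 1 - y t + - u * (r - t) \<and> 0 < 1 - y r \<and> 1 - y r < 1 - f r"
        using u(1) eventually_in_at_left[OF t'(1)]
      proof eventually_elim
        case (elim r)
        then have "r \<in> {p..q}" "y r \<noteq> 1" "y r \<noteq> f r" using t' by auto
        then have "0 < 1 - y r" "1 - y r < 1 - f r" using range[of r] hi by force+
        moreover have "- w r = - u" using elim by simp
        moreover have "1 - y r = 1 - y t + - u * (r - t)" using elim by linarith
        ultimately show ?case by blast
      qed
      moreover have "f t \<le> y t" using hi t by auto
      then have "y t \<noteq> 0" using f1[of t] by linarith
      then have "- w t = bounce (\<lambda>t. 1 - f t) t (1 - y t) (- u)"
        using u(2) deriv_flip[OF wall, of t] by (simp add: bounce_def reflect_def)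
      ultimately show "\<exists>u. (\<forall>\<^sub>F r in at_left t. - w r = u \<and> 1 - y r = 1 - y t + u * (r - t) \<and> 0 < 1 - y r \<and> 1 - y r < 1 - f r) \<and>
          - w t = bounce (\<lambda>t. 1 - f t) t (1 - y t) u"
        by blast
    qed
    then show ?thesis by (simp add: seg_def)
  qed
qed

lemma below_cong:
  assumes b: "below f p q y w" and eq: "\<And>t. p \<le> t \<Longrightarrow> t \<le> q \<Longrightarrow> y' t = y t \<and> w' t = w t"
  shows "below f p q y' w'"
  unfolding below_def
proof (intro conjI ballI)
  fix t assume "t \<in> {p..q}"
  then show "0 \<le> y' t" "y' t \<le> f t" using eq[of t] below_range[OF b, of t] by auto
next
  fix t assume t: "t \<in> {p..<q}"
  then have t': "p \<le> t" "t < q" by auto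
  have "\<forall>\<^sub>F r in at_right t. t < r \<and> r < q" using eventually_at_right_real[OF t'(2)] by simp
  then show "\<forall>\<^sub>F r in at_right t. w' r = w' t \<and> y' r = y' t + w' t * (r - t) \<and> 0 < y' r \<and> y' r < f r"
    using below_right[OF b t']
  proof eventually_elim
    case (elim r)
    have "y' r = y r" "w' r = w r" "y' t = y t" "w' t = w t" using eq[of r] eq[of t] elim t' by auto
    then show ?case using elim by simp
  qed
next
  fix t assume t: "t \<in> {p<..q}"
  then have t': "p < t" "t \<le> q" by auto
  obtain u where u: "\<forall>\<^sub>F r in at_left t. w r = u \<and> y r = y t + u * (r - t) \<and> 0 < y r \<and> y r < f r" "w t = bounce f t (y t) u"
    using below_left[OF b t'] .
  have e: "y' t = y t" "w' t = w t" using eq[of t] t' by auto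
  have "\<forall>\<^sub>F r in at_left t. w' r = u \<and> y' r = y' t + u * (r - t) \<and> 0 < y' r \<and> y' r < f r"
    using eventually_in_at_left[OF t'(1)] u(1)
  proof eventually_elim
    case (elim r)
    have "y' r = y r" "w' r = w r" using eq[of r] elim t' by auto
    then show ?case using elim e by simp
  qed
  then show "\<exists>u. (\<forall>\<^sub>F r in at_left t. w' r = u \<and> y' r = y' t + u * (r - t) \<and> 0 < y' r \<and> y' r < f r) \<and> w' t = bounce f t (y' t) u"
    using u(2) e by auto
qed

lemma seg_cong:
  assumes "seg f p q y w" "\<And>t. p \<le> t \<Longrightarrow> t \<le> q \<Longrightarrow> y' t = y t \<and> w' t = w t"
  shows "seg f p q y' w'"
  using assms below_cong[of f p q y w y' w']
    below_cong[of "\<lambda>t. 1 - f t" p q "\<lambda>t. 1 - y t" "\<lambda>t. - w t" "\<lambda>t. 1 - y' t" "\<lambda>t. - w' t"]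
  unfolding seg_def by simp blast

lemma eventually_not_in_finite:
  fixes F :: "'a::t1_space set"
  assumes "finite F" shows "\<forall>\<^sub>F r in at t. r \<notin> F"
proof -
  have "\<forall>\<^sub>F r in at t. \<forall>x\<in>F. r \<noteq> x"
    by (intro eventually_ball_finite assms ballI) (simp add: eventually_neq_at_within)
  then show ?thesis by (auto elim!: eventually_mono)
qed

text \<open>\<open>T 0\<close> is the launch, which is no passage, and \<open>T (Suc j)\<close> are
  the passages after it. With \<open>T\<close> abstract, the alternation of passages and the
  position of the launch stay out of the translation between orbits and germs.\<close>

locale itinerary =
  fixes a M K lam x0 :: real and fL fR :: "real \<Rightarrow> real" and T :: "nat \<Rightarrow> real" and R :: "nat \<Rightarrow> bool"
  assumes walls: "wall a M K fL" "wall a M K fR"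
    and T: "strict_mono T" "\<And>b. \<exists>j. b < T j"
    and on_right: "\<And>j t. T j < t \<Longrightarrow> t < T (Suc j) \<Longrightarrow> on_right lam x0 t = R j" "on_right lam x0 (T 0) = R 0"
    and passage: "\<And>t. T 0 \<le> t \<Longrightarrow> passage lam x0 t \<longleftrightarrow> (\<exists>j. t = T (Suc j))"
begin

definition slit :: "nat \<Rightarrow> real \<Rightarrow> real" where
  "slit j = (if R j then fR else fL)"

lemma slit_wall: "wall a M K (slit j)" using walls by (simp add: slit_def)

lemma current_slit: "T j < t \<Longrightarrow> t < T (Suc j) \<Longrightarrow> current lam x0 fL fR t = slit j t"
  "T j < t \<Longrightarrow> t < T (Suc j) \<Longrightarrow> current lam x0 (deriv fL) (deriv fR) t = deriv (slit j) t"
  "current lam x0 fL fR (T 0) = slit 0 (T 0)"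
  using on_right by (auto simp: current_def slit_def)

lemma T_less: "T j < T (Suc j)" using T(1) by (simp add: strict_mono_Suc_iff)

lemma T_ge: "T 0 \<le> T j" using T(1) by (simp add: strict_mono_less_eq)

lemma T_cover: assumes "T 0 \<le> t" obtains j where "T j \<le> t" "t < T (Suc j)"
proof -
  define j where "j = (LEAST j. t < T j)"
  have j: "t < T j" unfolding j_def by (rule LeastI_ex[OF T(2)])
  then have "j \<noteq> 0" using assms by (cases j) auto
  then obtain i where i: "j = Suc i" by (cases j) auto
  have "\<not> t < T i" using not_less_Least[of i "\<lambda>j. t < T j"] i by (simp add: j_def[symmetric])
  then show ?thesis using that[of i] j i by simp
qed

lemma T_cover': assumes "T 0 < t" obtains j where "T j < t" "t \<le> T (Suc j)"
proof -
  obtain j where j: "T j \<le> t" "t < T (Suc j)" using T_cover assms by (metis less_imp_le)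
  show ?thesis
  proof (cases "T j = t")
    case True
    then obtain i where "j = Suc i" using assms by (cases j) auto
    then show ?thesis using that[of i] True T_less[of i] by simp
  qed (use that[of j] j in auto)
qed

lemma T_disjoint: assumes "T j < t" "t < T (Suc j)" shows "t \<noteq> T i"
proof
  assume "t = T i"
  then have "j < i" "i < Suc j" using assms T(1) by (auto simp: strict_mono_less)
  then show False by simp
qed

definition follows :: "(real \<Rightarrow> real) \<Rightarrow> (real \<Rightarrow> real) \<Rightarrow> bool" where
  "follows y w \<longleftrightarrow> (\<forall>j. seg (slit j) (T j) (T (Suc j)) y w \<and> y (T (Suc j)) \<notin> {0, 1, fL (T (Suc j)), fR (T (Suc j))})"

text \<open>Finitely many collisions in bounded time leave one-sided neighbourhoods of every time
  free of contact; there the motion is an affine germ, and the left limit of \<open>w\<close> in the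
  reflection laws is the velocity of that germ.\<close>

lemma slit_orbit_follows:
  assumes o: "slit_orbit lam x0 fL fR (T 0) v y w"
  shows "follows y w"
  unfolding follows_def
proof (intro allI conjI)
  let ?c = "contact lam x0 fL fR y"
  have range: "\<And>t. T 0 \<le> t \<Longrightarrow> 0 \<le> y t \<and> y t \<le> 1"
    and fin: "\<And>b. finite {t. T 0 < t \<and> t \<le> b \<and> ?c t}"
    and free: "\<And>s t. T 0 \<le> s \<Longrightarrow> s < t \<Longrightarrow> \<forall>r\<in>{s<..<t}. \<not> ?c r \<Longrightarrow> (\<forall>r\<in>{s<..<t}. w r = w s) \<and> y t = y s + w s * (t - s)"
    and wall_refl: "\<And>t. T 0 < t \<Longrightarrow> y t = 0 \<or> y t = 1 \<Longrightarrow> \<exists>u. (w \<longlongrightarrow> u) (at_left t) \<and> w t = - u"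
    and slit_refl: "\<And>t. T 0 < t \<Longrightarrow> y t = current lam x0 fL fR t \<Longrightarrow>
       \<exists>u. (w \<longlongrightarrow> u) (at_left t) \<and> w t = - u + 2 * current lam x0 (deriv fL) (deriv fR) t"
    and sides: "\<And>s t. T 0 \<le> s \<Longrightarrow> s < t \<Longrightarrow> \<forall>r\<in>{s..t}. \<not> passage lam x0 r \<Longrightarrow>
       (\<forall>r\<in>{s..t}. current lam x0 fL fR r \<le> y r) \<or> (\<forall>r\<in>{s..t}. y r \<le> current lam x0 fL fR r)"
    and pass: "\<And>t. T 0 \<le> t \<Longrightarrow> passage lam x0 t \<Longrightarrow> y t \<notin> {0, 1, fL t, fR t}"
    using o unfolding slit_orbit_def by blast+
  have near: "\<forall>\<^sub>F r in at t. T 0 < r \<longrightarrow> \<not> ?c r" if "T 0 \<le> t" for t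
  proof -
    have "\<forall>\<^sub>F r in at t. r \<notin> {r. T 0 < r \<and> r \<le> t + 1 \<and> ?c r}" by (rule eventually_not_in_finite[OF fin])
    moreover have "\<forall>\<^sub>F r in at t. r < t + 1" by (rule order_tendstoD[OF tendsto_ident_at]) simp
    ultimately show ?thesis by eventually_elim auto
  qed
  have rgerm: "\<forall>\<^sub>F r in at_right t. w r = w t \<and> y r = y t + w t * (r - t) \<and> \<not> ?c r" if t: "T 0 \<le> t" for t
  proof -
    have "\<forall>\<^sub>F r in at_right t. T 0 < r \<longrightarrow> \<not> ?c r"
      using near[OF t] by (rule filter_leD[OF at_le[OF subset_UNIV]])
    then obtain b where b: "b > t" "\<And>r. t < r \<Longrightarrow> r < b \<Longrightarrow> \<not> ?c r"
      unfolding eventually_at_right_field using t by fastforce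
    have "w r = w t \<and> y r = y t + w t * (r - t) \<and> \<not> ?c r" if r: "t < r" "r < b" for r
      using free[OF t, of r] free[OF t, of b] b r by auto
    then show ?thesis unfolding eventually_at_right_field using b(1) by blast
  qed
  have lgerm: "\<exists>u. (\<forall>\<^sub>F r in at_left t. w r = u \<and> y r = y t + u * (r - t) \<and> \<not> ?c r) \<and> (\<not> ?c t \<longrightarrow> w t = u)"
    if t: "T 0 < t" for t
  proof -
    have "\<forall>\<^sub>F r in at_left t. T 0 < r \<longrightarrow> \<not> ?c r"
      using near[OF less_imp_le[OF t]] by (rule filter_leD[OF at_le[OF subset_UNIV]])
    then obtain b where b: "b < t" "\<And>r. b < r \<Longrightarrow> r < t \<Longrightarrow> T 0 < r \<Longrightarrow> \<not> ?c r"
      unfolding eventually_at_left_field by blast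
    define s where "s = max (T 0) b"
    have s: "T 0 \<le> s" "s < t" "\<And>r. s < r \<Longrightarrow> r < t \<Longrightarrow> \<not> ?c r" using b t by (auto simp: s_def)
    have yt: "y t = y s + w s * (t - s)" using free[OF s(1,2)] s(3) by auto
    have "w r = w s \<and> y r = y t + w s * (r - t) \<and> \<not> ?c r" if r: "s < r" "r < t" for r
    proof -
      have "w r = w s" using free[OF s(1,2)] s(3) r by auto
      moreover have "y r = y s + w s * (r - s)" using free[OF s(1) r(1)] s(3) r by auto
      ultimately show ?thesis using s(3)[OF r] unfolding yt by (simp add: algebra_simps)
    qed
    then have "\<forall>\<^sub>F r in at_left t. w r = w s \<and> y r = y t + w s * (r - t) \<and> \<not> ?c r"
      unfolding eventually_at_left_field using s(2) by blast
    \<comment> \<open>Without contact at \<open>t\<close> the free interval extends beyond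
      \<open>t\<close>, so the velocity cannot change there.\<close>
    moreover have "w t = w s" if nc: "\<not> ?c t"
    proof -
      obtain e where e: "e > t" "\<And>r. t < r \<Longrightarrow> r < e \<Longrightarrow> \<not> ?c r"
        using rgerm[OF less_imp_le[OF t]] unfolding eventually_at_right_field by blast
      have "\<not> ?c r" if "s < r" "r < e" for r
        using s(3)[of r] e(2)[of r] nc that by (cases r t rule: linorder_cases) auto
      then show ?thesis using free[OF s(1), of e] s(2) e(1) by auto
    qed
    ultimately show ?thesis by blast
  qed
  fix j
  have Tj: "T 0 \<le> T j" "T j < T (Suc j)" using T_ge T_less by auto
  have ncT: "y (T (Suc j)) \<notin> {0, 1, fL (T (Suc j)), fR (T (Suc j))}"
    using pass[of "T (Suc j)"] passage T_ge by blast
  then show "y (T (Suc j)) \<notin> {0, 1, fL (T (Suc j)), fR (T (Suc j))}" .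
  have nc: "?c r \<longleftrightarrow> y r \<in> {0, 1, slit j r}" if "T j < r" "r < T (Suc j)" for r
    using current_slit(1)[OF that] by (auto simp: contact_def)
  have R: "\<forall>\<^sub>F r in at_right t. w r = w t \<and> y r = y t + w t * (r - t) \<and> y r \<notin> {0, 1, slit j r}"
    if t: "T j \<le> t" "t < T (Suc j)" for t
  proof -
    have "T 0 \<le> t" using Tj t by simp
    have "\<forall>\<^sub>F r in at_right t. t < r \<and> r < T (Suc j)" using eventually_at_right_real[OF t(2)] by simp
    then show ?thesis using rgerm[OF \<open>T 0 \<le> t\<close>]
    proof eventually_elim
      case (elim r)
      have "T j < r" "r < T (Suc j)" using elim(1) t(1) by auto
      then show ?case using elim(2) nc[of r] by blast
    qed
  qed
  have L: "\<exists>u. (\<forall>\<^sub>F r in at_left t. w r = u \<and> y r = y t + u * (r - t) \<and> y r \<notin> {0, 1, slit j r}) \<and> w t = reflect (slit j) t (y t) u"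
    if t: "T j < t" "t \<le> T (Suc j)" for t
  proof -
    have t0: "T 0 < t" using Tj t by simp
    obtain u where u: "\<forall>\<^sub>F r in at_left t. w r = u \<and> y r = y t + u * (r - t) \<and> \<not> ?c r" "\<not> ?c t \<longrightarrow> w t = u"
      using lgerm[OF t0] by blast
    have 1: "\<forall>\<^sub>F r in at_left t. w r = u \<and> y r = y t + u * (r - t) \<and> y r \<notin> {0, 1, slit j r}"
      using u(1) eventually_in_at_left[OF t(1)]
    proof eventually_elim
      case (elim r)
      have "T j < r" "r < T (Suc j)" using elim t by auto
      then show ?case using nc[of r] elim by blast
    qed
    have lim: "(w \<longlongrightarrow> u) (at_left t)"
      by (rule tendsto_eventually) (use u(1) in \<open>auto elim!: eventually_mono\<close>)
    have uniq: "u' = u" if "(w \<longlongrightarrow> u') (at_left t)" for u'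
      using tendsto_unique[OF _ that lim] by (simp add: trivial_limit_at_left_real)
    have "w t = reflect (slit j) t (y t) u"
    proof (cases "t = T (Suc j)")
      case True
      then have n: "y t \<notin> {0, 1, fL t, fR t}" using ncT by simp
      then have "\<not> ?c t" by (auto simp: contact_def current_def)
      then show ?thesis using u(2) n by (auto simp: reflect_def slit_def)
    next
      case False
      then have t': "t < T (Suc j)" using t by simp
      consider "y t = 0 \<or> y t = 1" | "y t \<noteq> 0" "y t \<noteq> 1" "y t = slit j t" | "\<not> ?c t"
        using nc[OF t(1) t'] by blast
      then show ?thesis
      proof cases
        case 1
        then show ?thesis using wall_refl[OF t0 1] uniq by (auto simp: reflect_def)
      next
        case 2
        then have "y t = current lam x0 fL fR t" using current_slit(1)[OF t(1) t'] by simp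
        then show ?thesis using slit_refl[OF t0] uniq 2 current_slit(2)[OF t(1) t'] by (auto simp: reflect_def)
      next
        case 3
        then show ?thesis using u(2) nc[OF t(1) t'] by (auto simp: reflect_def)
      qed
    qed
    then show ?thesis using 1 by blast
  qed
  \<comment> \<open>The side condition of an orbit is only available on closed intervals free of
    passages; continuity carries it to the end points of the segment.\<close>
  have cont: "continuous_on {T j..T (Suc j)} y"
  proof (rule continuous_on_eq_continuous_within[THEN iffD2], rule ballI)
    fix t assume t: "t \<in> {T j..T (Suc j)}"
    have r: "(y \<longlongrightarrow> y t) (at_right t)" if "t < T (Suc j)"
    proof -
      have l: "((\<lambda>r. y t + w t * (r - t)) \<longlongrightarrow> y t + w t * (t - t)) (at_right t)" by (intro tendsto_intros)
      have ev: "\<forall>\<^sub>F r in at_right t. y t + w t * (r - t) = y r"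
        using R[of t] t that by (auto elim!: eventually_mono)
      show ?thesis using Lim_transform_eventually[OF l ev] by simp
    qed
    have l: "(y \<longlongrightarrow> y t) (at_left t)" if t': "T j < t"
    proof -
      obtain u where u: "\<forall>\<^sub>F r in at_left t. w r = u \<and> y r = y t + u * (r - t) \<and> y r \<notin> {0, 1, slit j r}"
        using L[of t] t t' by auto
      have l: "((\<lambda>r. y t + u * (r - t)) \<longlongrightarrow> y t + u * (t - t)) (at_left t)" by (intro tendsto_intros)
      have ev: "\<forall>\<^sub>F r in at_left t. y t + u * (r - t) = y r" using u by (auto elim!: eventually_mono)
      show ?thesis using Lim_transform_eventually[OF l ev] by simp
    qed
    consider "T j < t" "t < T (Suc j)" | "t = T j" | "t = T (Suc j)" using t by force
    then show "continuous (at t within {T j..T (Suc j)}) y"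
    proof cases
      case 1
      then have "isCont y t" using r l by (simp add: filterlim_split_at_real continuous_at)
      then show ?thesis by (rule continuous_at_imp_continuous_at_within)
    next
      case 2
      then show ?thesis using r Tj by (simp add: continuous_within at_within_Icc_at_right)
    next
      case 3
      then show ?thesis using l Tj by (simp add: continuous_within at_within_Icc_at_left)
    qed
  qed
  have "(\<forall>t\<in>{T j..T (Suc j)}. y t \<le> slit j t) \<or> (\<forall>t\<in>{T j..T (Suc j)}. slit j t \<le> y t)"
  proof (rule ccontr)
    assume "\<not> ?thesis"
    then obtain s s' where s: "s \<in> {T j..T (Suc j)}" "slit j s < y s" "s' \<in> {T j..T (Suc j)}" "y s' < slit j s'"
      by force
    have cg: "continuous_on {T j..T (Suc j)} (\<lambda>t. y t - slit j t)"
      by (intro continuous_intros cont wall_measurable(3)[OF slit_wall])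
    \<comment> \<open>A strict inequality at an end point of the segment already occurs in the
      interior; the sign of \<open>e\<close> treats both sides at once.\<close>
    have inner: "\<exists>r. T j < r \<and> r < T (Suc j) \<and> 0 < e * (y r - slit j r)"
      if s: "s \<in> {T j..T (Suc j)}" "0 < e * (y s - slit j s)" for s e
    proof (rule ccontr)
      assume "\<not> ?thesis"
      then have neg: "e * (y r - slit j r) \<le> 0" if "T j < r" "r < T (Suc j)" for r
        using that not_le by blast
      have cl: "closure {T j<..<T (Suc j)} = {T j..T (Suc j)}" using Tj by simp
      have 1: "continuous_on (closure {T j<..<T (Suc j)}) (\<lambda>t. e * (y t - slit j t))"
        unfolding cl using cg by (rule continuous_on_mult_left)
      have 2: "s \<in> closure {T j<..<T (Suc j)}" using s(1) cl by simp
      have "e * (y s - slit j s) \<le> 0"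
        by (rule continuous_le_on_closure[OF 1 2]) (use neg in simp)
      then show False using s(2) by simp
    qed
    obtain r where r: "T j < r" "r < T (Suc j)" "slit j r < y r" using inner[OF s(1), of 1] s(2) by auto
    obtain r' where r': "T j < r'" "r' < T (Suc j)" "y r' < slit j r'" using inner[OF s(3), of "-1"] s(4) by auto
    define l h where "l = min r r'" and "h = max r r'"
    have "r \<noteq> r'" using r r' by auto
    then have lh: "l < h" "T j < l" "h < T (Suc j)" using r r' by (auto simp: l_def h_def)
    have np: "\<not> passage lam x0 z" if z: "z \<in> {l..h}" for z
    proof -
      have z': "T j < z" "z < T (Suc j)" using z lh by auto
      then show ?thesis using passage[of z] Tj(1) T_disjoint[OF z'] by auto
    qed
    have cur: "current lam x0 fL fR z = slit j z" if "z \<in> {l..h}" for z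
      using current_slit(1)[of j z] that lh by auto
    have mem: "r \<in> {l..h}" "r' \<in> {l..h}" by (auto simp: l_def h_def)
    from sides[of l h] np lh Tj(1) show False
      using cur[OF mem(1)] cur[OF mem(2)] r(3) r'(3) mem by fastforce
  qed
  then show "seg (slit j) (T j) (T (Suc j)) y w"
    by (intro segI[OF slit_wall Tj(2)] R L range) (use Tj in auto)
qed

text \<open>The global clauses are recovered from germs: finiteness by compactness, free motion by
  real induction, and the side condition because an interval without passages lies in a single
  segment.\<close>

lemma follows_slit_orbit:
  assumes fo: "follows y w" and init: "y (T 0) = slit 0 (T 0)"
  shows "slit_orbit lam x0 fL fR (T 0) (w (T 0)) y w"
proof -
  let ?c = "contact lam x0 fL fR y"
  have S: "seg (slit j) (T j) (T (Suc j)) y w" and N: "y (T (Suc j)) \<notin> {0, 1, fL (T (Suc j)), fR (T (Suc j))}" for j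
    using fo unfolding follows_def by blast+
  have nc: "?c r \<longleftrightarrow> y r \<in> {0, 1, slit j r}" if "T j < r" "r < T (Suc j)" for r j
    using current_slit(1)[OF that] by (auto simp: contact_def)
  have range: "0 \<le> y t \<and> y t \<le> 1" if "T 0 \<le> t" for t
  proof -
    obtain j where j: "T j \<le> t" "t < T (Suc j)" using T_cover[OF \<open>T 0 \<le> t\<close>] .
    then show ?thesis using seg_facts(1)[OF slit_wall S] by simp
  qed
  have cur01: "0 < current lam x0 fL fR t \<and> current lam x0 fL fR t < 1" for t
    using wall_facts(5,6)[OF walls(1), of t] wall_facts(5,6)[OF walls(2), of t] by (simp add: current_def)
  have rgerm: "\<forall>\<^sub>F r in at_right t. w r = w t \<and> y r = y t + w t * (r - t) \<and> \<not> ?c r" if "T 0 \<le> t" for t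
  proof -
    obtain j where j: "T j \<le> t" "t < T (Suc j)" using T_cover[OF \<open>T 0 \<le> t\<close>] .
    have "\<forall>\<^sub>F r in at_right t. t < r \<and> r < T (Suc j)" using eventually_at_right_real[OF j(2)] by simp
    then show ?thesis using seg_facts(3)[OF slit_wall S j]
    proof eventually_elim
      case (elim r)
      have "T j < r" "r < T (Suc j)" using elim(1) j by auto
      then show ?case using elim nc[of j r] by blast
    qed
  qed
  have lgerm: "\<exists>u. (\<forall>\<^sub>F r in at_left t. w r = u \<and> y r = y t + u * (r - t) \<and> \<not> ?c r) \<and>
      w t = (if y t = 0 \<or> y t = 1 then - u else if y t = current lam x0 fL fR t then - u + 2 * current lam x0 (deriv fL) (deriv fR) t else u)"
    if "T 0 < t" for t
  proof -
    obtain j where j: "T j < t" "t \<le> T (Suc j)" using T_cover'[OF \<open>T 0 < t\<close>] .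
    obtain u where u: "\<forall>\<^sub>F r in at_left t. w r = u \<and> y r = y t + u * (r - t) \<and> y r \<notin> {0, 1, slit j r}"
      "w t = reflect (slit j) t (y t) u" using seg_facts(4)[OF slit_wall S j] by blast
    have 1: "\<forall>\<^sub>F r in at_left t. w r = u \<and> y r = y t + u * (r - t) \<and> \<not> ?c r"
      using u(1) eventually_in_at_left[OF j(1)]
    proof eventually_elim
      case (elim r)
      have "T j < r" "r < T (Suc j)" using elim j by auto
      then show ?case using elim nc[of j r] by blast
    qed
    have "w t = (if y t = 0 \<or> y t = 1 then - u else if y t = current lam x0 fL fR t then - u + 2 * current lam x0 (deriv fL) (deriv fR) t else u)"
    proof (cases "t = T (Suc j)")
      case True
      then have "y t \<notin> {0, 1, fL t, fR t}" using N[of j] by simp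
      then show ?thesis using u(2) by (auto simp: reflect_def slit_def current_def)
    next
      case False
      then have "t < T (Suc j)" using j by simp
      then show ?thesis using u(2) current_slit(1,2)[OF j(1)] by (simp add: reflect_def)
    qed
    then show ?thesis using 1 by blast
  qed
  have lim: "(w \<longlongrightarrow> u) (at_left t)" if "\<forall>\<^sub>F r in at_left t. w r = u \<and> y r = y t + u * (r - t) \<and> \<not> ?c r" for t u
    by (rule tendsto_eventually) (use that in \<open>auto elim!: eventually_mono\<close>)
  show ?thesis
    unfolding slit_orbit_def
  proof (intro conjI allI impI)
    show "y (T 0) = current lam x0 fL fR (T 0)" using init current_slit(3) by simp
    show "w (T 0) = w (T 0)" ..
    fix t assume "T 0 \<le> t"
    then show "0 \<le> y t" "y t \<le> 1" using range by auto
  next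
    fix b
    show "finite {t. T 0 < t \<and> t \<le> b \<and> ?c t}" (is "finite ?C")
    proof (rule ccontr)
      \<comment> \<open>An accumulation point of contacts would have contact-free germs on both
        sides. At \<open>T 0\<close> there is nothing on the left, since only later contacts are
        counted.\<close>
      assume "infinite ?C"
      moreover have "?C \<subseteq> {T 0..b}" by auto
      ultimately obtain x where x: "x \<in> {T 0..b}" "x islimpt ?C"
        using compact_Icc[of "T 0" b] unfolding compact_eq_Bolzano_Weierstrass by blast
      have "\<forall>\<^sub>F r in at_right x. r \<notin> ?C" using rgerm[of x] x(1) by (auto elim!: eventually_mono)
      moreover have "\<forall>\<^sub>F r in at_left x. r \<notin> ?C"
      proof (cases "T 0 < x")
        case True
        then show ?thesis using lgerm[OF True] by (auto elim!: eventually_mono)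
      next
        case False
        have "\<forall>\<^sub>F r in at_left x. r < x" by (simp add: eventually_at_filter)
        then show ?thesis using False by (auto elim!: eventually_mono)
      qed
      ultimately have "\<forall>\<^sub>F r in at x. r \<notin> ?C" by (simp add: eventually_at_split)
      then show False using x(2) by (simp add: islimpt_iff_eventually)
    qed
  next
    fix s t assume st: "T 0 \<le> s \<and> s < t \<and> (\<forall>r\<in>{s<..<t}. \<not> ?c r)"
    have line: "(r < t \<longrightarrow> w r = w s) \<and> y r = y s + w s * (r - s)" if "s \<le> r" "r \<le> t" for r
      using that
    proof (induction r rule: real_induction)
      case base
      then show ?case by simp
    next
      case (right r)
      have r: "w r = w s" "y r = y s + w s * (r - s)" using right(3)[of r] right(1,2) by auto
      have "T 0 \<le> r" using st right by simp
      from rgerm[OF this] show ?case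
      proof eventually_elim
        case (elim r')
        have "y r' = (y s + w s * (r - s)) + w s * (r' - r)" using elim unfolding r by blast
        then have "y r' = y s + w s * (r' - s)" by (simp add: algebra_simps)
        then show ?case using elim unfolding r by blast
      qed
    next
      case (left r)
      have "T 0 < r" using st left by simp
      then obtain u where u: "\<forall>\<^sub>F r' in at_left r. w r' = u \<and> y r' = y r + u * (r' - r) \<and> \<not> ?c r'"
        "w r = (if y r = 0 \<or> y r = 1 then - u else if y r = current lam x0 fL fR r then - u + 2 * current lam x0 (deriv fL) (deriv fR) r else u)"
        using lgerm by blast
      obtain r' where r': "w r' = u" "y r' = y r + u * (r' - r)" "s < r'" "r' < r"
        using eventually_happens'[OF _ eventually_conj[OF u(1) eventually_in_at_left[OF left(1)]]]
          trivial_limit_at_left_real[of r] by blast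
      have "w r' = w s" "y r' = y s + w s * (r' - s)" using left(3)[of r'] r'(3,4) left(2) by auto
      then have us: "u = w s" and "y r + w s * (r' - r) = y s + w s * (r' - s)" using r'(1,2) by auto
      then have yr: "y r = y s + w s * (r - s)" by (simp add: algebra_simps)
      have "w r = w s" if "r < t"
      proof -
        have "\<not> ?c r" using st left(1) that by auto
        then show ?thesis using u(2) us by (auto simp: contact_def)
      qed
      then show ?case using yr by blast
    qed
    have "s \<le> t" using st by simp
    from line[OF this order_refl] show "y t = y s + w s * (t - s)" by blast
    show "\<forall>r\<in>{s<..<t}. w r = w s"
    proof
      fix r assume "r \<in> {s<..<t}"
      then have "s \<le> r" "r \<le> t" "r < t" by auto
      then show "w r = w s" using line[of r] by blast
    qed
  next
    fix t assume t: "T 0 < t" "y t = 0 \<or> y t = 1"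
    then show "\<exists>u. (w \<longlongrightarrow> u) (at_left t) \<and> w t = - u" using lgerm[OF t(1)] lim by auto
  next
    fix t assume t: "T 0 < t" "y t = current lam x0 fL fR t"
    then have "y t \<noteq> 0" "y t \<noteq> 1" using cur01[of t] by auto
    then show "\<exists>u. (w \<longlongrightarrow> u) (at_left t) \<and> w t = - u + 2 * current lam x0 (deriv fL) (deriv fR) t"
      using lgerm[OF t(1)] lim t(2) by auto
  next
    fix s t assume st: "T 0 \<le> s \<and> s < t \<and> (\<forall>r\<in>{s..t}. \<not> passage lam x0 r)"
    obtain j where j: "T j \<le> s" "s < T (Suc j)" using T_cover st by blast
    have tj: "t < T (Suc j)"
    proof (rule ccontr)
      assume "\<not> t < T (Suc j)"
      then have "\<not> passage lam x0 (T (Suc j))" using st j by auto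
      then show False using passage[of "T (Suc j)"] T_ge by blast
    qed
    \<comment> \<open>The left end of a segment is either the launch, where the current slit is
      known, or a passage, which the interval avoids.\<close>
    have cur: "current lam x0 fL fR r = slit j r" if r: "r \<in> {s..t}" for r
    proof (cases "r = T j")
      case True
      have "\<not> passage lam x0 r" "T 0 \<le> r" using st r by auto
      then have "j = 0" using passage[of r] True by (cases j) auto
      then show ?thesis using True current_slit(3) by simp
    next
      case False
      then show ?thesis using current_slit(1)[of j r] r j tj by auto
    qed
    have sub: "{s..t} \<subseteq> {T j..T (Suc j)}" using j tj by auto
    from seg_facts(2)[OF slit_wall S[of j]]
    show "(\<forall>r\<in>{s..t}. current lam x0 fL fR r \<le> y r) \<or> (\<forall>r\<in>{s..t}. y r \<le> current lam x0 fL fR r)"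
    proof
      assume "\<forall>t\<in>{T j..T (Suc j)}. y t \<le> slit j t"
      then show ?thesis using cur sub by (metis subsetD)
    next
      assume "\<forall>t\<in>{T j..T (Suc j)}. slit j t \<le> y t"
      then show ?thesis using cur sub by (metis subsetD)
    qed
  next
    fix t assume "T 0 \<le> t" "passage lam x0 t"
    then show "y t \<notin> {0, 1, fL t, fR t}" using passage N by metis
  qed
qed

text \<open>Chosen segments agree at a common end point because both have the state \<open>z\<close>
  there; the value at a passage is taken from the segment that starts at it.\<close>

lemma concatenate:
  assumes z: "\<And>j. reach (slit j) (T j) (T (Suc j)) (z j) (z (Suc j))"
  obtains y w where "\<And>j. seg (slit j) (T j) (T (Suc j)) y w" "\<And>j. (y (T j), w (T j)) = z j"
proof -
  have "\<forall>j. \<exists>y w. seg (slit j) (T j) (T (Suc j)) y w \<and> (y (T j), w (T j)) = z j \<and> (y (T (Suc j)), w (T (Suc j))) = z (Suc j)"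
    using z unfolding reach_seg by blast
  then obtain Y W where YW: "\<And>j. seg (slit j) (T j) (T (Suc j)) (Y j) (W j)" "\<And>j. (Y j (T j), W j (T j)) = z j"
    "\<And>j. (Y j (T (Suc j)), W j (T (Suc j))) = z (Suc j)" by metis
  define ix where "ix = (\<lambda>t. THE j. T j \<le> t \<and> t < T (Suc j))"
  have ix: "ix t = j" if "T j \<le> t" "t < T (Suc j)" for t j
    unfolding ix_def
  proof (rule the_equality)
    fix i assume i: "T i \<le> t \<and> t < T (Suc i)"
    have "T i < T (Suc j)" "T j < T (Suc i)" using i that by linarith+
    then have "i < Suc j" "j < Suc i" unfolding strict_mono_less[OF T(1)] .
    then show "i = j" by simp
  qed (use that in simp)
  define y where "y = (\<lambda>t. Y (ix t) t)"
  define w where "w = (\<lambda>t. W (ix t) t)"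
  have zT: "(y (T j), w (T j)) = z j" for j
    using ix[of j "T j"] T_less[of j] YW(2)[of j] by (simp add: y_def w_def)
  have agree: "y t = Y j t \<and> w t = W j t" if "T j \<le> t" "t \<le> T (Suc j)" for t j
  proof (cases "t = T (Suc j)")
    case True
    then show ?thesis using zT[of "Suc j"] YW(3)[of j] by (metis Pair_inject)
  next
    case False
    then have "ix t = j" using ix that by simp
    then show ?thesis by (simp add: y_def w_def)
  qed
  have "seg (slit j) (T j) (T (Suc j)) y w" for j by (rule seg_cong[OF YW(1) agree])
  then show ?thesis using zT that by blast
qed

end

section \<open>Invariance under shifts by the period\<close>

lemma deriv_shift:
  assumes wall: "wall a M K f" and per: "\<And>t. f (t + c) = f t"
  shows "deriv f (t + c) = deriv f t"
proof -
  have "(f has_real_derivative deriv f (t + c)) (at (t + c))" using wall by (simp add: wall_def)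
  then have "((\<lambda>s. f (s + c)) has_real_derivative deriv f (t + c)) (at t)" by (simp add: DERIV_shift)
  then show ?thesis unfolding per by (rule DERIV_imp_deriv[symmetric])
qed

lemma filtermap_at_left_shift: "filtermap (\<lambda>x. x - d) (at_left a) = at_left (a - d)" for a d :: real
  by (simp add: filter_eq_iff eventually_filtermap eventually_at_filter filtermap_nhds_shift[symmetric])

lemma below_shift:
  assumes per: "\<And>t. f (t + c) = f t" "\<And>t. deriv f (t + c) = deriv f t" and b: "below f (p + c) (q + c) y w"
  shows "below f p q (\<lambda>t. y (t + c)) (\<lambda>t. w (t + c))"
  unfolding below_def
proof (intro conjI ballI)
  fix t assume "t \<in> {p..q}"
  then show "0 \<le> y (t + c)" "y (t + c) \<le> f t" using below_range[OF b, of "t + c"] per(1) by auto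
next
  fix t assume "t \<in> {p..<q}"
  then have "\<forall>\<^sub>F r in at_right (t + c). w r = w (t + c) \<and> y r = y (t + c) + w (t + c) * (r - (t + c)) \<and> 0 < y r \<and> y r < f r"
    by (intro below_right[OF b]) auto
  moreover have "at_right (t + c) = filtermap (\<lambda>x. x + c) (at_right t)"
    using filtermap_at_right_shift[of "-c" t] by simp
  ultimately show "\<forall>\<^sub>F r in at_right t. w (r + c) = w (t + c) \<and> y (r + c) = y (t + c) + w (t + c) * (r - t) \<and> 0 < y (r + c) \<and> y (r + c) < f r"
    by (simp add: eventually_filtermap per(1))
next
  fix t assume "t \<in> {p<..q}"
  then obtain u where u: "\<forall>\<^sub>F r in at_left (t + c). w r = u \<and> y r = y (t + c) + u * (r - (t + c)) \<and> 0 < y r \<and> y r < f r"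
    "w (t + c) = bounce f (t + c) (y (t + c)) u" using below_left[OF b, of "t + c"] by auto
  have "at_left (t + c) = filtermap (\<lambda>x. x + c) (at_left t)"
    using filtermap_at_left_shift[of "-c" t] by simp
  then have "\<forall>\<^sub>F r in at_left t. w (r + c) = u \<and> y (r + c) = y (t + c) + u * (r - t) \<and> 0 < y (r + c) \<and> y (r + c) < f r"
    using u(1) by (simp add: eventually_filtermap per(1))
  moreover have "w (t + c) = bounce f t (y (t + c)) u" using u(2) by (simp add: bounce_def per)
  ultimately show "\<exists>u. (\<forall>\<^sub>F r in at_left t. w (r + c) = u \<and> y (r + c) = y (t + c) + u * (r - t) \<and> 0 < y (r + c) \<and> y (r + c) < f r) \<and>
      w (t + c) = bounce f t (y (t + c)) u" by blast
qed

lemma reach_shift1: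
  assumes wall: "wall a M K f" and per: "\<And>t. f (t + c) = f t" and r: "reach f (p + c) (q + c) x x'"
  shows "reach f p q x x'"
proof -
  have d: "deriv f (t + c) = deriv f t" for t by (rule deriv_shift[OF wall per])
  obtain y w where s: "seg f (p + c) (q + c) y w" "(y (p + c), w (p + c)) = x" "(y (q + c), w (q + c)) = x'"
    using r unfolding reach_seg by blast
  have "seg f p q (\<lambda>t. y (t + c)) (\<lambda>t. w (t + c))"
    using s(1) below_shift[OF per d, of p q y w]
      below_shift[of "\<lambda>t. 1 - f t" c p q "\<lambda>t. 1 - y t" "\<lambda>t. - w t"] deriv_flip[OF wall] per d
    unfolding seg_def by auto
  then show ?thesis using s(2,3) unfolding reach_seg by blast
qed

text \<open>Reduces all later periods to the first, so that a single \<open>period_map\<close> can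
  be iterated. The one-sided version is applied to \<open>c\<close> and to
  \<open>- c\<close>.\<close>

lemma flow_shift:
  assumes wall: "wall a M K f" and per: "\<And>t. f (t + c) = f t"
  shows "flow f (p + c) (q + c) = flow f p q" "reach f (p + c) (q + c) = reach f p q"
proof -
  have per': "f (t + - c) = f t" for t using per[of "t - c"] by simp
  have "reach f (p + c) (q + c) x x' \<longleftrightarrow> reach f p q x x'" for x x'
    using reach_shift1[OF wall per, of p q x x'] reach_shift1[OF wall per', of "p + c" "q + c" x x'] by auto
  then show "reach f (p + c) (q + c) = reach f p q" by (simp add: fun_eq_iff)
  then show "flow f (p + c) (q + c) = flow f p q" by (intro ext) (simp add: flow_def)
qed

section \<open>Exponential growth\<close>

text \<open>Widths lie between \<open>a\<close> and 1, so within a segment the speed falls at most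
  by the factor \<open>a\<close> and a constant. This interpolates between the section
  times.\<close>

lemma seg_speed:
  assumes wall: "wall a M K f" and s: "seg f p q y w" and t: "p \<le> t" "t \<le> q" "q \<le> p + 2"
  shows "a * \<bar>w p\<bar> - (2 * M + 4 * K) \<le> \<bar>w t\<bar>"
proof -
  have *: "a * \<bar>w p\<bar> - (2 * M + 4 * K) \<le> \<bar>w t\<bar>" if wl: "wall a M K f" and b: "below f p q y w" for f y w
  proof -
    have f: "a \<le> f p" "f t \<le> 1" "0 \<le> K" using wall_facts(4,6,3)[OF wl] by (auto intro: less_imp_le)
    have "2 * K * (q - p) \<le> 2 * K * 2" using t f(3) by (intro mult_left_mono) auto
    then have "\<bar>w p\<bar> * f p - \<bar>w t\<bar> * f t \<le> 2 * M + 4 * K" using below_speed[OF wl b t(1,2)] by linarith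
    moreover have "\<bar>w t\<bar> * f t \<le> \<bar>w t\<bar> * 1" using f by (intro mult_left_mono) auto
    moreover have "\<bar>w p\<bar> * a \<le> \<bar>w p\<bar> * f p" using f by (intro mult_left_mono) auto
    ultimately show ?thesis by (simp add: mult.commute)
  qed
  show ?thesis using s *[OF wall] *[OF wall_flip[OF wall], of "\<lambda>t. 1 - y t" "\<lambda>t. - w t"]
    unfolding seg_def by auto
qed

lemma reach_speed:
  assumes wall: "wall a M K f" and r: "reach f p q x x'" and t: "p \<le> q" "q \<le> p + 2"
  shows "a * \<bar>snd x\<bar> - (2 * M + 4 * K) \<le> \<bar>snd x'\<bar>"
proof -
  obtain y w where s: "seg f p q y w" "(y p, w p) = x" "(y q, w q) = x'" using r unfolding reach_seg by blast
  then show ?thesis using seg_speed[OF wall s(1), of q] t by auto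
qed

lemma periodic_multiple:
  fixes f :: "real \<Rightarrow> real"
  assumes "\<And>t. f (t + 2) = f t" shows "f (t + 2 * real n) = f t"
proof (induction n)
  case (Suc n)
  have "t + 2 * real (Suc n) = (t + 2 * real n) + 2" by simp
  then show ?case using assms Suc by metis
qed simp

locale slits = switching a M K fL fR "t1 lam x0" "t2 lam x0"
  for a M K fL fR lam x0
begin

abbreviation "p \<equiv> t1 lam x0"
abbreviation "u \<equiv> t2 lam x0"

text \<open>Even passages lead into the right part of the table, odd ones back into the left
  part.\<close>

definition pass :: "nat \<Rightarrow> real" where
  "pass m = (if even m then p + real m else u + real m - 1)"

text \<open>The passage preceding \<open>pass m\<close>, given separately because for
  \<open>m = 0\<close> it is \<open>u - 2\<close>, which is not of the form
  \<open>pass k\<close>.\<close>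

definition before :: "nat \<Rightarrow> real" where
  "before m = (if even m then u + real m - 2 else p + real m - 1)"

lemma before_Suc: "before (Suc m) = pass m"
  by (auto simp: before_def pass_def)

lemma before_pass: "before m < pass m" "pass m - before m < 2"
  using times by (auto simp: before_def pass_def)

lemma pass_less_Suc: "pass m < pass (Suc m)"
  using before_pass(1)[of "Suc m"] by (simp add: before_Suc)

lemma pass_strict_mono: "strict_mono pass"
  using pass_less_Suc by (simp add: strict_mono_Suc_iff)

lemma on_right_between:
  assumes "before m < t" "t < pass m"
  shows "on_right lam x0 t \<longleftrightarrow> odd m"
proof (cases "odd m")
  case True
  then obtain i where "m = 2 * i + 1" by (elim oddE)
  then have "p + 2 * of_int (int i) < t \<and> t < u + 2 * of_int (int i)" using assms by (auto simp: before_def pass_def)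
  then show ?thesis using True unfolding on_right_def by blast
next
  case False
  then have "even m" by simp
  then obtain i where m: "m = 2 * i" by (elim evenE)
  have t: "u + 2 * real i - 2 < t" "t < p + 2 * real i" using assms False m by (auto simp: before_def pass_def)
  have "\<not> on_right lam x0 t"
  proof
    assume "on_right lam x0 t"
    then obtain k :: int where k: "p + 2 * of_int k < t" "t < u + 2 * of_int k" unfolding on_right_def by blast
    have "real_of_int k < real_of_int (int i)" "real_of_int (int i) < real_of_int (k + 1)" using k t by simp_all
    then have "k < int i" "int i < k + 1" unfolding of_int_less_iff by simp_all
    then show False by simp
  qed
  then show ?thesis using False by simp
qed

lemma passage_pass: "passage lam x0 (pass m)"
proof (cases "even m")
  case True
  then obtain i where "m = 2 * i" by (elim evenE) auto
  then have "pass m = p + 2 * of_int (int i)" by (simp add: pass_def)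
  then show ?thesis unfolding passage_def by blast
next
  case False
  then obtain i where "m = 2 * i + 1" by (elim oddE)
  then have "pass m = u + 2 * of_int (int i)" by (simp add: pass_def)
  then show ?thesis unfolding passage_def by blast
qed

lemma passage_after:
  assumes "passage lam x0 t" "before n < t"
  shows "\<exists>j. t = pass (n + j)"
proof -
  have "before 0 \<le> before n"
    using times by (cases n) (auto simp: before_def)
  then have t: "u - 2 < t" using assms(2) by (simp add: before_def)
  obtain k :: int where "t = p + 2 * of_int k \<or> t = u + 2 * of_int k" using assms(1) unfolding passage_def by blast
  then obtain m where m: "t = pass m"
  proof
    assume k: "t = p + 2 * of_int k"
    have "real_of_int (-1) < real_of_int k" using k t times by simp
    then have "-1 < k" unfolding of_int_less_iff .
    then have "t = pass (2 * nat k)" using k by (simp add: pass_def)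
    then show ?thesis using that by blast
  next
    assume k: "t = u + 2 * of_int k"
    have "real_of_int (-1) < real_of_int k" using k t times by simp
    then have "-1 < k" unfolding of_int_less_iff .
    then have "t = pass (2 * nat k + 1)" using k by (simp add: pass_def)
    then show ?thesis using that by blast
  qed
  have "n \<le> m"
  proof (rule ccontr)
    assume "\<not> n \<le> m"
    then obtain n' where n': "n = Suc n'" "m \<le> n'" by (cases n) auto
    then have "pass m \<le> before n" using pass_strict_mono by (simp add: before_Suc strict_mono_less_eq)
    then show False using assms(2) m by simp
  qed
  then show ?thesis using m by (intro exI[of _ "m - n"]) simp
qed

definition times_from :: "real \<Rightarrow> nat \<Rightarrow> nat \<Rightarrow> real" where
  "times_from t n j = (if j = 0 then t else pass (n + j - 1))"

lemma itinerary_from: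
  assumes t: "before n < t" "t < pass n"
  shows "itinerary a M K lam x0 fL fR (times_from t n) (\<lambda>j. odd (n + j))"
proof
  let ?T = "times_from t n"
  show "wall a M K fL" "wall a M K fR" by (rule walls)+
  have bT: "before (n + j) \<le> ?T j" for j
    using t by (cases j) (auto simp: times_from_def before_Suc)
  have TS: "?T (Suc j) = pass (n + j)" for j by (simp add: times_from_def)
  have "?T j < ?T (Suc j)" for j
    using t pass_less_Suc by (cases j) (auto simp: times_from_def)
  then show "strict_mono ?T" by (simp add: strict_mono_Suc_iff)
  show "\<exists>j. b < ?T j" for b
  proof -
    obtain j :: nat where j: "b - p + 1 < real j" using reals_Archimedean2 by blast
    have "p + real j - 1 \<le> pass (n + j)" using times by (auto simp: pass_def)
    then show ?thesis using j by (intro exI[of _ "Suc j"]) (simp add: TS)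
  qed
  show "on_right lam x0 s = odd (n + j)" if "?T j < s" "s < ?T (Suc j)" for j s
    using on_right_between[of "n + j" s] bT[of j] that by (simp add: TS)
  show "on_right lam x0 (?T 0) = odd (n + 0)" using on_right_between[OF t] by (simp add: times_from_def)
  show "passage lam x0 s \<longleftrightarrow> (\<exists>j. s = ?T (Suc j))" if "?T 0 \<le> s" for s
  proof -
    have "before n < s" using that t by (simp add: times_from_def)
    then show ?thesis using passage_after[of s n] passage_pass by (auto simp: TS)
  qed
qed

text \<open>The state in which an orbit launched from the slit at time \<open>t\<close> between the passages
  \<open>n - 1\<close> and \<open>n\<close> first switches to the right part.\<close>

definition entry :: "nat \<Rightarrow> real \<times> real \<Rightarrow> real \<times> real \<Rightarrow> bool" where
  "entry n x s \<longleftrightarrow> s \<in> table fL p \<and>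
     (if even n then reach fL (fst x) (pass n) (fL (fst x), snd x) s
      else \<exists>s1. reach fR (fst x) (pass n) (fR (fst x), snd x) s1 \<and> s1 \<in> table fR u \<and> s1 \<in> table fL u \<and>
        reach fL u (p + 2) s1 s)"

text \<open>The number of passages up to and including the first entry into the right part.\<close>

definition entry_index :: "nat \<Rightarrow> nat" where
  "entry_index n = (if even n then 1 else 2)"

text \<open>\<open>(n + entry_index n - 1) div 2\<close> is the number of the period in which the
  entry takes place; from then on the passages are translates of \<open>p\<close> and
  \<open>u\<close> by whole periods.\<close>

lemma times_entry: "times_from t n (entry_index n + 2 * k) = p + 2 * real ((n + entry_index n - 1) div 2 + k)"
  "times_from t n (entry_index n + 2 * k + 1) = u + 2 * real ((n + entry_index n - 1) div 2 + k)"
  "times_from t n (entry_index n + 2 * k + 2) = p + 2 + 2 * real ((n + entry_index n - 1) div 2 + k)"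
proof -
  have "even (n + entry_index n - 1)" "0 < entry_index n" by (auto simp: entry_index_def)
  then obtain m where m: "n + entry_index n - 1 = 2 * m" by (elim evenE)
  have e: "0 < entry_index n" by (simp add: entry_index_def)
  have i: "n + (entry_index n + 2 * k) - 1 = 2 * (m + k)" "n + (entry_index n + 2 * k + 1) - 1 = 2 * (m + k) + 1"
    "n + (entry_index n + 2 * k + 2) - 1 = 2 * (m + k + 1)"
    using m e by simp_all
  show "times_from t n (entry_index n + 2 * k) = p + 2 * real ((n + entry_index n - 1) div 2 + k)"
    "times_from t n (entry_index n + 2 * k + 1) = u + 2 * real ((n + entry_index n - 1) div 2 + k)"
    "times_from t n (entry_index n + 2 * k + 2) = p + 2 + 2 * real ((n + entry_index n - 1) div 2 + k)"
    unfolding times_from_def i m using e by (simp_all add: pass_def)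
qed

text \<open>Existence is by concatenation along the iterates of the entry state. The second claim is
  about every orbit with these initial data: growth asks for some growing orbit, so refuting it
  requires that no other orbit is possible.\<close>

lemma entry_orbit:
  assumes t: "before n < t" "t < pass n" and e: "entry n (t, v) s"
    and orb: "\<And>k. (period_map ^^ k) s \<in> orbit_states"
  obtains y w where "slit_orbit lam x0 fL fR t v y w"
    "\<And>y w. slit_orbit lam x0 fL fR t v y w \<Longrightarrow>
       (\<forall>j. seg (if odd (n + j) then fR else fL) (times_from t n j) (times_from t n (Suc j)) y w) \<and>
       (\<forall>k. w (times_from t n (entry_index n + 2 * k)) = snd ((period_map ^^ k) s))"
proof -
  let ?T = "times_from t n" and ?e = "entry_index n"
  interpret it: itinerary a M K lam x0 fL fR ?T "\<lambda>j. odd (n + j)" by (rule itinerary_from[OF t])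
  define S where "S = (\<lambda>k. (period_map ^^ k) s)"
  define s1 where "s1 = (SOME s1. reach fR t (pass n) (fR t, v) s1 \<and> s1 \<in> table fR u \<and> s1 \<in> table fL u \<and> reach fL u (p + 2) s1 s)"
  have s1: "reach fR t (pass n) (fR t, v) s1" "s1 \<in> table fR u" "s1 \<in> table fL u" "reach fL u (p + 2) s1 s" if "odd n"
    using someI_ex[of "\<lambda>s1. reach fR t (pass n) (fR t, v) s1 \<and> s1 \<in> table fR u \<and> s1 \<in> table fL u \<and> reach fL u (p + 2) s1 s"] e that
    unfolding s1_def entry_def by auto
  \<comment> \<open>The states at successive passages: the launch, the intermediate state
    \<open>s1\<close> if the launch is in the right part, then the iterates of \<open>s\<close>
    alternating with their images at the passage back to the left part.\<close>
  define z where "z = (\<lambda>j. if j = 0 then (it.slit 0 t, v) else if j < ?e then s1 else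
    if even (j - ?e) then S ((j - ?e) div 2) else flow fR p u (S ((j - ?e) div 2)))"
  define m where "m = (n + ?e - 1) div 2"
  have e0: "0 < ?e" by (simp add: entry_index_def)
  have pn: "even (n + ?e - 1)" "odd (n + ?e)" by (auto simp: entry_index_def)
  have zS: "z (?e + 2 * k) = S k" "z (?e + 2 * k + 1) = flow fR p u (S k)" "z (?e + 2 * k + 2) = S (Suc k)" for k
  proof -
    have "?e + 2 * k + 1 - ?e = 2 * k + 1" "?e + 2 * k + 2 - ?e = 2 * Suc k" by simp_all
    then show "z (?e + 2 * k) = S k" "z (?e + 2 * k + 1) = flow fR p u (S k)" "z (?e + 2 * k + 2) = S (Suc k)"
      using e0 by (simp_all add: z_def)
  qed
  have SS: "S (Suc k) = period_map (S k)" "S 0 = s" for k by (simp_all add: S_def)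
  have O: "S k \<in> table fR p" "reach fR p u (S k) (flow fR p u (S k))" "flow fR p u (S k) \<in> table fR u"
    "flow fR p u (S k) \<in> table fL u" "reach fL u (p + 2) (flow fR p u (S k)) (S (Suc k))" "S (Suc k) \<in> table fL p" for k
    using orb[of k] by (auto simp: orbit_states_def SS S_def)
  have O': "S k \<in> table fL p" for k using O(6) e by (cases k) (auto simp: SS entry_def)
  have per: "fL (r + 2 * real k) = fL r" "fR (r + 2 * real k) = fR r" for r k
    using periodic by (auto intro: periodic_multiple)
  note shL = flow_shift(2)[where f = fL, OF walls(1) per(1)] and shR = flow_shift(2)[where f = fR, OF walls(2) per(2)]
  have cases_j: "j = 0 \<or> (odd n \<and> j = 1) \<or> (\<exists>k. j = ?e + 2 * k) \<or> (\<exists>k. j = ?e + 2 * k + 1)" for j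
  proof (cases "?e \<le> j")
    case True
    then have "j = ?e + (j - ?e)" by simp
    then show ?thesis by (metis evenE oddE add.assoc)
  next
    case False
    then show ?thesis by (auto simp: entry_index_def split: if_splits)
  qed
  have step: "reach (it.slit j) (?T j) (?T (Suc j)) (z j) (z (Suc j)) \<and>
      fst (z (Suc j)) \<notin> {0, 1, fL (?T (Suc j)), fR (?T (Suc j))}" for j
  proof -
    have tab: "fst x \<notin> {0, 1, fL r, fR r}" if "x \<in> table fL r" "x \<in> table fR r" for x r
      using that by (auto simp: table_def)
    from cases_j[of j] consider (init) "j = 0" "even n" | (init') "j = 0" "odd n" | (odd) "odd n" "j = 1"
      | (right) k where "j = ?e + 2 * k" | (left) k where "j = ?e + 2 * k + 1" by blast
    then show ?thesis
    proof cases
      case init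
      then have e1: "?e = 1" by (simp add: entry_index_def)
      have "reach fL t (pass n) (fL t, v) s" using e init by (simp add: entry_def)
      moreover have "z (Suc j) = s" using zS(1)[of 0] init by (simp add: e1 SS)
      moreover have sl: "it.slit 0 = fL" using init(2) unfolding it.slit_def by simp
      moreover have "z j = (fL t, v)" by (simp only: z_def init(1) sl if_True simp_thms)
      moreover have "?T j = t" "?T (Suc j) = pass n" using init(1) by (simp_all add: times_from_def)
      moreover have "fL (pass n) = fL p" "fR (pass n) = fR p"
        using init(2) per[of p "n div 2"] by (auto simp: pass_def)
      moreover have "fst s \<notin> {0, 1, fL p, fR p}" using tab[OF O' O(1), of 0] by (simp add: SS)
      ultimately show ?thesis using init(1) by (simp only: simp_thms)
    next
      case init'
      then have e2: "?e = 2" by (simp add: entry_index_def)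
      have "pass n = u + 2 * real (n div 2)" using init'(2) by (auto simp: pass_def elim!: oddE)
      then have "fL (pass n) = fL u" "fR (pass n) = fR u" using per[of u "n div 2"] by auto
      moreover have "z (Suc j) = s1" using init'(1) by (simp add: z_def e2)
      moreover have sl: "it.slit 0 = fR" using init'(2) unfolding it.slit_def by simp
      moreover have "z j = (fR t, v)" by (simp only: z_def init'(1) sl if_True simp_thms)
      moreover have "?T j = t" "?T (Suc j) = pass n" using init'(1) by (simp_all add: times_from_def)
      ultimately show ?thesis using init'(1) s1(1)[OF init'(2)] tab[OF s1(3,2)[OF init'(2)]] by (simp only: simp_thms)
    next
      case odd
      then have e2: "?e = 2" by (simp add: entry_index_def)
      have z1: "z 1 = s1" by (simp add: z_def e2)
      have z2: "z 2 = s" using zS(1)[of 0] by (simp add: e2 SS)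
      have "pass n = u + 2 * real (n div 2)" using odd(1) by (auto simp: pass_def elim!: oddE)
      moreover have "pass (Suc n) = p + 2 + 2 * real (n div 2)" using odd(1) by (auto simp: pass_def elim!: oddE)
      moreover have "p + 2 + 2 * real (n div 2) = p + 2 * real (Suc (n div 2))" by simp
      ultimately have T: "?T 1 = u + 2 * real (n div 2)" "?T 2 = p + 2 + 2 * real (n div 2)"
        and f: "fL (?T 2) = fL p" "fR (?T 2) = fR p"
        using per[of p "Suc (n div 2)"] by (auto simp: times_from_def)
      have "reach fL (?T 1) (?T 2) s1 s"
        unfolding T using s1(4)[OF odd(1)] shL[of u "n div 2" "p + 2"] by simp
      moreover have "it.slit j = fL" using odd unfolding it.slit_def by simp
      moreover have "Suc j = 2" using odd by simp
      moreover have "fst s \<notin> {0, 1, fL p, fR p}" using tab[OF O' O(1), of 0] by (simp add: SS)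
      ultimately show ?thesis using odd(2) z1 z2 f by (simp only: simp_thms)
    next
      case right
      have "odd (n + j)" using right pn by simp
      then have "it.slit j = fR" unfolding it.slit_def by (rule if_P)
      moreover have "?T j = p + 2 * real (m + k)" "?T (Suc j) = u + 2 * real (m + k)"
        using times_entry(1,2)[of t n k] right by (simp_all add: m_def)
      moreover have "z j = S k" "z (Suc j) = flow fR p u (S k)" using zS(1,2)[of k] right by simp_all
      ultimately show ?thesis using O(2)[of k] tab[OF O(4) O(3), of k] by (simp only: shR per simp_thms)
    next
      case left
      have "\<not> odd (n + j)" using left pn by simp
      then have "it.slit j = fL" unfolding it.slit_def by (rule if_not_P)
      moreover have "?T j = u + 2 * real (m + k)" "?T (Suc j) = p + 2 + 2 * real (m + k)"
        using times_entry(2,3)[of t n k] left by (simp_all add: m_def)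
      moreover have "z j = flow fR p u (S k)" "z (Suc j) = S (Suc k)" using zS(2,3)[of k] left by simp_all
      moreover have "fL (p + 2) = fL p" "fR (p + 2) = fR p" using periodic by auto
      ultimately show ?thesis using O(5)[of k] tab[OF O' O(1), of "Suc k"] by (simp only: shL per simp_thms)
    qed
  qed
  have T0: "?T 0 = t" by (simp add: times_from_def)
  obtain y w where yw: "\<And>j. seg (it.slit j) (?T j) (?T (Suc j)) y w" "\<And>j. (y (?T j), w (?T j)) = z j"
    using it.concatenate[of z] step by blast
  have "it.follows y w"
    unfolding it.follows_def using yw step by (metis fst_conv)
  moreover have "y t = it.slit 0 t" "w t = v" using yw(2)[of 0] by (auto simp: T0 z_def)
  ultimately have 1: "slit_orbit lam x0 fL fR t v y w" using it.follows_slit_orbit[of y w] by (simp add: T0)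
  have 2: "(\<forall>j. seg (if odd (n + j) then fR else fL) (?T j) (?T (Suc j)) y w) \<and> (\<forall>k. w (?T (?e + 2 * k)) = snd (S k))"
    if o: "slit_orbit lam x0 fL fR t v y w" for y w
  proof -
    have fo: "it.follows y w" using it.slit_orbit_follows[of v y w] o by (simp add: T0)
    then have sg: "seg (it.slit j) (?T j) (?T (Suc j)) y w" for j
      unfolding it.follows_def by blast
    \<comment> \<open>Determinism on each interval, in the form of \<open>reach_unique\<close>,
      propagates along the passages.\<close>
    have zj: "(y (?T j), w (?T j)) = z j" for j
    proof (induction j)
      case 0
      have "y t = current lam x0 fL fR t" "w t = v" using o unfolding slit_orbit_def by blast+
      then show ?case using it.current_slit(3) by (simp add: T0 z_def)
    next
      case (Suc j)
      have "reach (it.slit j) (?T j) (?T (Suc j)) (z j) (y (?T (Suc j)), w (?T (Suc j)))"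
        unfolding reach_seg using sg[of j] Suc by blast
      then show ?case using reach_unique[OF it.T_less] step by blast
    qed
    have "w (?T (?e + 2 * k)) = snd (S k)" for k using zj[of "?e + 2 * k"] zS(1)[of k] by (metis snd_conv)
    then show ?thesis using sg unfolding it.slit_def by blast
  qed
  show ?thesis using that[OF 1] 2 unfolding S_def by blast
qed

text \<open>Either the trap is entered, and the speed grows geometrically from then on, or the
  speeds at the section times stay bounded. So growth is decided on the section.\<close>

lemma growth_iff:
  assumes t: "before n < t" "t < pass n" and e: "entry n (t, v) s"
    and orb: "\<And>k. (period_map ^^ k) s \<in> orbit_states"
    and c: "0 < V" "1 < r" "0 < \<rho>" "\<rho> < 1" "0 \<le> C"
    and trap: "\<And>x. x \<in> orbit_states \<Longrightarrow> x \<in> trap V \<Longrightarrow> period_map x \<in> trap V \<and> r * \<bar>snd x\<bar> \<le> \<bar>snd (period_map x)\<bar>"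
    and slow: "\<And>x. x \<in> orbit_states \<Longrightarrow> period_map x \<notin> trap V \<Longrightarrow> \<bar>snd (period_map x)\<bar> \<le> max V (\<rho> * \<bar>snd x\<bar> + C)"
  shows "exp_energy_growth lam x0 fL fR t v \<longleftrightarrow> (\<exists>k. (period_map ^^ k) s \<in> trap V)"
proof -
  let ?T = "times_from t n" and ?e = "entry_index n"
  define S where "S = (\<lambda>k. (period_map ^^ k) s)"
  have SS: "S (Suc k) = period_map (S k)" for k by (simp add: S_def)
  have O: "S k \<in> orbit_states" for k using orb by (simp add: S_def)
  interpret it: itinerary a M K lam x0 fL fR ?T "\<lambda>j. odd (n + j)" by (rule itinerary_from[OF t])
  obtain y w where yw: "slit_orbit lam x0 fL fR t v y w" and
    orbit: "\<And>y w. slit_orbit lam x0 fL fR t v y w \<Longrightarrow>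
       (\<forall>j. seg (if odd (n + j) then fR else fL) (?T j) (?T (Suc j)) y w) \<and> (\<forall>k. w (?T (?e + 2 * k)) = snd (S k))"
    using entry_orbit[OF t e orb] unfolding S_def by blast
  have Te: "?T (?e + 2 * k) = ?T ?e + 2 * real k" for k
    using times_entry(1)[of t n k] times_entry(1)[of t n 0] by (simp add: algebra_simps)
  have "\<exists>k. S k \<in> trap V" if g: "exp_energy_growth lam x0 fL fR t v"
  proof (rule ccontr)
    assume nt: "\<not> ?thesis"
    obtain y w c \<zeta> where o: "slit_orbit lam x0 fL fR t v y w" and c': "0 < c" "0 < \<zeta>"
      and ev: "\<forall>\<^sub>F s in at_top. c * exp (\<zeta> * s) \<le> \<bar>w (t + s)\<bar>"
      using g unfolding exp_energy_growth_def by blast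
    \<comment> \<open>\<open>C / (1 - \<rho>)\<close> is the fixed point of the affine bound
      \<open>\<rho> * x + C\<close>, so a bound above it is preserved by the period map.\<close>
    define B where "B = max \<bar>snd s\<bar> (max V (C / (1 - \<rho>)))"
    have B: "\<bar>snd (S k)\<bar> \<le> B" for k
    proof (induction k)
      case 0
      show ?case by (simp add: S_def B_def)
    next
      case (Suc k)
      have "S (Suc k) \<notin> trap V" using nt by blast
      then have "\<bar>snd (S (Suc k))\<bar> \<le> max V (\<rho> * \<bar>snd (S k)\<bar> + C)" using slow[OF O] by (simp add: SS)
      moreover have "\<rho> * \<bar>snd (S k)\<bar> \<le> \<rho> * B" using Suc c by (intro mult_left_mono) auto
      moreover have "C / (1 - \<rho>) \<le> B" by (simp add: B_def)
      then have "C \<le> B * (1 - \<rho>)" using c by (simp add: field_simps)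
      then have "\<rho> * B + C \<le> B" by (simp add: algebra_simps)
      moreover have "V \<le> B" by (simp add: B_def)
      ultimately show ?case by linarith
    qed
    have "filterlim (\<lambda>s. c * exp (\<zeta> * s)) at_top at_top"
      using c' by (intro filterlim_tendsto_pos_mult_at_top[OF tendsto_const] filterlim_compose[OF exp_at_top]
          filterlim_tendsto_pos_mult_at_top[OF tendsto_const] filterlim_ident)
    then have "\<forall>\<^sub>F s in at_top. B < c * exp (\<zeta> * s)" by (simp add: filterlim_at_top_dense)
    with ev have "\<forall>\<^sub>F s in at_top. B < \<bar>w (t + s)\<bar>" by eventually_elim linarith
    then obtain b where b: "\<And>s. b \<le> s \<Longrightarrow> B < \<bar>w (t + s)\<bar>" unfolding eventually_at_top_linorder by blast
    obtain k :: nat where k: "b + t - ?T ?e < real k" using reals_Archimedean2 by blast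
    have "B < \<bar>w (t + (?T (?e + 2 * k) - t))\<bar>" using k by (intro b) (simp add: Te)
    moreover have "w (?T (?e + 2 * k)) = snd (S k)" using orbit[OF o] by blast
    ultimately show False using B[of k] by simp
  qed
  moreover have "exp_energy_growth lam x0 fL fR t v" if k0: "S k0 \<in> trap V" for k0
  proof -
    have grow: "S (k0 + i) \<in> trap V \<and> r ^ i * V \<le> \<bar>snd (S (k0 + i))\<bar>" for i
    proof (induction i)
      case 0
      then show ?case using k0 by (simp add: trap_def)
    next
      case (Suc i)
      have "r * (r ^ i * V) \<le> r * \<bar>snd (S (k0 + i))\<bar>" using Suc c by (intro mult_left_mono) auto
      then show ?case using trap[OF O, of "k0 + i"] Suc by (simp add: SS algebra_simps)
    qed
    define C0 where "C0 = 2 * M + 4 * K"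
    have C0: "0 \<le> C0" and a: "0 < a" "a \<le> 1"
      using f_bounds(2,8)[of 0] f_bounds(5-7) by (simp_all add: C0_def)
    have sg: "seg (it.slit j) (?T j) (?T (Suc j)) y w" for j
      using orbit[OF yw] unfolding it.slit_def by blast
    have len: "?T (Suc j) \<le> ?T j + 2" if "j \<noteq> 0" for j
      using that before_pass(2)[of "n + j"] by (cases j) (auto simp: times_from_def before_Suc)
    have speed: "a * \<bar>w (?T j)\<bar> - C0 \<le> \<bar>w \<tau>\<bar>" if "j \<noteq> 0" "?T j \<le> \<tau>" "\<tau> \<le> ?T (Suc j)" for j \<tau>
      unfolding C0_def by (rule seg_speed[OF it.slit_wall sg that(2,3) len[OF that(1)]])
    have e0: "?e \<noteq> 0" by (simp add: entry_index_def)
    \<comment> \<open>A period consists of two segments, each of which may cost a factor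
      \<open>a\<close> and an error \<open>C0\<close>; the weaker bound, for the second segment, is
      used in both.\<close>
    have low: "a * a * \<bar>snd (S k)\<bar> - 2 * C0 \<le> \<bar>w \<tau>\<bar>"
      if \<tau>: "?T ?e + 2 * real k \<le> \<tau>" "\<tau> \<le> ?T ?e + 2 * real k + 2" for k \<tau>
    proof -
      let ?j = "?e + 2 * k"
      have wj: "w (?T ?j) = snd (S k)" using orbit[OF yw] by blast
      have TT: "?T ?j = ?T ?e + 2 * real k" "?T (?j + 2) = ?T ?e + 2 * real k + 2"
        using Te[of k] Te[of "Suc k"] by (simp_all add: numeral_2_eq_2)
      have j0: "?j \<noteq> 0" using e0 by simp
      show ?thesis
      proof (cases "\<tau> \<le> ?T (Suc ?j)")
        case True
        have "?T ?j \<le> \<tau>" using \<tau>(1) TT(1) by simp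
        from speed[OF j0 this True] have "a * \<bar>snd (S k)\<bar> - C0 \<le> \<bar>w \<tau>\<bar>" unfolding wj .
        moreover have "a * (a * \<bar>snd (S k)\<bar>) \<le> 1 * (a * \<bar>snd (S k)\<bar>)" using a by (intro mult_right_mono) auto
        ultimately show ?thesis using C0 by (simp add: mult.assoc)
      next
        case False
        have 1: "a * \<bar>snd (S k)\<bar> - C0 \<le> \<bar>w (?T (Suc ?j))\<bar>"
          using speed[OF j0, of "?T (Suc ?j)"] it.T_less[of ?j] wj by simp
        have 2: "a * \<bar>w (?T (Suc ?j))\<bar> - C0 \<le> \<bar>w \<tau>\<bar>"
          using speed[of "Suc ?j" \<tau>] False \<tau>(2) TT(2) by (simp add: numeral_2_eq_2)
        have "a * (a * \<bar>snd (S k)\<bar> - C0) \<le> a * \<bar>w (?T (Suc ?j))\<bar>" using 1 a by (intro mult_left_mono) auto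
        moreover have "a * C0 \<le> 1 * C0" using a C0 by (intro mult_right_mono) auto
        ultimately show ?thesis using 2 by (simp add: algebra_simps)
      qed
    qed
    \<comment> \<open>The guaranteed factor per period is \<open>r\<close>, and a period has length
      2.\<close>
    define \<zeta> where "\<zeta> = ln r / 2"
    have \<zeta>: "0 < \<zeta>" using c by (simp add: \<zeta>_def)
    \<comment> \<open>Accounts for the time from launch to entry, the \<open>k0\<close> periods
      before the trap, and one period lost in rounding down the elapsed time.\<close>
    define A where "A = exp (ln r * ((t - ?T ?e) / 2 - real k0 - 1))"
    define D where "D = a * a * V * A"
    have D: "0 < D" using a c by (simp add: D_def A_def)
    have bound: "D * exp (\<zeta> * s) - 2 * C0 \<le> \<bar>w (t + s)\<bar>" if s: "?T ?e + 2 * real k0 - t \<le> s" for s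
    proof -
      define h where "h = (t + s - ?T ?e) / 2"
      have h: "real k0 \<le> h" using s by (simp add: h_def field_simps)
      define k where "k = nat \<lfloor>h\<rfloor>"
      have k: "real k \<le> h" "h < real k + 1" using h by (auto simp: k_def)
      have kk: "k0 \<le> k" using h by (simp add: k_def le_nat_floor)
      obtain i where i: "k = k0 + i" using kk le_Suc_ex by blast
      have "ln r * (h - real k0 - 1) \<le> ln r * real i" using k(2) c by (intro mult_left_mono) (auto simp: i)
      then have "exp (ln r * (h - real k0 - 1)) \<le> exp (ln r * real i)" by simp
      also have "exp (ln r * real i) = r ^ i" using c by (simp add: mult.commute exp_of_nat_mult)
      also have "exp (ln r * (h - real k0 - 1)) = A * exp (\<zeta> * s)"
        unfolding A_def exp_add[symmetric] by (simp add: h_def \<zeta>_def field_simps)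
      finally have "A * exp (\<zeta> * s) * V \<le> r ^ i * V" using c by (intro mult_right_mono) auto
      also have "\<dots> \<le> \<bar>snd (S k)\<bar>" using grow[of i] by (simp add: i)
      finally have "(a * a) * (A * exp (\<zeta> * s) * V) \<le> (a * a) * \<bar>snd (S k)\<bar>" using a by (intro mult_left_mono) auto
      moreover have "a * a * \<bar>snd (S k)\<bar> - 2 * C0 \<le> \<bar>w (t + s)\<bar>"
        using k by (intro low) (auto simp: h_def field_simps)
      ultimately show ?thesis by (simp add: D_def mult.assoc mult.left_commute mult.commute)
    qed
    have "filterlim (\<lambda>s. D / 2 * exp (\<zeta> * s)) at_top at_top"
      using D \<zeta> by (intro filterlim_tendsto_pos_mult_at_top[OF tendsto_const] filterlim_compose[OF exp_at_top]
          filterlim_tendsto_pos_mult_at_top[OF tendsto_const] filterlim_ident) auto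
    then have "\<forall>\<^sub>F s in at_top. 2 * C0 < D / 2 * exp (\<zeta> * s)" unfolding filterlim_at_top_dense by blast
    then have "\<forall>\<^sub>F s in at_top. D / 2 * exp (\<zeta> * s) \<le> \<bar>w (t + s)\<bar>"
      using eventually_ge_at_top[of "?T ?e + 2 * real k0 - t"]
    proof eventually_elim
      case (elim s)
      then show ?case using bound[of s] by simp
    qed
    then show ?thesis unfolding exp_energy_growth_def using yw D \<zeta> half_gt_zero by blast
  qed
  ultimately show ?thesis unfolding S_def by blast
qed

text \<open>At most two segments precede the entry, each costing a factor \<open>a\<close>. This
  converts the speed threshold of the section into one for initial conditions.\<close>

lemma entry_speed:
  assumes t: "before n < t" "t < pass n" and e: "entry n (t, v) s"
  shows "a * a * \<bar>v\<bar> - 2 * (2 * M + 4 * K) \<le> \<bar>snd s\<bar>"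
proof -
  define C0 where "C0 = 2 * M + 4 * K"
  have C0: "0 \<le> C0" and a: "0 < a" "a \<le> 1"
    using f_bounds(2,8)[of 0] f_bounds(5-7) by (simp_all add: C0_def)
  have tn: "t \<le> pass n" "pass n \<le> t + 2" using t before_pass(2)[of n] by auto
  have av: "a * (a * \<bar>v\<bar>) \<le> 1 * (a * \<bar>v\<bar>)" using a by (intro mult_right_mono) auto
  show ?thesis
  proof (cases "even n")
    case True
    then have "a * \<bar>v\<bar> - C0 \<le> \<bar>snd s\<bar>"
      using e reach_speed[OF walls(1) _ tn, of "(fL t, v)" s] by (simp add: entry_def C0_def)
    then show ?thesis using av C0 by (simp add: C0_def mult.assoc)
  next
    case False
    then obtain s1 where s1: "reach fR t (pass n) (fR t, v) s1" "reach fL u (p + 2) s1 s"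
      using e by (auto simp: entry_def)
    have 1: "a * \<bar>v\<bar> - C0 \<le> \<bar>snd s1\<bar>" using reach_speed[OF walls(2) s1(1) tn] by (simp add: C0_def)
    have 2: "a * \<bar>snd s1\<bar> - C0 \<le> \<bar>snd s\<bar>" using reach_speed[OF walls(1) s1(2)] times by (simp add: C0_def)
    have "a * (a * \<bar>v\<bar> - C0) \<le> a * \<bar>snd s1\<bar>" using 1 a by (intro mult_left_mono) auto
    moreover have "a * C0 \<le> 1 * C0" using a C0 by (intro mult_right_mono) auto
    ultimately show ?thesis using 2 unfolding C0_def[symmetric] by (simp add: algebra_simps)
  qed
qed

text \<open>Launching pulls null sets back to null sets, so almost every initial condition enters in
  a prescribed set of full measure; below this is the set where all iterates exist.\<close>

lemma entry_map:
  assumes D: "D \<in> sets borel" "emeasure lborel (strip - D) = 0"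
  obtains Y E where "null_preserving Y E" "Y \<subseteq> {x. before n < fst x \<and> fst x < pass n}"
    "emeasure lborel ({x. before n < fst x \<and> fst x < pass n} - Y) = 0"
    "\<And>x. x \<in> Y \<Longrightarrow> E x \<in> D \<and> entry n x (E x)"
proof -
  have per: "fL (r + 2 * real k) = fL r" "fR (r + 2 * real k) = fR r" for r k
    using periodic by (auto intro: periodic_multiple)
  define f where "f = (if even n then fL else fR)"
  have wf: "wall a M K f" using walls by (simp add: f_def)
  let ?B = "{x::real \<times> real. before n < fst x \<and> fst x < pass n}"
  obtain A where A: "null_preserving A (launch f (pass n))" "A \<subseteq> ?B"
    "\<And>x. x \<in> A \<Longrightarrow> launch f (pass n) x \<in> table f (pass n) \<and> reach f (fst x) (pass n) (f (fst x), snd x) (launch f (pass n) x)"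
    "emeasure lborel (?B - A) = 0"
    using launch_flow[OF wf before_pass(1)[of n]] by blast
  have strip: "strip \<in> sets borel" unfolding strip_def by measurable
  have B: "?B \<in> sets borel" by measurable
  \<comment> \<open>The remaining way from the first passage to the entry: none after a launch in
    the left part, the flow past the left slit after a launch in the right part.\<close>
  obtain D' E' where D': "null_preserving D' E'" "emeasure lborel (strip - D') = 0"
    "\<And>x s. s \<in> D' \<Longrightarrow> x \<in> A \<Longrightarrow> launch f (pass n) x = s \<Longrightarrow> E' s \<in> D \<and> entry n x (E' s)"
  proof (cases "even n")
    case True
    have "null_preserving D (\<lambda>x. x)"
      unfolding null_preserving_def using D(1) by (auto intro: emeasure_eq_0)
    moreover have "s \<in> D \<and> entry n x s" if "s \<in> D" "x \<in> A" "launch f (pass n) x = s" for x s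
    proof -
      have "fL (pass n) = fL p" using True per(1)[of p "n div 2"] by (auto simp: pass_def)
      then have "table fL (pass n) = table fL p" by (simp add: table_def)
      then show ?thesis using that A(3)[OF that(2)] True by (simp add: entry_def f_def)
    qed
    ultimately show ?thesis using that[of D "\<lambda>x. x"] D(2) by blast
  next
    case False
    have tp: "table fL (p + 2) = table fL p" by (simp add: table_def periodic)
    obtain A2 where A2: "nonexpanding A2 (table fL p) (flow fL u (p + 2))" "A2 \<subseteq> table fL u"
      "\<And>x. x \<in> A2 \<Longrightarrow> flow fL u (p + 2) x \<in> table fL p \<and> reach fL u (p + 2) x (flow fL u (p + 2) x)"
      "emeasure lborel (table fL u - A2) = 0" using interval_flow[OF walls(1) times(2)] unfolding tp by auto
    let ?F = "flow fL u (p + 2)"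
    have np: "null_preserving A2 ?F" by (rule nonexpanding_null_preserving[OF A2(1)])
    have "null_preserving (A2 \<inter> ?F -` D) ?F"
    proof -
      have i: "null_preserving D (\<lambda>x. x)"
        unfolding null_preserving_def using D(1) by (auto intro: emeasure_eq_0)
      show ?thesis using null_preserving_comp[OF np i] by (simp add: comp_def)
    qed
    moreover have "emeasure lborel (strip - (A2 \<inter> ?F -` D)) = 0"
    proof -
      have sD: "strip - D \<in> sets borel" using strip D(1) by auto
      have "A2 \<inter> ?F -` (strip - D) \<in> null_sets lborel"
        using null_preservingD(2)[OF np sD] null_preservingD(3)[OF np sD D(2)] by (intro null_setsI) auto
      moreover have "strip - A2 \<in> null_sets lborel" by (rule strip_diff_null[OF nonexpandingD(1)[OF A2(1)] A2(4)])
      ultimately have "(strip - A2) \<union> (A2 \<inter> ?F -` (strip - D)) \<in> null_sets lborel" by blast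
      moreover have "strip - (A2 \<inter> ?F -` D) \<subseteq> (strip - A2) \<union> (A2 \<inter> ?F -` (strip - D))"
      proof
        fix x assume x: "x \<in> strip - (A2 \<inter> ?F -` D)"
        show "x \<in> (strip - A2) \<union> (A2 \<inter> ?F -` (strip - D))"
        proof (cases "x \<in> A2")
          case True
          then have "?F x \<in> strip" using A2(3)[OF True] by (simp add: table_def strip_def)
          then show ?thesis using True x by simp
        qed (use x in simp)
      qed
      moreover have "strip - (A2 \<inter> ?F -` D) \<in> sets lborel"
        using strip nonexpandingD(3)[OF A2(1) D(1)] by auto
      ultimately have "strip - (A2 \<inter> ?F -` D) \<in> null_sets lborel" by (auto intro: null_sets_subset)
      then show ?thesis by auto
    qed
    moreover have "?F s \<in> D \<and> entry n x (?F s)"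
      if s: "s \<in> A2 \<inter> ?F -` D" "x \<in> A" "launch f (pass n) x = s" for x s
    proof -
      have "pass n = u + 2 * real (n div 2)" using False by (auto simp: pass_def elim!: oddE)
      then have "fR (pass n) = fR u" using per(2)[of u "n div 2"] by simp
      then have "table fR (pass n) = table fR u" by (simp add: table_def)
      then have "s \<in> table fR u" "reach fR (fst x) (pass n) (fR (fst x), snd x) s"
        using A(3)[OF s(2)] s(3) False by (simp_all add: f_def)
      moreover have "s \<in> table fL u" using A2(2) s(1) by blast
      moreover have "?F s \<in> table fL p" "reach fL u (p + 2) s (?F s)" using A2(3)[of s] s(1) by auto
      ultimately show ?thesis using s(1) unfolding entry_def if_not_P[OF False] by blast
    qed
    ultimately show ?thesis by (rule that)
  qed
  define Y where "Y = A \<inter> launch f (pass n) -` D'"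
  define E where "E = E' \<circ> launch f (pass n)"
  have 1: "null_preserving Y E" unfolding Y_def E_def by (rule null_preserving_comp[OF A(1) D'(1)])
  have sD: "strip - D' \<in> sets borel" using strip null_preservingD(1)[OF D'(1)] by auto
  have "A \<inter> launch f (pass n) -` (strip - D') \<in> null_sets lborel"
    using null_preservingD(2)[OF A(1) sD] null_preservingD(3)[OF A(1) sD D'(2)] by (intro null_setsI) auto
  moreover have "?B - A \<in> null_sets lborel" using A(4) B null_preservingD(1)[OF A(1)] by (intro null_setsI) auto
  ultimately have "(?B - A) \<union> (A \<inter> launch f (pass n) -` (strip - D')) \<in> null_sets lborel" by blast
  moreover have "?B - Y \<subseteq> (?B - A) \<union> (A \<inter> launch f (pass n) -` (strip - D'))"
  proof
    fix x assume x: "x \<in> ?B - Y"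
    show "x \<in> (?B - A) \<union> (A \<inter> launch f (pass n) -` (strip - D'))"
    proof (cases "x \<in> A")
      case True
      then have "launch f (pass n) x \<in> strip" using A(3)[OF True] by (simp add: table_def strip_def)
      then show ?thesis using True x by (simp add: Y_def)
    qed (use x in blast)
  qed
  moreover have "?B - Y \<in> sets lborel" using B null_preservingD(1)[OF 1] by auto
  ultimately have "?B - Y \<in> null_sets lborel" by (auto intro: null_sets_subset)
  then have 2: "emeasure lborel (?B - Y) = 0" by auto
  have 3: "E x \<in> D \<and> entry n x (E x)" if "x \<in> Y" for x
    using D'(3)[of "launch f (pass n) x" x] that by (simp add: Y_def E_def)
  have 4: "Y \<subseteq> ?B" using A(2) by (auto simp: Y_def)
  show ?thesis using that[OF 1 4 2 3] .
qed

end

context slits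
begin

text \<open>Outside the null set \<open>Z\<close>, growth means that the entry state is eventually
  trapped, which is a Borel condition; on \<open>Z\<close> nothing is claimed about growth.\<close>

lemma core:
  assumes start: "0 < p" "u < 2"
  obtains S Z V where "S \<in> sets borel" "Z \<in> sets borel" "emeasure lborel Z = 0" "1 < V"
    "\<And>x. x \<notin> Z \<Longrightarrow> fst x \<in> {0..<2} \<Longrightarrow> exp_energy_growth lam x0 fL fR (fst x) (snd x) \<longleftrightarrow> x \<in> S"
    "emeasure lborel ({x. fst x \<in> {0..<2} \<and> V < \<bar>snd x\<bar>} - S) = 0"
proof -
  obtain D V r \<rho> C W where d: "0 < V" "1 < r" "0 < \<rho>" "\<rho> < 1" "0 \<le> C" "D \<in> sets borel" "emeasure lborel (strip - D) = 0"
    "\<And>x k. x \<in> D \<Longrightarrow> (period_map ^^ k) x \<in> orbit_states"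
    "\<And>x. x \<in> orbit_states \<Longrightarrow> x \<in> trap V \<Longrightarrow> period_map x \<in> trap V \<and> r * \<bar>snd x\<bar> \<le> \<bar>snd (period_map x)\<bar>"
    "\<And>x. x \<in> orbit_states \<Longrightarrow> period_map x \<notin> trap V \<Longrightarrow> \<bar>snd (period_map x)\<bar> \<le> max V (\<rho> * \<bar>snd x\<bar> + C)"
    "{x \<in> D. \<exists>k. (period_map ^^ k) x \<in> trap V} \<in> sets borel"
    "emeasure lborel {x \<in> D. W < \<bar>snd x\<bar> \<and> (\<forall>k. (period_map ^^ k) x \<notin> trap V)} = 0"
    by (rule section_dynamics) blast
  define N where "N = {x \<in> D. W < \<bar>snd x\<bar> \<and> (\<forall>k. (period_map ^^ k) x \<notin> trap V)}"
  define G where "G = {x \<in> D. \<exists>k. (period_map ^^ k) x \<in> trap V}"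
  have N: "N \<in> sets borel"
  proof -
    have "N = (D - G) \<inter> {x. W < \<bar>snd x\<bar>}" by (auto simp: N_def G_def)
    moreover have "{x::real\<times>real. W < \<bar>snd x\<bar>} \<in> sets borel" by measurable
    ultimately show ?thesis using d(6,11) by (auto simp: G_def)
  qed
  have G: "G \<in> sets borel" unfolding G_def by (rule d(11))
  define Q where "Q = (\<lambda>n Y E. null_preserving Y E \<and> Y \<subseteq> {x. before n < fst x \<and> fst x < pass n} \<and>
    emeasure lborel ({x. before n < fst x \<and> fst x < pass n} - Y) = 0 \<and>
    (\<forall>x\<in>Y. E x \<in> D \<and> entry n x (E x)))"
  have "\<forall>n. \<exists>Y E. Q n Y E"
  proof
    show "\<exists>Y E. Q n Y E" for n
      unfolding Q_def by (rule entry_map[OF d(6,7), of n]) blast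
  qed
  then obtain Y E where "\<And>n. Q n (Y n) (E n)" by metis
  then have Y: "\<And>n. null_preserving (Y n) (E n)" "\<And>n. Y n \<subseteq> {x. before n < fst x \<and> fst x < pass n}"
    "\<And>n. emeasure lborel ({x. before n < fst x \<and> fst x < pass n} - Y n) = 0"
    "\<And>n x. x \<in> Y n \<Longrightarrow> E n x \<in> D \<and> entry n x (E n x)"
    unfolding Q_def by blast+
  define S where "S = (\<Union>n. Y n \<inter> E n -` G)"
  define Z where "Z = (\<Union>n. ({x. before n < fst x \<and> fst x < pass n} - Y n) \<union> {x. fst x = pass n})"
  have S: "S \<in> sets borel" unfolding S_def
    using null_preservingD(2)[OF Y(1) G] by (intro sets.countable_UN' image_subsetI countableI_type)
  have Zn: "Z \<in> null_sets lborel"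
    unfolding Z_def
  proof (intro null_sets_UN null_sets.Un)
    fix n
    have "{x::real\<times>real. before n < fst x \<and> fst x < pass n} \<in> sets borel" by measurable
    then show "{x. before n < fst x \<and> fst x < pass n} - Y n \<in> null_sets lborel"
      using Y(3)[of n] null_preservingD(1)[OF Y(1)] by (intro null_setsI) auto
    show "{x::real\<times>real. fst x = pass n} \<in> null_sets lborel"
      using emeasure_line[of 0 "pass n"] by (intro null_setsI) auto
  qed
  have iff: "exp_energy_growth lam x0 fL fR (fst x) (snd x) \<longleftrightarrow> E n x \<in> G" if x: "x \<in> Y n" for x n
  proof -
    have t: "before n < fst x" "fst x < pass n" using Y(2) x by auto
    have "entry n (fst x, snd x) (E n x)" "E n x \<in> D" using Y(4)[OF x] by auto
    then show ?thesis using growth_iff[OF t _ d(8) d(1-5) d(9,10)] by (simp add: G_def)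
  qed
  have region: "\<exists>n. x \<in> Y n" if "x \<notin> Z" "fst x \<in> {0..<2}" for x
  proof -
    have ne: "fst x \<noteq> pass n" for n using that(1) unfolding Z_def by auto
    \<comment> \<open>One period of launch times is covered by the intervals 0, 1 and 2 and the
      passages between them, because \<open>0 < p\<close> and \<open>u < 2\<close>.\<close>
    have b: "before 0 < fst x" "fst x < pass 2"
      using that(2) start by (auto simp: before_def pass_def)
    have "\<exists>n. before n < fst x \<and> fst x < pass n"
    proof (cases "fst x < pass 0")
      case True
      then show ?thesis using b by blast
    next
      case False
      then have 0: "before 1 < fst x" using ne[of 0] before_Suc[of 0] by simp
      show ?thesis
      proof (cases "fst x < pass 1")
        case True
        then show ?thesis using 0 by blast
      next
        case False
        then have "before 2 < fst x" using ne[of 1] before_Suc[of 1] by (simp add: numeral_2_eq_2)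
        then show ?thesis using b by blast
      qed
    qed
    then show ?thesis using that(1) unfolding Z_def by blast
  qed
  have gS: "exp_energy_growth lam x0 fL fR (fst x) (snd x) \<longleftrightarrow> x \<in> S" if "x \<notin> Z" "fst x \<in> {0..<2}" for x
  proof -
    obtain n where "x \<in> Y n" using region \<open>x \<notin> Z\<close> \<open>fst x \<in> {0..<2}\<close> by blast
    then show ?thesis using iff unfolding S_def by blast
  qed
  define C0 where "C0 = 2 * M + 4 * K"
  \<comment> \<open>Inverts \<open>entry_speed\<close>, so that launches faster than
    \<open>V'\<close> enter faster than \<open>W\<close>; the summand 2 ensures
    \<open>1 < V'\<close>.\<close>
  define V' where "V' = (\<bar>W\<bar> + 2 * C0) / (a * a) + 2"
  have C0: "0 \<le> C0" and a: "0 < a" using f_bounds(5-7) by (simp_all add: C0_def)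
  have "0 \<le> (\<bar>W\<bar> + 2 * C0) / (a * a)" using C0 a by simp
  then have V': "1 < V'" by (simp add: V'_def)
  have fast: "W < \<bar>snd (E n x)\<bar>" if x: "x \<in> Y n" "V' < \<bar>snd x\<bar>" for n x
  proof -
    have t: "before n < fst x" "fst x < pass n" using Y(2) x by auto
    have "entry n (fst x, snd x) (E n x)" using Y(4)[OF x(1)] by auto
    from entry_speed[OF t this] have "a * a * \<bar>snd x\<bar> - 2 * C0 \<le> \<bar>snd (E n x)\<bar>" by (simp add: C0_def)
    moreover have "(\<bar>W\<bar> + 2 * C0) / (a * a) < \<bar>snd x\<bar>" using x(2) by (simp add: V'_def)
    then have "\<bar>W\<bar> + 2 * C0 < a * a * \<bar>snd x\<bar>" using a by (simp add: field_simps)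
    ultimately show ?thesis by linarith
  qed
  have n1: "Z \<union> (\<Union>n. Y n \<inter> E n -` N) \<in> null_sets lborel"
  proof (intro null_sets.Un Zn null_sets_UN)
    fix n
    have "emeasure lborel N = 0" using d(12) by (simp add: N_def)
    then show "Y n \<inter> E n -` N \<in> null_sets lborel"
      using null_preservingD(2,3)[OF Y(1) N] by (intro null_setsI) auto
  qed
  have n2: "{x. fst x \<in> {0..<2} \<and> V' < \<bar>snd x\<bar>} - S \<subseteq> Z \<union> (\<Union>n. Y n \<inter> E n -` N)"
  proof
    fix x assume x: "x \<in> {x. fst x \<in> {0..<2} \<and> V' < \<bar>snd x\<bar>} - S"
    show "x \<in> Z \<union> (\<Union>n. Y n \<inter> E n -` N)"
    proof (cases "x \<in> Z")
      case False
      then obtain n where n: "x \<in> Y n" using region x by blast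
      then have "E n x \<notin> G" "E n x \<in> D" "W < \<bar>snd (E n x)\<bar>" using x Y(4)[OF n] fast[OF n] by (auto simp: S_def)
      then have "E n x \<in> N" unfolding N_def G_def by blast
      then show ?thesis using n by blast
    qed simp
  qed
  have n3: "{x. fst x \<in> {0..<2} \<and> V' < \<bar>snd x\<bar>} - S \<in> sets lborel"
  proof -
    have "{x::real\<times>real. fst x \<in> {0..<2} \<and> V' < \<bar>snd x\<bar>} \<in> sets borel" by measurable
    then show ?thesis using S by auto
  qed
  have "emeasure lborel ({x. fst x \<in> {0..<2} \<and> V' < \<bar>snd x\<bar>} - S) = 0"
    using null_sets_subset[OF n1 n3 n2] by (rule null_setsD1)
  moreover have "Z \<in> sets borel" "emeasure lborel Z = 0" using Zn by auto
  ultimately show ?thesis by (intro that[of S Z V', OF S _ _ V' gS])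
qed

end

section \<open>Turning the table upside down\<close>

lemma slit_orbit_flip:
  assumes walls: "wall a M K fL" "wall a M K fR"
    and o: "slit_orbit lam x0 (\<lambda>t. 1 - fL t) (\<lambda>t. 1 - fR t) t0 v y w"
  shows "slit_orbit lam x0 fL fR t0 (- v) (\<lambda>t. 1 - y t) (\<lambda>t. - w t)"
proof -
  let ?c = "contact lam x0 (\<lambda>t. 1 - fL t) (\<lambda>t. 1 - fR t) y"
  have cur: "current lam x0 (\<lambda>t. 1 - fL t) (\<lambda>t. 1 - fR t) t = 1 - current lam x0 fL fR t" for t
    by (simp add: current_def)
  have curd: "current lam x0 (deriv (\<lambda>t. 1 - fL t)) (deriv (\<lambda>t. 1 - fR t)) t = - current lam x0 (deriv fL) (deriv fR) t" for t
    by (simp add: current_def deriv_flip[OF walls(1)] deriv_flip[OF walls(2)])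
  have con: "contact lam x0 fL fR (\<lambda>t. 1 - y t) t \<longleftrightarrow> ?c t" for t
    by (auto simp: contact_def cur)
  note o' = o[unfolded slit_orbit_def cur curd]
  have init: "y t0 = 1 - current lam x0 fL fR t0" "w t0 = v"
    and range: "\<And>t. t0 \<le> t \<Longrightarrow> 0 \<le> y t \<and> y t \<le> 1"
    and fin: "\<And>b. finite {t. t0 < t \<and> t \<le> b \<and> ?c t}"
    and free: "\<And>s t. t0 \<le> s \<Longrightarrow> s < t \<Longrightarrow> \<forall>r\<in>{s<..<t}. \<not> ?c r \<Longrightarrow> (\<forall>r\<in>{s<..<t}. w r = w s) \<and> y t = y s + w s * (t - s)"
    and wall_refl: "\<And>t. t0 < t \<Longrightarrow> y t = 0 \<or> y t = 1 \<Longrightarrow> \<exists>u. (w \<longlongrightarrow> u) (at_left t) \<and> w t = - u"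
    and slit_refl: "\<And>t. t0 < t \<Longrightarrow> y t = 1 - current lam x0 fL fR t \<Longrightarrow>
       \<exists>u. (w \<longlongrightarrow> u) (at_left t) \<and> w t = - u + 2 * - current lam x0 (deriv fL) (deriv fR) t"
    and sides: "\<And>s t. t0 \<le> s \<Longrightarrow> s < t \<Longrightarrow> \<forall>r\<in>{s..t}. \<not> passage lam x0 r \<Longrightarrow>
       (\<forall>r\<in>{s..t}. 1 - current lam x0 fL fR r \<le> y r) \<or> (\<forall>r\<in>{s..t}. y r \<le> 1 - current lam x0 fL fR r)"
    and pass: "\<And>t. t0 \<le> t \<Longrightarrow> passage lam x0 t \<Longrightarrow> y t \<notin> {0, 1, 1 - fL t, 1 - fR t}"
    using o' by blast+
  show ?thesis
    unfolding slit_orbit_def con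
  proof (intro conjI allI impI)
    show "1 - y t0 = current lam x0 fL fR t0" "- w t0 = - v" using init by auto
    show "finite {t. t0 < t \<and> t \<le> b \<and> ?c t}" for b by (rule fin)
  next
    fix t assume "t0 \<le> t"
    then show "0 \<le> 1 - y t" "1 - y t \<le> 1" using range[of t] by auto
  next
    fix s t assume st: "t0 \<le> s \<and> s < t \<and> (\<forall>r\<in>{s<..<t}. \<not> ?c r)"
    then have f: "(\<forall>r\<in>{s<..<t}. w r = w s) \<and> y t = y s + w s * (t - s)" using free by blast
    then show "\<forall>r\<in>{s<..<t}. - w r = - w s" by simp
    show "1 - y t = 1 - y s + - w s * (t - s)" using f by linarith
  next
    fix t assume t: "t0 < t" "1 - y t = 0 \<or> 1 - y t = 1"
    have "y t = 0 \<or> y t = 1" using t(2) by auto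
    from wall_refl[OF t(1) this] obtain z where "(w \<longlongrightarrow> z) (at_left t)" "w t = - z" by blast
    then show "\<exists>u. ((\<lambda>t. - w t) \<longlongrightarrow> u) (at_left t) \<and> - w t = - u"
      by (intro exI[of _ "- z"]) (auto intro: tendsto_minus)
  next
    fix t assume t: "t0 < t" "1 - y t = current lam x0 fL fR t"
    have "y t = 1 - current lam x0 fL fR t" using t(2) by linarith
    from slit_refl[OF t(1) this] obtain z where "(w \<longlongrightarrow> z) (at_left t)"
      "w t = - z + 2 * - current lam x0 (deriv fL) (deriv fR) t" by blast
    then show "\<exists>u. ((\<lambda>t. - w t) \<longlongrightarrow> u) (at_left t) \<and> - w t = - u + 2 * current lam x0 (deriv fL) (deriv fR) t"
      by (intro exI[of _ "- z"]) (auto intro: tendsto_minus)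
  next
    fix s t assume "t0 \<le> s \<and> s < t \<and> (\<forall>r\<in>{s..t}. \<not> passage lam x0 r)"
    then have "(\<forall>r\<in>{s..t}. 1 - current lam x0 fL fR r \<le> y r) \<or> (\<forall>r\<in>{s..t}. y r \<le> 1 - current lam x0 fL fR r)"
      using sides by blast
    then show "(\<forall>r\<in>{s..t}. current lam x0 fL fR r \<le> 1 - y r) \<or> (\<forall>r\<in>{s..t}. 1 - y r \<le> current lam x0 fL fR r)"
    proof
      assume *: "\<forall>r\<in>{s..t}. 1 - current lam x0 fL fR r \<le> y r"
      have "1 - y r \<le> current lam x0 fL fR r" if "r \<in> {s..t}" for r using bspec[OF * that] by linarith
      then show ?thesis by blast
    next
      assume *: "\<forall>r\<in>{s..t}. y r \<le> 1 - current lam x0 fL fR r"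
      have "current lam x0 fL fR r \<le> 1 - y r" if "r \<in> {s..t}" for r using bspec[OF * that] by linarith
      then show ?thesis by blast
    qed
  next
    fix t assume "t0 \<le> t" "passage lam x0 t"
    then show "1 - y t \<notin> {0, 1, fL t, fR t}" using pass[of t] by auto
  qed
qed

lemma exp_energy_growth_flip:
  assumes walls: "wall a M K fL" "wall a M K fR"
  shows "exp_energy_growth lam x0 (\<lambda>t. 1 - fL t) (\<lambda>t. 1 - fR t) t0 v \<longleftrightarrow> exp_energy_growth lam x0 fL fR t0 (- v)"
proof
  assume "exp_energy_growth lam x0 (\<lambda>t. 1 - fL t) (\<lambda>t. 1 - fR t) t0 v"
  then obtain y w c \<zeta> where o: "slit_orbit lam x0 (\<lambda>t. 1 - fL t) (\<lambda>t. 1 - fR t) t0 v y w" "0 < c" "0 < \<zeta>"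
    "\<forall>\<^sub>F s in at_top. c * exp (\<zeta> * s) \<le> \<bar>w (t0 + s)\<bar>"
    unfolding exp_energy_growth_def by blast
  have "\<forall>\<^sub>F s in at_top. c * exp (\<zeta> * s) \<le> \<bar>- w (t0 + s)\<bar>" using o(4) by simp
  then show "exp_energy_growth lam x0 fL fR t0 (- v)"
    unfolding exp_energy_growth_def using slit_orbit_flip[OF walls o(1)] o(2,3) by blast
next
  assume "exp_energy_growth lam x0 fL fR t0 (- v)"
  then obtain y w c \<zeta> where o: "slit_orbit lam x0 fL fR t0 (- v) y w" "0 < c" "0 < \<zeta>"
    "\<forall>\<^sub>F s in at_top. c * exp (\<zeta> * s) \<le> \<bar>w (t0 + s)\<bar>"
    unfolding exp_energy_growth_def by blast
  have "\<forall>\<^sub>F s in at_top. c * exp (\<zeta> * s) \<le> \<bar>- w (t0 + s)\<bar>" using o(4) by simp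
  moreover have "slit_orbit lam x0 (\<lambda>t. 1 - fL t) (\<lambda>t. 1 - fR t) t0 v (\<lambda>t. 1 - y t) (\<lambda>t. - w t)"
    using slit_orbit_flip[OF wall_flip[OF walls(1)] wall_flip[OF walls(2)], of lam x0 t0 "- v" y w] o(1) by simp
  ultimately show "exp_energy_growth lam x0 (\<lambda>t. 1 - fL t) (\<lambda>t. 1 - fR t) t0 v"
    unfolding exp_energy_growth_def using o(2,3) by blast
qed

section \<open>Uniform constants from smoothness and periodicity\<close>

lemma bounded_periodic:
  fixes g :: "real \<Rightarrow> real"
  assumes "continuous_on UNIV g" and per: "\<And>t. g (t + 2) = g t"
  obtains B where "0 < B" "\<And>t. \<bar>g t\<bar> \<le> B"
proof -
  have "compact (g ` {0..2})"
    using assms(1) by (intro compact_continuous_image) (auto intro: continuous_on_subset)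
  then obtain B where B: "0 < B" "\<And>z. z \<in> g ` {0..2} \<Longrightarrow> norm z \<le> B"
    using compact_imp_bounded bounded_pos by metis
  have "\<bar>g t\<bar> \<le> B" for t
  proof -
    define k where "k = \<lfloor>t / 2\<rfloor>"
    define s where "s = t - 2 * of_int k"
    have k: "of_int k \<le> t / 2" "t / 2 < of_int k + 1" unfolding k_def by linarith+
    then have s: "s \<in> {0..2}" by (simp add: s_def)
    have "g t = g s"
    proof (cases "0 \<le> k")
      case True
      then show ?thesis using periodic_multiple[of g s "nat k"] per by (simp add: s_def)
    next
      case False
      then show ?thesis using periodic_multiple[of g t "nat (- k)"] per by (simp add: s_def)
    qed
    then show ?thesis using B(2)[of "g s"] s by simp
  qed
  then show ?thesis using that B(1) by blast
qed

lemma C1_derivD: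
  fixes f :: "real \<Rightarrow> real"
  assumes "f C1_differentiable_on UNIV"
  shows "(f has_real_derivative deriv f t) (at t)" "continuous_on UNIV (deriv f)"
proof -
  obtain D where D: "\<And>x. (f has_vector_derivative D x) (at x)" "continuous_on UNIV D"
    using assms unfolding C1_differentiable_on_def by auto
  have d: "(f has_real_derivative D x) (at x)" for x
    using D(1) by (simp add: has_real_derivative_iff_has_vector_derivative)
  have "deriv f = D" using DERIV_imp_deriv[OF d] by blast
  then show "(f has_real_derivative deriv f t) (at t)" "continuous_on UNIV (deriv f)" using d D(2) by auto
qed

lemma C1_deriv_periodic:
  fixes f :: "real \<Rightarrow> real"
  assumes "f C1_differentiable_on UNIV" "\<And>t. f (t + 2) = f t"
  shows "deriv f (t + 2) = deriv f t"
proof -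
  have "((\<lambda>s. f (s + 2)) has_real_derivative deriv f (t + 2)) (at t)"
    using C1_derivD(1)[OF assms(1), of "t + 2"] by (simp only: DERIV_shift)
  then show ?thesis unfolding assms(2) by (rule DERIV_imp_deriv[symmetric])
qed

lemma C2_wall:
  fixes f :: "real \<Rightarrow> real"
  assumes f: "C2 f" and range: "\<And>t. 0 < f t \<and> f t < 1" and per: "\<And>t. f (t + 2) = f t"
  obtains a M K where "wall a M K f"
proof -
  have C1: "f C1_differentiable_on UNIV" "deriv f C1_differentiable_on UNIV" using f by (auto simp: C2_def)
  note d1 = C1_derivD[OF C1(1)] and d2 = C1_derivD[OF C1(2)]
  have p1: "deriv f (t + 2) = deriv f t" for t by (rule C1_deriv_periodic[OF C1(1) per])
  have p2: "deriv (deriv f) (t + 2) = deriv (deriv f) t" for t by (rule C1_deriv_periodic[OF C1(2) p1])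
  obtain M where M: "0 < M" "\<And>t. \<bar>deriv f t\<bar> \<le> M" using bounded_periodic[OF d1(2) p1] by blast
  obtain K where K: "0 < K" "\<And>t. \<bar>deriv (deriv f) t\<bar> \<le> K" using bounded_periodic[OF d2(2) p2] by blast
  have cf: "continuous_on UNIV f"
    by (intro continuous_at_imp_continuous_on ballI DERIV_isCont[OF d1(1)])
  have ne: "f t \<noteq> 0" "1 - f t \<noteq> 0" for t using range[of t] by auto
  \<comment> \<open>Bounding the reciprocals of both distances turns the boundedness of periodic
    functions into a positive margin \<open>a\<close>.\<close>
  have c1: "continuous_on UNIV (\<lambda>t. 1 / f t)" "continuous_on UNIV (\<lambda>t. 1 / (1 - f t))"
    using cf ne by (auto intro!: continuous_intros)
  obtain A where A: "0 < A" "\<And>t. \<bar>1 / f t\<bar> \<le> A" using bounded_periodic[OF c1(1)] per by auto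
  obtain B where B: "0 < B" "\<And>t. \<bar>1 / (1 - f t)\<bar> \<le> B" using bounded_periodic[OF c1(2)] per by auto
  define a where "a = min (1 / A) (1 / B)"
  have a: "0 < a" "a \<le> 1 / A" "a \<le> 1 / B" using A B by (auto simp: a_def)
  have b: "a \<le> f t" "f t \<le> 1 - a" for t
  proof -
    have "1 / f t \<le> A" "1 / (1 - f t) \<le> B" using A(2)[of t] B(2)[of t] range[of t] by simp_all
    then have "1 / A \<le> f t" "1 / B \<le> 1 - f t" using range[of t] A(1) B(1) by (simp_all add: field_simps)
    then show "a \<le> f t" "f t \<le> 1 - a" using a by linarith+
  qed
  have lip: "\<bar>deriv f s - deriv f t\<bar> \<le> K * \<bar>s - t\<bar>" for s t
    using field_differentiable_bound[of UNIV "deriv f" "deriv (deriv f)" K s t] d2(1) K(2)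
    by (auto simp: dist_norm)
  show ?thesis
    by (rule that[of a M K]) (use a M K d1(1) b lip in \<open>auto simp: wall_def\<close>)
qed

lemma wall_mono:
  assumes "wall a M K f" "0 < a'" "a' \<le> a" "M \<le> M'" "K \<le> K'"
  shows "wall a' M' K' f"
proof -
  have w: "0 \<le> M" "0 \<le> K" "(f has_real_derivative deriv f t) (at t)" "a \<le> f t" "f t \<le> 1 - a" "\<bar>deriv f t\<bar> \<le> M"
    "\<bar>deriv f s - deriv f t\<bar> \<le> K * \<bar>s - t\<bar>" for s t
    using assms(1) unfolding wall_def by blast+
  have "\<bar>deriv f s - deriv f t\<bar> \<le> K' * \<bar>s - t\<bar>" for s t
    using w(7)[of s t] mult_right_mono[OF assms(5), of "\<bar>s - t\<bar>"] by simp
  moreover have "a' \<le> f t" "f t \<le> 1 - a'" "\<bar>deriv f t\<bar> \<le> M'" for t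
    using w(4,5,6)[of t] assms by linarith+
  ultimately show ?thesis using assms w(1-3) unfolding wall_def by auto
qed

text \<open>The exceptional set is Borel up to a subset of the null set \<open>Z\<close>, and such a
  subset is Lebesgue measurable by completeness. The Borel part lies in a box together with a null
  set, hence has finite measure.\<close>

lemma measure_conclusion:
  fixes g :: "real \<Rightarrow> real \<Rightarrow> bool"
  assumes S: "S \<in> sets borel" and Z: "Z \<in> sets borel" "emeasure lborel Z = 0" and V: "1 < V"
    and iff: "\<And>x. x \<notin> Z \<Longrightarrow> fst x \<in> {0..<2} \<Longrightarrow> g (fst x) (snd x) \<longleftrightarrow> x \<in> S"
    and null: "emeasure lborel ({x. fst x \<in> {0..<2} \<and> V < \<bar>snd x\<bar>} - S) = 0"
  shows "(\<exists>V>1. AE (t0, v0) in lebesgue. t0 \<in> {0..<2} \<and> \<bar>v0\<bar> > V \<longrightarrow> g t0 v0) \<and>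
    {(t0, v0). t0 \<in> {0..<2} \<and> \<not> g t0 v0} \<in> lmeasurable"
proof
  define X where "X = {x::real\<times>real. fst x \<in> {0..<2}}"
  have X: "X \<in> sets borel" unfolding X_def by measurable
  define F where "F = {x. fst x \<in> {0..<2} \<and> V < \<bar>snd x\<bar>} - S"
  have "{x::real\<times>real. fst x \<in> {0..<2} \<and> V < \<bar>snd x\<bar>} \<in> sets borel" by measurable
  then have F: "F \<in> null_sets lborel" using S null unfolding F_def by (intro null_setsI) auto
  have Zn: "Z \<in> null_sets lborel" using Z by auto
  have "AE x in lborel. x \<notin> Z \<and> x \<notin> F" using AE_not_in[OF Zn] AE_not_in[OF F] by eventually_elim simp
  then have "AE x in lebesgue. x \<notin> Z \<and> x \<notin> F" by (rule AE_completion)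
  then have "AE x in lebesgue. case x of (t0, v0) \<Rightarrow> t0 \<in> {0..<2} \<and> \<bar>v0\<bar> > V \<longrightarrow> g t0 v0"
  proof eventually_elim
    case (elim x)
    obtain t v where x: "x = (t, v)" by force
    then show ?case using elim iff[of x] by (auto simp: F_def)
  qed
  then show "\<exists>V>1. AE (t0, v0) in lebesgue. t0 \<in> {0..<2} \<and> \<bar>v0\<bar> > V \<longrightarrow> g t0 v0" using V by blast
  define B where "B = {(t0, v0). t0 \<in> {0..<2} \<and> \<not> g t0 v0}"
  have B: "B = (X - S - Z) \<union> (B \<inter> Z)"
  proof (intro set_eqI)
    fix x :: "real \<times> real"
    obtain t v where "x = (t, v)" by force
    then show "x \<in> B \<longleftrightarrow> x \<in> (X - S - Z) \<union> (B \<inter> Z)" using iff[of x] by (auto simp: B_def X_def)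
  qed
  have XS: "X - S - Z \<in> sets borel" using X S Z by auto
  have "X - S - Z \<in> lmeasurable"
  proof (rule fmeasurableI)
    show "X - S - Z \<in> sets lebesgue" using XS by simp
    have sub: "X - S - Z \<subseteq> cbox (0, - V) (2, V) \<union> F"
    proof
      fix x assume x: "x \<in> X - S - Z"
      show "x \<in> cbox (0, - V) (2, V) \<union> F"
      proof (cases "V < \<bar>snd x\<bar>")
        case True
        then show ?thesis using x by (simp add: F_def X_def)
      next
        case False
        then have "x \<in> cbox (0, - V) (2, V)" using x by (cases x) (auto simp: X_def cbox_Pair_eq abs_le_iff)
        then show ?thesis by simp
      qed
    qed
    have "emeasure lebesgue (X - S - Z) = emeasure lborel (X - S - Z)" using XS by simp
    also have "\<dots> \<le> emeasure lborel (cbox (0::real, - V) (2, V) \<union> F)"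
      using F by (intro emeasure_mono sub) auto
    also have "\<dots> \<le> emeasure lborel (cbox (0::real, - V) (2, V)) + emeasure lborel F"
      using F by (intro emeasure_subadditive) auto
    also have "\<dots> = emeasure lborel (cbox (0::real, - V) (2, V))" using F by auto
    also have "\<dots> < \<infinity>" by (rule emeasure_lborel_cbox_finite)
    finally show "emeasure lebesgue (X - S - Z) < \<infinity>" .
  qed
  moreover have "B \<inter> Z \<in> lmeasurable"
  proof -
    have "B \<inter> Z \<in> null_sets lebesgue"
      by (rule null_sets_completion_subset[of _ Z]) (use Zn in \<open>auto intro: null_sets_completionI\<close>)
    then show ?thesis by (intro fmeasurableI_null_sets)
  qed
  ultimately show "{(t0, v0). t0 \<in> {0..<2} \<and> \<not> g t0 v0} \<in> lmeasurable"
    using B unfolding B_def[symmetric] by (metis fmeasurable.Un)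
qed

theorem theorem1:
  fixes lam x0 :: real and fL fR :: "real \<Rightarrow> real"
  assumes lam: "0 < lam" "lam < 1" and x0: "0 \<le> x0" "x0 < lam"
    and smooth: "C2 fL" "C2 fR"
    and range: "\<And>t. 0 < fL t \<and> fL t < 1" "\<And>t. 0 < fR t \<and> fR t < 1"
    and periodic: "\<And>t. fL (t + 2) = fL t" "\<And>t. fR (t + 2) = fR t"
    and order:
      "(fL (t1 lam x0) < fR (t1 lam x0) \<and> fL (t2 lam x0) > fR (t2 lam x0)) \<or>
       (fL (t1 lam x0) > fR (t1 lam x0) \<and> fL (t2 lam x0) < fR (t2 lam x0))"
  shows "(\<exists>V>1. AE (t0, v0) in lebesgue.
            t0 \<in> {0..<2} \<and> \<bar>v0\<bar> > V \<longrightarrow> exp_energy_growth lam x0 fL fR t0 v0) \<and>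
         {(t0, v0). t0 \<in> {0..<2} \<and> \<not> exp_energy_growth lam x0 fL fR t0 v0} \<in> lmeasurable"
proof -
  obtain a M K where wL': "wall a M K fL" using C2_wall[OF smooth(1) range(1) periodic(1)] .
  obtain a' M' K' where wR': "wall a' M' K' fR" using C2_wall[OF smooth(2) range(2) periodic(2)] .
  \<comment> \<open>Both slits are given the weaker of their constants, as \<open>switching\<close>
    uses one set for both.\<close>
  define b N L where "b = min a a'" and "N = max M M'" and "L = max K K'"
  have b: "0 < b" using wL' wR' by (simp add: b_def wall_def)
  have wL: "wall b N L fL" by (rule wall_mono[OF wL' b]) (simp_all add: b_def N_def L_def)
  have wR: "wall b N L fR" by (rule wall_mono[OF wR' b]) (simp_all add: b_def N_def L_def)
  have tt: "t1 lam x0 < t2 lam x0" "t2 lam x0 < t1 lam x0 + 2" "0 < t1 lam x0" "t2 lam x0 < 2"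
    using lam x0 by (auto simp: t1_def t2_def)
  from order show ?thesis
  proof
    assume o: "fL (t1 lam x0) < fR (t1 lam x0) \<and> fL (t2 lam x0) > fR (t2 lam x0)"
    interpret slits b N L fL fR lam x0
      by unfold_locales (use wL wR tt periodic o in auto)
    obtain S Z V where "S \<in> sets borel" "Z \<in> sets borel" "emeasure lborel Z = 0" "1 < V"
      "\<And>x. x \<notin> Z \<Longrightarrow> fst x \<in> {0..<2} \<Longrightarrow> exp_energy_growth lam x0 fL fR (fst x) (snd x) \<longleftrightarrow> x \<in> S"
      "emeasure lborel ({x. fst x \<in> {0..<2} \<and> V < \<bar>snd x\<bar>} - S) = 0"
      using core[OF tt(3,4)] by blast
    then show ?thesis by (rule measure_conclusion)
  next
    assume o: "fL (t1 lam x0) > fR (t1 lam x0) \<and> fL (t2 lam x0) < fR (t2 lam x0)"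
    interpret slits b N L "\<lambda>t. 1 - fL t" "\<lambda>t. 1 - fR t" lam x0
      by unfold_locales (use wall_flip[OF wL] wall_flip[OF wR] tt periodic o in auto)
    obtain S Z V where c: "S \<in> sets borel" "Z \<in> sets borel" "emeasure lborel Z = 0" "1 < V"
      "\<And>x. x \<notin> Z \<Longrightarrow> fst x \<in> {0..<2} \<Longrightarrow>
         exp_energy_growth lam x0 (\<lambda>t. 1 - fL t) (\<lambda>t. 1 - fR t) (fst x) (snd x) \<longleftrightarrow> x \<in> S"
      "emeasure lborel ({x. fst x \<in> {0..<2} \<and> V < \<bar>snd x\<bar>} - S) = 0"
      using core[OF tt(3,4)] by blast
    \<comment> \<open>A launch from the turned slit has the opposite velocity. So the sets found for
      the turned table are pulled back by reversing \<open>v\<close>, which keeps null sets null and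
      leaves the speed unchanged.\<close>
    let ?r = "\<lambda>x::real \<times> real. (fst x, - snd x)"
    have np: "null_preserving UNIV ?r" using null_preserving_reverse[of UNIV] by simp
    have r: "?r -` B \<in> sets borel" if "B \<in> sets borel" for B using null_preservingD(2)[OF np that] by simp
    have r0: "emeasure lborel (?r -` B) = 0" if "B \<in> sets borel" "emeasure lborel B = 0" for B
      using null_preservingD(3)[OF np that] by simp
    show ?thesis
    proof (rule measure_conclusion[OF r[OF c(1)] r[OF c(2)] r0[OF c(2,3)] c(4)])
      fix x assume "x \<notin> ?r -` Z" "fst x \<in> {0..<2}"
      then show "exp_energy_growth lam x0 fL fR (fst x) (snd x) \<longleftrightarrow> x \<in> ?r -` S"
        using c(5)[of "?r x"] exp_energy_growth_flip[OF wL wR, of lam x0 "fst x" "- snd x"] by simp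
    next
      let ?X = "{x::real\<times>real. fst x \<in> {0..<2} \<and> V < \<bar>snd x\<bar>}"
      have "?X \<in> sets borel" by measurable
      then have "emeasure lborel (?r -` (?X - S)) = 0" using c(1,6) by (intro r0) auto
      moreover have "?r -` (?X - S) = ?X - ?r -` S" by auto
      ultimately show "emeasure lborel (?X - ?r -` S) = 0" by simp
    qed
  qed
qed

end
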